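(* Let $u_0,u_1$ be $C^\infty$ vector fields on the torus $\mathbb{T}^2=\mathbb{R}^2/\mathbb{Z}^2$. Suppose that each of $u_0$ and $u_1$ satisfies the conjugacy condition (Condition A) and that the pair $(u_0,u_1)$ satisfies the transversality condition (Condition B). Then for every switching rate $\lambda>0$, the invariant densities $\rho_0$ and $\rho_1$ of the associated switching process admit $C^\infty$ representatives.
   Context: Condition A (conjugacy condition): a smooth vector field $u$ on $\mathbb{T}^2$ satisfies Condition A if the flow generated by $u$ has an invariant measure with an everywhere positive $C^\infty$ density with respect to Lebesgue measure, and has no periodic orbits and no fixed points. Condition B (transversality/ellipticity condition): a pair $(u,v)$ of smooth vector fields on $\mathbb{T}^2$ satisfies Condition B if for every $x\in\mathbb{T}^2$ the vectors $u(x)$ and $v(x)$ span the tangent space $T_x\mathbb{T}^2\cong\mathbb{R}^2$. Switching process: for $i\in\{0,1\}$ let $\Phi_i^t$, $t\in\mathbb{R}$, be the flow on $\mathbb{T}^2$ generated by $u_i$, i.e. $t\mapsto\Phi_i^t(x)$ solves $\dot x(t)=u_i(x(t))$, $x(0)=x$. Given a starting point $(x,i)\in\mathbb{T}^2\times\{0,1\}$, the process $X$ follows the flow $t\mapsto\Phi_i^t(x)$ for an exponentially distributed time with parameter $\lambda$, then switches to following the flow of $u_{1-i}$ from the point reached, for another exponential time with parameter $\lambda$, then switches back to $u_i$, and so on; all times between consecutive switches are i.i.d. exponential with parameter $\lambda$. Let $A_t\in\{0,1\}$ be the index of the driving vector field at time $t$. Then $(X,A)$ is a Markov process on $\mathbb{T}^2\times\{0,1\}$,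 with transition probabilities denoted $\mathsf{P}^t_{x,i}$. A probability measure $\mu$ on $\mathbb{T}^2\times\{0,1\}$ is invariant if $$\mu(E\times\{i\})=\sum_{j\in\{0,1\}}\int_{\mathbb{T}^2}\mathsf{P}^t_{x,j}(E\times\{i\})\,\mu(dx\times\{j\})$$ for all Borel $E\subset\mathbb{T}^2$, $i\in\{0,1\}$, $t\ge0$. Under Conditions A (for $u_0$ and for $u_1$) and B (for the pair) it is known that there is a unique invariant measure $\mu$ and that it is absolutely continuous with respect to the product of Lebesgue measure on $\mathbb{T}^2$ and counting measure on $\{0,1\}$. Put $\mu_i(E)=\mu(E\times\{i\})$; the invariant density $\rho_i$ is the density of $\mu_i$ with respect to Lebesgue measure on $\mathbb{T}^2$. *)

theory Defs
  imports "HOL-Probability.Probability" "HOL-Library.Z2"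
begin

section \<open>The torus\<close>

definition lattice_equiv :: "real^2 \<Rightarrow> real^2 \<Rightarrow> bool" where
  "lattice_equiv x y \<longleftrightarrow> (\<forall>k. x $ k - y $ k \<in> \<int>)"

quotient_type torus = "real^2" / lattice_equiv
  morphisms rep_torus torus_proj
proof (rule equivpI)
  show "reflp lattice_equiv"
    by (auto simp: reflp_def lattice_equiv_def)
  show "symp lattice_equiv"
    unfolding symp_def lattice_equiv_def by (metis Ints_minus minus_diff_eq)
  show "transp lattice_equiv"
    unfolding transp_def lattice_equiv_def
    by (metis Ints_add diff_add_cancel add_diff_eq)
qed

instantiation torus :: topological_space
begin

definition open_torus :: "torus set \<Rightarrow> bool" where
  "open_torus U \<longleftrightarrow> open (torus_proj -` U)"

instance
proof
  show "open (UNIV :: torus set)"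
    by (simp add: open_torus_def)
  show "open (S \<inter> T)" if "open S" "open T" for S T :: "torus set"
    using that by (auto simp: open_torus_def)
  show "open (\<Union>K)" if "\<forall>S\<in>K. open S" for K :: "torus set set"
    using that by (auto simp: open_torus_def vimage_Union)
qed

end

definition torus_lebesgue :: "torus measure" where
  "torus_lebesgue =
     distr (restrict_space lborel {x :: real^2. \<forall>k. 0 \<le> x $ k \<and> x $ k < 1}) borel torus_proj"


section \<open>Smooth functions\<close>

primrec C_k :: "nat \<Rightarrow> ('a::euclidean_space \<Rightarrow> 'b::euclidean_space) \<Rightarrow> bool" where
  "C_k 0 f \<longleftrightarrow> continuous_on UNIV f"
| "C_k (Suc n) f \<longleftrightarrow>
     (\<forall>x. f differentiable (at x)) \<and> (\<forall>v. C_k n (\<lambda>x. frechet_derivative f (at x) v))"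

definition C_infinity :: "('a::euclidean_space \<Rightarrow> 'b::euclidean_space) \<Rightarrow> bool" where
  "C_infinity f \<longleftrightarrow> (\<forall>n. C_k n f)"

definition torus_smooth :: "(torus \<Rightarrow> 'b::euclidean_space) \<Rightarrow> bool" where
  "torus_smooth f \<longleftrightarrow> C_infinity (\<lambda>x. f (torus_proj x))"


section \<open>Vector fields and their flows\<close>

text \<open>The tangent spaces of the torus are all identified with \<open>\<real>\<^sup>2\<close>, so a vector field
  is a map from the torus to \<open>\<real>\<^sup>2\<close>.  A curve on the torus is differentiated by lifting it
  to \<open>\<real>\<^sup>2\<close>; every continuous curve has a lift, unique up to translation by \<open>\<int>\<^sup>2\<close>.\<close>

type_synonym vector_field = "torus \<Rightarrow> real^2"

definition integral_curve :: "vector_field \<Rightarrow> (real \<Rightarrow> torus) \<Rightarrow> bool" where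
  "integral_curve u \<gamma> \<longleftrightarrow>
     (\<exists>c. (\<forall>t. \<gamma> t = torus_proj (c t)) \<and> (\<forall>t. (c has_vector_derivative u (\<gamma> t)) (at t)))"

text \<open>For a smooth \<open>u\<close> there is exactly one integral curve through each point: it is
  defined for all times because the torus is compact.\<close>

definition flow :: "vector_field \<Rightarrow> real \<Rightarrow> torus \<Rightarrow> torus" where
  "flow u t x = (THE \<gamma>. integral_curve u \<gamma> \<and> \<gamma> 0 = x) t"

definition fixed_point :: "vector_field \<Rightarrow> torus \<Rightarrow> bool" where
  "fixed_point u x \<longleftrightarrow> (\<forall>t. flow u t x = x)"

definition on_periodic_orbit :: "vector_field \<Rightarrow> torus \<Rightarrow> bool" where
  "on_periodic_orbit u x \<longleftrightarrow> \<not> fixed_point u x \<and> (\<exists>T>0. flow u T x = x)"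

definition flow_invariant :: "vector_field \<Rightarrow> torus measure \<Rightarrow> bool" where
  "flow_invariant u M \<longleftrightarrow> (\<forall>t. distr M borel (flow u t) = M)"

definition condition_A :: "vector_field \<Rightarrow> bool" where
  "condition_A u \<longleftrightarrow>
     (\<exists>h :: torus \<Rightarrow> real. torus_smooth h \<and> (\<forall>x. 0 < h x) \<and>
        flow_invariant u (density torus_lebesgue (\<lambda>x. ennreal (h x)))) \<and>
     (\<forall>x. \<not> on_periodic_orbit u x) \<and>
     (\<forall>x. \<not> fixed_point u x)"

definition condition_B :: "vector_field \<Rightarrow> vector_field \<Rightarrow> bool" where
  "condition_B u v \<longleftrightarrow> (\<forall>x. span {u x, v x} = UNIV)"


section \<open>The switching process\<close>

text \<open>The index set \<open>{0,1}\<close> is the two-element type \<open>bit\<close>, in which \<open>1 - i\<close> is the other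
  index.  The argument \<open>\<tau>\<close> is the sequence of times between consecutive switches.\<close>

primrec state_after_switches ::
  "(bit \<Rightarrow> vector_field) \<Rightarrow> torus \<times> bit \<Rightarrow> (nat \<Rightarrow> real) \<Rightarrow> nat \<Rightarrow> torus \<times> bit" where
  "state_after_switches u s \<tau> 0 = s"
| "state_after_switches u s \<tau> (Suc n) =
     (let (x, i) = state_after_switches u s \<tau> n in (flow (u i) (\<tau> n) x, 1 - i))"

definition switch_time :: "(nat \<Rightarrow> real) \<Rightarrow> nat \<Rightarrow> real" where
  "switch_time \<tau> n = (\<Sum>k<n. \<tau> k)"

definition switch_count :: "(nat \<Rightarrow> real) \<Rightarrow> real \<Rightarrow> nat" where
  "switch_count \<tau> t = (LEAST n. t < switch_time \<tau> (Suc n))"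

text \<open>The pair \<open>(X, A)\<close> at time \<open>t\<close>, started from \<open>s\<close>.  The set of those \<open>\<tau>\<close> for which
  \<open>switch_count\<close> is not meaningful (the switch times stay bounded) is a null set.\<close>

definition switching_process ::
  "(bit \<Rightarrow> vector_field) \<Rightarrow> torus \<times> bit \<Rightarrow> (nat \<Rightarrow> real) \<Rightarrow> real \<Rightarrow> torus \<times> bit" where
  "switching_process u s \<tau> t =
     (let n = switch_count \<tau> t; (x, i) = state_after_switches u s \<tau> n
      in (flow (u i) (t - switch_time \<tau> n) x, i))"

definition waiting_times :: "real \<Rightarrow> (nat \<Rightarrow> real) measure" where
  "waiting_times r =
     (\<Pi>\<^sub>M k\<in>UNIV. density lborel (\<lambda>s. ennreal (exponential_density r s)))"

definition state_space :: "(torus \<times> bit) measure" where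
  "state_space = borel \<Otimes>\<^sub>M count_space UNIV"

definition transition_prob ::
  "(bit \<Rightarrow> vector_field) \<Rightarrow> real \<Rightarrow> real \<Rightarrow> torus \<Rightarrow> bit \<Rightarrow> (torus \<times> bit) measure" where
  "transition_prob u r t x i =
     distr (waiting_times r) state_space (\<lambda>\<tau>. switching_process u (x, i) \<tau> t)"

text \<open>\<open>component_measure \<mu> i\<close> is the measure that sends \<open>E\<close> to \<open>\<mu> (E \<times> {i})\<close>.\<close>

definition component_measure :: "(torus \<times> bit) measure \<Rightarrow> bit \<Rightarrow> torus measure" where
  "component_measure \<mu> i = distr (restrict_space \<mu> (UNIV \<times> {i})) borel fst"

lemma emeasure_component_measure:
  assumes "sets \<mu> = sets state_space" "E \<in> sets borel"
  shows "emeasure (component_measure \<mu> i) E = emeasure \<mu> (E \<times> {i})"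
proof -
  have slice: "F \<times> {i} \<in> sets \<mu>" if "F \<in> sets borel" for F
    using that by (simp add: assms(1) state_space_def pair_measureI)
  have space: "space \<mu> = UNIV"
    using sets_eq_imp_space_eq[OF assms(1)] by (simp add: state_space_def space_pair_measure)
  have "fst \<in> \<mu> \<rightarrow>\<^sub>M borel"
    unfolding measurable_cong_sets[OF assms(1) refl] state_space_def by (rule measurable_fst)
  then have "fst \<in> restrict_space \<mu> (UNIV \<times> {i}) \<rightarrow>\<^sub>M borel"
    by (rule measurable_restrict_space1)
  then have "emeasure (component_measure \<mu> i) E =
      emeasure (restrict_space \<mu> (UNIV \<times> {i})) (E \<times> {i})"
    using assms(2) unfolding component_measure_def
    by (subst emeasure_distr) (auto simp: space_restrict_space space intro!: arg_cong2[where f = emeasure])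
  also have "\<dots> = emeasure \<mu> (E \<times> {i})"
    using slice[of UNIV] by (subst emeasure_restrict_space) (auto simp: space)
  finally show ?thesis .
qed

definition invariant_measure ::
  "(bit \<Rightarrow> vector_field) \<Rightarrow> real \<Rightarrow> (torus \<times> bit) measure \<Rightarrow> bool" where
  "invariant_measure u r \<mu> \<longleftrightarrow>
     prob_space \<mu> \<and> sets \<mu> = sets state_space \<and>
     (\<forall>t\<ge>0. \<forall>E\<in>sets borel. \<forall>i.
        emeasure \<mu> (E \<times> {i}) =
          (\<Sum>j\<in>{0, 1}. \<integral>\<^sup>+ x. emeasure (transition_prob u r t x j) (E \<times> {i}) \<partial>component_measure \<mu> j))"

definition invariant_densities ::
  "(bit \<Rightarrow> vector_field) \<Rightarrow> real \<Rightarrow> (bit \<Rightarrow> torus \<Rightarrow> real) \<Rightarrow> bool" where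
  "invariant_densities u r \<rho> \<longleftrightarrow>
     (\<exists>\<mu>. invariant_measure u r \<mu> \<and>
        (\<forall>i. \<rho> i \<in> borel_measurable borel \<and> (\<forall>x. 0 \<le> \<rho> i x) \<and>
           component_measure \<mu> i = density torus_lebesgue (\<lambda>x. ennreal (\<rho> i x))))"

end

theory Submission
  imports Defs "HOL-Library.Nat_Bijection"
begin

text \<open>Write \<open>X\<close> for the vector field driving one component, \<open>h\<close> for the density that its flow preserves and
  \<open>\<rho>\<close>, \<open>\<rho>'\<close> for the densities of this and of the other component.  Over a short time the process switches at
  most once, up to probability \<open>O(t\<^sup>2)\<close>, so invariance gives the stationary equation
  \<open>div (\<rho> X) = r (\<rho>' - \<rho>)\<close> in the weak sense (\<open>stationary_equation\<close>).  Since the flow preserves \<open>h dx\<close>, this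
  says that \<open>\<rho> / h\<close> is the average of \<open>\<rho>' / h\<close> over the backward flow of \<open>X\<close>, taken at an exponential time
  (\<open>push\<close>).  This operator smooths only along \<open>X\<close>; regularity across \<open>X\<close> has to come from the other
  equation.

  Both directions can be controlled because a flow on the torus that preserves a positive density and has no
  fixed points hardly stretches.  Let \<open>w\<close> be the multiple of the other vector field with \<open>h det (X, w) = 1\<close>.  Then
  \<open>[X, w] = g X\<close> with a smooth function \<open>g\<close> (\<open>bracket_eq\<close>): the flow keeps \<open>X\<close> and moves \<open>w\<close> to \<open>w\<close> plus a
  multiple of \<open>X\<close> that grows at most linearly in time (\<open>flow_lift_has_derivative\<close>).  Hence the exponential
  average of a \<open>C\<^sup>1\<close> function is \<open>C\<^sup>1\<close> for every rate \<open>r > 0\<close>, and commuting \<open>w\<close> with the average leaves only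
  terms without derivatives (\<open>average_Lie_w\<close>), because derivatives along \<open>X\<close> can be integrated by parts in
  time.

  By duality, \<open>push\<close> preserves the classes of functions all of whose weak derivatives up to order \<open>k\<close> are
  integrable (\<open>push_sobolev\<close>).  The crucial gain is that of a full order as soon as the argument has one more
  derivative along the other vector field only (\<open>push_gain\<close>).  The argument \<open>\<rho>' / h\<close> has it: by its own
  stationary equation, \<open>\<rho>'\<close> has a derivative along the other field that is a combination of \<open>\<rho>\<close> and \<open>\<rho>'\<close>.  So
  both densities climb through all orders together.  Their Fourier coefficients then decay faster than every
  power, the Fourier series is a smooth function, and it agrees with the density almost everywhere
  (\<open>smooth_if_all_sobolev\<close>).\<close>

section \<open>Differential calculus of the classes \<open>C_k\<close>\<close>

lemma C_k_SucD_derivative: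
  "C_k (Suc n) f \<Longrightarrow> (f has_derivative frechet_derivative f (at x)) (at x)"
  by (simp add: frechet_derivative_works)

lemma C_k_SucI:
  assumes "\<And>x. (f has_derivative f' x) (at x)" "\<And>v. C_k n (\<lambda>x. f' x v)"
  shows "C_k (Suc n) f"
proof -
  have "frechet_derivative f (at x) = f' x" for x
    using frechet_derivative_at[OF assms(1)] by simp
  then show ?thesis
    using assms by (auto simp: differentiable_def)
qed

lemma C_k_Suc_lower: "C_k (Suc n) f \<Longrightarrow> C_k n f"
proof (induction n arbitrary: f)
  case 0
  then show ?case
    by (auto simp: continuous_on_eq_continuous_at differentiable_imp_continuous_within)
next
  case (Suc n)
  then show ?case by (metis C_k.simps(2))
qed

lemma C_k_mono: "m \<le> n \<Longrightarrow> C_k n f \<Longrightarrow> C_k m f"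
  by (induction n) (auto simp: le_Suc_eq simp del: C_k.simps dest: C_k_Suc_lower)

lemma C_k_continuous: "C_k n f \<Longrightarrow> continuous_on A f"
  using C_k_mono[of 0 n f] continuous_on_subset by auto

lemma C_k_const: "C_k n (\<lambda>x. c)"
proof (induction n arbitrary: c)
  case (Suc n)
  show ?case by (rule C_k_SucI[where f' = "\<lambda>x v. 0"]) (auto intro: Suc)
qed auto

lemma C_k_add: "C_k n f \<Longrightarrow> C_k n g \<Longrightarrow> C_k n (\<lambda>x. f x + g x)"
proof (induction n arbitrary: f g)
  case (Suc n)
  show ?case
    by (rule C_k_SucI[OF has_derivative_add[OF C_k_SucD_derivative[OF Suc.prems(1)]
          C_k_SucD_derivative[OF Suc.prems(2)]]]) (use Suc in auto)
qed (auto intro: continuous_intros)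

lemma C_k_sum: "(\<And>i. i \<in> I \<Longrightarrow> C_k n (f i)) \<Longrightarrow> C_k n (\<lambda>x. \<Sum>i\<in>I. f i x)"
  by (induction I rule: infinite_finite_induct) (auto intro: C_k_const C_k_add)

lemma C_k_bounded_linear:
  assumes "bounded_linear h"
  shows "C_k n f \<Longrightarrow> C_k n (\<lambda>x. h (f x))"
proof (induction n arbitrary: f)
  case 0
  then show ?case using assms
    by (auto intro: continuous_on_compose2[OF linear_continuous_on])
next
  case (Suc n)
  show ?case
    by (rule C_k_SucI[OF bounded_linear.has_derivative[OF assms C_k_SucD_derivative[OF Suc.prems]]])
      (use Suc in auto)
qed

lemma C_k_bounded_bilinear:
  assumes "bounded_bilinear bop"
  shows "C_k n f \<Longrightarrow> C_k n g \<Longrightarrow> C_k n (\<lambda>x. bop (f x) (g x))"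
proof (induction n arbitrary: f g)
  case 0
  then show ?case using bounded_bilinear.continuous_on[OF assms] by auto
next
  case (Suc n)
  show ?case
    by (rule C_k_SucI[OF bounded_bilinear.FDERIV[OF assms C_k_SucD_derivative[OF Suc.prems(1)]
          C_k_SucD_derivative[OF Suc.prems(2)]]])
      (intro C_k_add Suc.IH C_k_Suc_lower[OF Suc.prems(1)] C_k_Suc_lower[OF Suc.prems(2)],
        use Suc.prems in auto)
qed

lemma C_k_mult: "C_k n f \<Longrightarrow> C_k n g \<Longrightarrow> C_k n (\<lambda>x. f x * g x)" for f g :: "_ \<Rightarrow> real"
  by (rule C_k_bounded_bilinear[OF bounded_bilinear_mult])

lemma C_k_inverse:
  fixes f :: "_ \<Rightarrow> real"
  assumes "\<And>x. f x \<noteq> 0"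
  shows "C_k n f \<Longrightarrow> C_k n (\<lambda>x. inverse (f x))"
proof (induction n)
  case 0
  then show ?case using assms by (auto intro!: continuous_intros)
next
  case (Suc n)
  have inv: "C_k n (\<lambda>x. inverse (f x))"
    using Suc C_k_Suc_lower by blast
  show ?case
  proof (rule C_k_SucI)
    show "((\<lambda>x. inverse (f x)) has_derivative
        (\<lambda>v. - (inverse (f x) * frechet_derivative f (at x) v * inverse (f x)))) (at x)" for x
      by (rule Deriv.has_derivative_inverse[OF assms C_k_SucD_derivative[OF Suc.prems]])
    show "C_k n (\<lambda>x. - (inverse (f x) * frechet_derivative f (at x) v * inverse (f x)))" for v
      using inv Suc.prems
      by (intro C_k_bounded_linear[OF bounded_linear_minus[OF bounded_linear_ident]] C_k_mult) auto
  qed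
qed

lemma frechet_derivative_Basis_expansion:
  fixes f :: "'a::euclidean_space \<Rightarrow> 'b::euclidean_space"
  assumes "f differentiable (at x)"
  shows "frechet_derivative f (at x) v = (\<Sum>b\<in>Basis. (v \<bullet> b) *\<^sub>R frechet_derivative f (at x) b)"
proof -
  interpret linear "frechet_derivative f (at x)"
    using assms by (rule linear_frechet_derivative)
  have "frechet_derivative f (at x) v = frechet_derivative f (at x) (\<Sum>b\<in>Basis. (v \<bullet> b) *\<^sub>R b)"
    by (simp add: euclidean_representation)
  then show ?thesis by (simp add: sum scale)
qed

lemma C_k_directional_derivative:
  assumes "C_k (Suc n) f" "C_k n Z"
  shows "C_k n (\<lambda>x. frechet_derivative f (at x) (Z x))"
proof -
  have "(\<lambda>x. frechet_derivative f (at x) (Z x)) =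
      (\<lambda>x. \<Sum>b\<in>Basis. (Z x \<bullet> b) *\<^sub>R frechet_derivative f (at x) b)"
    using assms(1) by (intro ext frechet_derivative_Basis_expansion) auto
  moreover have "C_k n (\<lambda>x. \<Sum>b\<in>Basis. (Z x \<bullet> b) *\<^sub>R frechet_derivative f (at x) b)"
    using assms
    by (intro C_k_sum C_k_bounded_bilinear[OF bounded_bilinear_scaleR]
        C_k_bounded_linear[OF bounded_linear_inner_left]) auto
  ultimately show ?thesis by simp
qed

lemma continuous_directional_derivative:
  fixes f :: "'a::euclidean_space \<Rightarrow> 'b::euclidean_space"
  assumes "C_k (Suc n) f" "continuous_on A c" "continuous_on A Z"
  shows "continuous_on A (\<lambda>s. frechet_derivative f (at (c s)) (Z s))"
proof -
  have "continuous_on UNIV (\<lambda>x. frechet_derivative f (at x) b)" for b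
    using assms(1) C_k_continuous[of n "\<lambda>x. frechet_derivative f (at x) b"] by auto
  then have "continuous_on A (\<lambda>s. frechet_derivative f (at (c s)) b)" for b
    using continuous_on_compose2[OF _ assms(2)] by blast
  then have "continuous_on A (\<lambda>s. \<Sum>b\<in>Basis. (Z s \<bullet> b) *\<^sub>R frechet_derivative f (at (c s)) b)"
    using assms(3) by (intro continuous_intros) auto
  moreover have "(\<lambda>s. frechet_derivative f (at (c s)) (Z s)) =
      (\<lambda>s. \<Sum>b\<in>Basis. (Z s \<bullet> b) *\<^sub>R frechet_derivative f (at (c s)) b)"
    using assms(1) by (intro ext frechet_derivative_Basis_expansion) auto
  ultimately show ?thesis by (simp only:)
qed

section \<open>Periodic functions and functions on the torus\<close>

lemma proj_rep [simp]: "torus_proj (rep_torus x) = x"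
  by (rule Quotient_abs_rep[OF Quotient_torus])

lemma proj_eq_iff: "torus_proj x = torus_proj y \<longleftrightarrow> lattice_equiv x y"
  using Quotient_rel[OF Quotient_torus] by (simp add: torus.abs_eq_iff)

lemma torus_cases: obtains y where "x = torus_proj y"
  by (metis proj_rep)

definition lattice :: "(real^2) set" where
  "lattice = {k. \<forall>i. k $ i \<in> \<int>}"

lemma proj_add_lattice [simp]: "k \<in> lattice \<Longrightarrow> torus_proj (y + k) = torus_proj y"
  by (auto simp: proj_eq_iff lattice_equiv_def lattice_def)

lemma proj_eq_latticeE:
  assumes "torus_proj x = torus_proj y"
  obtains k where "k \<in> lattice" "x = y + k"
  using assms that[of "x - y"] by (auto simp: proj_eq_iff lattice_equiv_def lattice_def)

definition periodic :: "(real^2 \<Rightarrow> 'b) \<Rightarrow> bool" where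
  "periodic F \<longleftrightarrow> (\<forall>y. \<forall>k\<in>lattice. F (y + k) = F y)"

lemma periodicD: "periodic F \<Longrightarrow> k \<in> lattice \<Longrightarrow> F (y + k) = F y"
  by (simp add: periodic_def)

lemma periodic_lift: "periodic (\<lambda>y. f (torus_proj y))"
  by (simp add: periodic_def)

lemma periodic_rep: "periodic F \<Longrightarrow> F (rep_torus (torus_proj y)) = F y"
  by (metis periodicD proj_eq_latticeE proj_rep)

lemma periodic_frechet_derivative:
  assumes "periodic F" "\<And>y. F differentiable (at y)"
  shows "periodic (\<lambda>y. frechet_derivative F (at y))"
  unfolding periodic_def
proof (intro allI ballI)
  fix y k :: "real^2" assume k: "k \<in> lattice"
  have "((\<lambda>z. F (z + k)) has_derivative frechet_derivative F (at (y + k))) (at y)"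
    by (rule has_derivative_compose[of "\<lambda>z. z + k" "\<lambda>v. v"])
      (use assms(2)[of "y + k"] in \<open>auto simp: frechet_derivative_works intro!: derivative_eq_intros\<close>)
  moreover have "(\<lambda>z. F (z + k)) = F"
    using assms(1) k by (auto simp: periodic_def)
  ultimately show "frechet_derivative F (at (y + k)) = frechet_derivative F (at y)"
    using frechet_derivative_at by metis
qed

definition unit_cell :: "(real^2) set" where
  "unit_cell = {x. \<forall>k. 0 \<le> x $ k \<and> x $ k < 1}"

definition frac_vec :: "real^2 \<Rightarrow> real^2" where
  "frac_vec x = (\<chi> i. frac (x $ i))"

lemma frac_vec_unit_cell: "frac_vec x \<in> unit_cell"
  by (simp add: frac_vec_def unit_cell_def frac_lt_1)

lemma proj_frac_vec [simp]: "torus_proj (frac_vec x) = torus_proj x"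
  by (simp add: proj_eq_iff lattice_equiv_def frac_vec_def frac_def)

lemma unit_cell_subset_cbox: "unit_cell \<subseteq> cbox 0 1"
  by (auto simp: unit_cell_def mem_box_cart less_imp_le)

lemma periodic_frac_vec: "periodic F \<Longrightarrow> F (frac_vec x) = F x"
  using periodic_rep[of F x] periodic_rep[of F "frac_vec x"] by simp

lemma periodic_bounded:
  fixes F :: "real^2 \<Rightarrow> 'b::real_normed_vector"
  assumes "periodic F" "continuous_on UNIV F"
  obtains B where "B > 0" "\<And>y. norm (F y) \<le> B"
proof -
  have "compact (F ` cbox 0 1)"
    using assms(2) by (intro compact_continuous_image compact_cbox) (auto intro: continuous_on_subset)
  from compact_imp_bounded[OF this] obtain B where B: "B > 0" "\<forall>z\<in>F ` cbox 0 1. norm z \<le> B"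
    unfolding bounded_pos by (elim exE conjE)
  have "norm (F y) \<le> B" for y
  proof -
    have "F (frac_vec y) \<in> F ` cbox 0 1"
      using frac_vec_unit_cell[of y] unit_cell_subset_cbox by (intro imageI) auto
    then show ?thesis
      using B(2) by (metis periodic_frac_vec[OF assms(1)])
  qed
  then show ?thesis by (rule that[OF B(1)])
qed

lemma periodic_lipschitz:
  fixes F :: "real^2 \<Rightarrow> 'b::euclidean_space"
  assumes "periodic F" "C_k (Suc n) F"
  obtains L where "L > 0" "\<And>x y. norm (F x - F y) \<le> L * norm (x - y)"
    "\<And>y v. norm (frechet_derivative F (at y) v) \<le> L * norm v"
proof -
  let ?D = "\<lambda>y. frechet_derivative F (at y)"
  have diff: "\<And>y. F differentiable (at y)" using assms(2) by auto
  have "\<exists>B>0. \<forall>y. norm (?D y b) \<le> B" for b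
  proof -
    have "periodic (\<lambda>y. ?D y b)"
      using periodic_frechet_derivative[OF assms(1) diff] by (auto simp: periodic_def)
    moreover have "continuous_on UNIV (\<lambda>y. ?D y b)"
      using assms(2) C_k_continuous[of n "\<lambda>y. ?D y b"] by auto
    ultimately show ?thesis using periodic_bounded[of "\<lambda>y. ?D y b"] by metis
  qed
  then obtain B where B: "\<And>b. B b > 0" "\<And>b y. norm (?D y b) \<le> B b" by metis
  define L where "L = (\<Sum>b\<in>Basis. B b)"
  have L: "L > 0" unfolding L_def using B(1) by (intro sum_pos) auto
  have D: "norm (?D y v) \<le> L * norm v" for y v
  proof -
    have "norm (?D y v) = norm (\<Sum>b\<in>Basis. (v \<bullet> b) *\<^sub>R ?D y b)"
      by (rule arg_cong[OF frechet_derivative_Basis_expansion[OF diff]])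
    also have "\<dots> \<le> (\<Sum>b\<in>Basis. norm v * B b)"
      using Basis_le_norm by (intro sum_norm_le) (auto intro!: mult_mono B simp: )
    also have "\<dots> = L * norm v" by (simp add: L_def sum_distrib_left mult.commute)
    finally show ?thesis .
  qed
  have "norm (F x - F y) \<le> L * norm (x - y)" for x y
  proof (rule differentiable_bound[of UNIV F "\<lambda>y. ?D y"])
    show "(F has_derivative ?D z) (at z within UNIV)" for z
      by (rule C_k_SucD_derivative[OF assms(2)])
    show "onorm (?D z) \<le> L" for z
      by (rule onorm_le[OF D])
  qed auto
  then show ?thesis by (rule that[OF L _ D])
qed

text \<open>The quadratic remainder is what makes the flow differentiable in its starting point.\<close>

lemma periodic_taylor:
  fixes F :: "real^2 \<Rightarrow> 'b::euclidean_space"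
  assumes "periodic F" "C_k (Suc (Suc n)) F"
  obtains K where "K > 0"
    "\<And>x y. norm (F y - F x - frechet_derivative F (at x) (y - x)) \<le> K * (norm (y - x))\<^sup>2"
proof -
  let ?D = "\<lambda>y. frechet_derivative F (at y)"
  have diff: "\<And>y. F differentiable (at y)" using assms(2) by auto
  have "\<exists>B>0. \<forall>x y. norm (?D x b - ?D y b) \<le> B * norm (x - y)" for b
  proof -
    have "periodic (\<lambda>y. ?D y b)"
      using periodic_frechet_derivative[OF assms(1) diff] by (auto simp: periodic_def)
    moreover have "C_k (Suc n) (\<lambda>y. ?D y b)"
      using assms(2) by auto
    ultimately show ?thesis using periodic_lipschitz by metis
  qed
  then obtain B where B: "\<And>b. B b > 0" "\<And>b x y. norm (?D x b - ?D y b) \<le> B b * norm (x - y)"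
    by metis
  define K where "K = (\<Sum>b\<in>Basis. B b)"
  have K: "K > 0" unfolding K_def using B(1) by (intro sum_pos) auto
  have D: "norm (?D x v - ?D y v) \<le> K * norm (x - y) * norm v" for x y v
  proof -
    have "?D x v - ?D y v = (\<Sum>b\<in>Basis. (v \<bullet> b) *\<^sub>R (?D x b - ?D y b))"
      unfolding frechet_derivative_Basis_expansion[OF diff, of x v]
        frechet_derivative_Basis_expansion[OF diff, of y v]
      by (simp add: algebra_simps sum_subtractf)
    also have "norm \<dots> \<le> (\<Sum>b\<in>Basis. norm v * (B b * norm (x - y)))"
      using Basis_le_norm by (intro sum_norm_le) (auto intro!: mult_mono B)
    also have "\<dots> = K * norm (x - y) * norm v"
      by (simp add: K_def sum_distrib_left[symmetric] sum_distrib_right[symmetric] mult_ac)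
    finally show ?thesis .
  qed
  have "norm (F y - F x - ?D x (y - x)) \<le> K * (norm (y - x))\<^sup>2" for x y
  proof -
    have "norm (F y - F x - ?D x (y - x)) \<le> norm (y - x) * (K * norm (y - x))"
    proof (rule differentiable_bound_linearization[where S = "closed_segment x y" and f' = ?D])
      show "x + t *\<^sub>R (y - x) \<in> closed_segment x y" if "t \<in> {0..1}" for t
        unfolding closed_segment_def using that
        by (intro CollectI exI[of _ t]) (simp add: scaleR_diff_left scaleR_diff_right)
      show "(F has_derivative ?D z) (at z within closed_segment x y)" for z
        by (rule has_derivative_at_withinI[OF C_k_SucD_derivative[OF assms(2)]])
      show "onorm (?D z - ?D x) \<le> K * norm (y - x)" if "z \<in> closed_segment x y" for z
      proof (rule onorm_le)
        have "norm (z - x) \<le> norm (y - x)"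
          using segment_bound1[OF that] by (simp add: norm_minus_commute)
        then show "norm ((?D z - ?D x) v) \<le> K * norm (y - x) * norm v" for v
          using order_trans[OF D[of z v x] mult_right_mono[OF mult_left_mono[of "norm (z - x)" "norm (y - x)" K] norm_ge_zero[of v]]] K
          by (simp add: fun_diff_def)
      qed
    qed simp
    also have "\<dots> = K * (norm (y - x))\<^sup>2" by (simp add: power2_eq_square)
    finally show ?thesis .
  qed
  then show ?thesis by (rule that[OF K])
qed

section \<open>Ordinary differential equations with bounded Lipschitz right-hand side\<close>

text \<open>One formula for both signs of \<open>t\<close>: the integral over an empty interval vanishes.\<close>

definition antiderivative :: "(real \<Rightarrow> 'a::euclidean_space) \<Rightarrow> real \<Rightarrow> 'a" where
  "antiderivative f t = integral {0..t} f - integral {t..0} f"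

lemma antiderivative_0 [simp]: "antiderivative f 0 = 0"
  by (simp add: antiderivative_def)

lemma antiderivative_nonneg: "0 \<le> t \<Longrightarrow> antiderivative f t = integral {0..t} f"
  by (cases "t = 0") (auto simp: antiderivative_def)

lemma antiderivative_nonpos: "t \<le> 0 \<Longrightarrow> antiderivative f t = - integral {t..0} f"
  by (cases "t = 0") (auto simp: antiderivative_def)

lemma has_vector_derivative_antiderivative:
  fixes f :: "real \<Rightarrow> 'a::euclidean_space"
  assumes "continuous_on UNIV f"
  shows "(antiderivative f has_vector_derivative f t) (at t)"
proof -
  define a b where "a = - \<bar>t\<bar> - 1" and "b = \<bar>t\<bar> + 1"
  have ab: "a < t" "t < b" "a < 0" by (auto simp: a_def b_def)
  have cont: "continuous_on S f" for S
    using assms continuous_on_subset by blast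
  have int: "f integrable_on {c..d}" for c d
    by (rule integrable_continuous_real[OF cont])
  have eq: "antiderivative f s = integral {a..s} f - integral {a..0} f" if "s \<in> {a<..<b}" for s
  proof (cases "0 \<le> s")
    case True
    then show ?thesis
      using Henstock_Kurzweil_Integration.integral_combine[of a 0 s f] int ab
      by (simp add: antiderivative_nonneg algebra_simps)
  next
    case False
    then show ?thesis
      using Henstock_Kurzweil_Integration.integral_combine[of a s 0 f] int that
      by (simp add: antiderivative_nonpos algebra_simps)
  qed
  have "((\<lambda>s. integral {a..s} f) has_vector_derivative f t) (at t within {a..b})"
    using ab by (intro integral_has_vector_derivative cont) auto
  moreover have "at t within {a..b} = at t"
    using ab by (intro at_within_interior) (simp add: interior_atLeastAtMost_real)
  ultimately have "((\<lambda>s. integral {a..s} f - integral {a..0} f) has_vector_derivative f t - 0) (at t)"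
    by (intro has_vector_derivative_diff) auto
  then show ?thesis
    using has_vector_derivative_transform_within_open[of "\<lambda>s. integral {a..s} f - integral {a..0} f"
        "f t" t "{a<..<b}" "antiderivative f"] eq ab
    by simp
qed

lemma antiderivative_diff:
  fixes f g :: "real \<Rightarrow> 'a::euclidean_space"
  assumes "continuous_on UNIV f" "continuous_on UNIV g"
  shows "antiderivative f t - antiderivative g t = antiderivative (\<lambda>s. f s - g s) t"
proof -
  have int: "f integrable_on {c..d}" "g integrable_on {c..d}" for c d
    by (auto intro!: integrable_continuous_real intro: continuous_on_subset assms)
  show ?thesis
    by (simp add: antiderivative_def Henstock_Kurzweil_Integration.integral_diff int)
qed

lemma norm_antiderivative_le:
  fixes f :: "real \<Rightarrow> 'a::euclidean_space"
  assumes "continuous_on UNIV f" "K > 0" "\<And>s. norm (f s) \<le> C * exp (K * \<bar>s\<bar>)" "C \<ge> 0"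
  shows "norm (antiderivative f t) \<le> C / K * exp (K * \<bar>t\<bar>)"
proof (cases "0 \<le> t")
  case True
  have "((\<lambda>s. C * exp (K * s)) has_integral (C / K * exp (K * t) - C / K * exp (K * 0))) {0..t}"
    using True \<open>K > 0\<close>
    by (intro fundamental_theorem_of_calculus)
      (auto intro!: derivative_eq_intros simp: has_real_derivative_iff_has_vector_derivative[symmetric])
  note h = this
  have "norm (integral {0..t} f) \<le> integral {0..t} (\<lambda>s. C * exp (K * s))"
    using assms(3)
    by (intro Henstock_Kurzweil_Integration.integral_norm_bound_integral has_integral_integrable[OF h]
        integrable_continuous_real continuous_on_subset[OF assms(1)])
      (auto, metis abs_of_nonneg)
  also have "\<dots> \<le> C / K * exp (K * t)"
    using integral_unique[OF h] assms(2,4) by simp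
  finally show ?thesis using True by (simp add: antiderivative_nonneg)
next
  case False
  have "((\<lambda>s. C * exp (- (K * s))) has_integral
      (- C / K * exp (- (K * 0)) - (- C / K * exp (- (K * t))))) {t..0}"
    using False \<open>K > 0\<close>
    by (intro fundamental_theorem_of_calculus)
      (auto intro!: derivative_eq_intros simp: has_real_derivative_iff_has_vector_derivative[symmetric])
  note h = this
  have "norm (integral {t..0} f) \<le> integral {t..0} (\<lambda>s. C * exp (- (K * s)))"
    using assms(3)
    by (intro Henstock_Kurzweil_Integration.integral_norm_bound_integral has_integral_integrable[OF h]
        integrable_continuous_real continuous_on_subset[OF assms(1)])
      (auto, metis abs_of_nonpos mult_minus_right)
  also have "\<dots> \<le> C / K * exp (- (K * t))"
    using integral_unique[OF h] assms(2,4) by simp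
  finally show ?thesis using False by (simp add: antiderivative_nonpos)
qed

definition solves_ode :: "('a::real_normed_vector \<Rightarrow> 'a) \<Rightarrow> (real \<Rightarrow> 'a) \<Rightarrow> bool" where
  "solves_ode U c \<longleftrightarrow> (\<forall>t. (c has_vector_derivative U (c t)) (at t))"

lemma solves_odeD: "solves_ode U c \<Longrightarrow> (c has_vector_derivative U (c t)) (at t)"
  by (simp add: solves_ode_def)

lemma solves_ode_shift:
  assumes "solves_ode U c" shows "solves_ode U (\<lambda>t. c (t + s))"
  unfolding solves_ode_def
proof
  fix t
  have "(c \<circ> (\<lambda>t. t + s) has_vector_derivative 1 *\<^sub>R U (c (t + s))) (at t)"
    by (rule vector_diff_chain_at) (auto intro!: derivative_eq_intros solves_odeD[OF assms])
  then show "((\<lambda>t. c (t + s)) has_vector_derivative U (c (t + s))) (at t)"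
    by (simp add: o_def)
qed

lemma solves_ode_reverse:
  assumes "solves_ode U c" shows "solves_ode (\<lambda>x. - U x) (\<lambda>t. c (- t))"
  unfolding solves_ode_def
proof
  fix t
  have "(c \<circ> uminus has_vector_derivative (-1) *\<^sub>R U (c (- t))) (at t)"
    by (rule vector_diff_chain_at) (auto intro!: derivative_eq_intros solves_odeD[OF assms])
  then show "((\<lambda>t. c (- t)) has_vector_derivative - U (c (- t))) (at t)"
    by (simp add: o_def)
qed

text \<open>The Picard operator contracts a weighted sup norm with weight \<open>exp (-2 L |t|)\<close>, so that one
  fixed point gives the solution for all times.\<close>

lemma solves_ode_exists:
  fixes U :: "'a::euclidean_space \<Rightarrow> 'a"
  assumes L: "L > 0" "\<And>x y. norm (U x - U y) \<le> L * norm (x - y)" and M: "\<And>x. norm (U x) \<le> M"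
  obtains c where "c 0 = x" "solves_ode U c"
proof -
  \<comment> \<open>With this weight the Lipschitz constant of the Picard operator is \<open>L / K = 1 / 2\<close>.\<close>
  define K where "K = 2 * L"
  have K: "K > 0" using L by (simp add: K_def)
  have M0: "M \<ge> 0" using norm_ge_zero order_trans M by blast
  have contU: "continuous_on UNIV U"
    by (rule lipschitz_on_continuous_on[OF lipschitz_onI[of _ _ L]]) (use L in \<open>auto simp: dist_norm\<close>)
  define G where "G b t = x + exp (K * \<bar>t\<bar>) *\<^sub>R apply_bcontfun b t" for b :: "real \<Rightarrow>\<^sub>C 'a" and t
  have contUG: "continuous_on UNIV (\<lambda>s. U (G b s))" for b
    unfolding G_def
    by (intro continuous_on_compose2[OF contU] continuous_intros) auto
  define P where "P b t = exp (- (K * \<bar>t\<bar>)) *\<^sub>R antiderivative (\<lambda>s. U (G b s)) t" for b t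
  have exp1: "exp (- (K * \<bar>t\<bar>)) * (c * exp (K * \<bar>t\<bar>)) = c" for t c
    by (simp add: exp_minus)
  have P_le: "norm (P b t) \<le> M / K" for b t
  proof -
    have "norm (antiderivative (\<lambda>s. U (G b s)) t) \<le> M / K * exp (K * \<bar>t\<bar>)"
    proof (rule norm_antiderivative_le[OF contUG K _ M0])
      show "norm (U (G b s)) \<le> M * exp (K * \<bar>s\<bar>)" for s
        using M[of "G b s"] mult_left_mono[of 1 "exp (K * \<bar>s\<bar>)" M] M0 K by simp
    qed
    then have "norm (P b t) \<le> exp (- (K * \<bar>t\<bar>)) * (M / K * exp (K * \<bar>t\<bar>))"
      unfolding P_def norm_scaleR abs_exp_cancel by (intro mult_left_mono) auto
    then show ?thesis by (simp only: exp1)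
  qed
  have "continuous_on UNIV (antiderivative (\<lambda>s. U (G b s)))" for b
    by (intro continuous_at_imp_continuous_on ballI
        has_vector_derivative_continuous[OF has_vector_derivative_antiderivative[OF contUG]])
  then have contP: "continuous_on UNIV (P b)" for b
    unfolding P_def by (intro continuous_intros)
  define T where "T b = Bcontfun (P b)" for b
  have T: "apply_bcontfun (T b) = P b" for b
    unfolding T_def by (rule Bcontfun_inverse, rule bcontfun_normI[OF contP P_le])
  have "dist (T b) (T b') \<le> 1/2 * dist b b'" for b b'
  proof (rule dist_bound)
    fix t
    have "norm (antiderivative (\<lambda>s. U (G b s) - U (G b' s)) t) \<le> L * dist b b' / K * exp (K * \<bar>t\<bar>)"
    proof (rule norm_antiderivative_le[OF _ K])
      show "continuous_on UNIV (\<lambda>s. U (G b s) - U (G b' s))"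
        by (intro continuous_intros contUG)
      show "norm (U (G b s) - U (G b' s)) \<le> L * dist b b' * exp (K * \<bar>s\<bar>)" for s
      proof -
        have "norm (U (G b s) - U (G b' s)) \<le> L * norm (G b s - G b' s)" by (rule L)
        also have "G b s - G b' s = exp (K * \<bar>s\<bar>) *\<^sub>R (apply_bcontfun b s - apply_bcontfun b' s)"
          by (simp add: G_def algebra_simps)
        also have "L * norm \<dots> = L * (exp (K * \<bar>s\<bar>) * dist (apply_bcontfun b s) (apply_bcontfun b' s))"
          by (simp add: dist_norm)
        also have "\<dots> \<le> L * (exp (K * \<bar>s\<bar>) * dist b b')"
          using L(1) dist_bounded[of b s b'] by (intro mult_left_mono) auto
        finally show ?thesis by (simp add: mult_ac)
      qed
    qed (use L in auto)
    then have "exp (- (K * \<bar>t\<bar>)) * norm (antiderivative (\<lambda>s. U (G b s)) t - antiderivative (\<lambda>s. U (G b' s)) t)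
       \<le> exp (- (K * \<bar>t\<bar>)) * (L * dist b b' / K * exp (K * \<bar>t\<bar>))"
      by (intro mult_left_mono) (auto simp: antiderivative_diff[OF contUG contUG])
    then have "norm (P b t - P b' t) \<le> L * dist b b' / K"
      unfolding exp1 by (simp add: P_def flip: scaleR_diff_right)
    then show "dist (apply_bcontfun (T b) t) (apply_bcontfun (T b') t) \<le> 1/2 * dist b b'"
      using L(1) by (simp add: T dist_norm K_def)
  qed
  then obtain b where "T b = b"
    using banach_fix_type[of "1/2" T] by auto
  then have b: "apply_bcontfun b t = exp (- (K * \<bar>t\<bar>)) *\<^sub>R antiderivative (\<lambda>s. U (G b s)) t" for t
    using T[of b] P_def by metis
  have G: "G b t = x + antiderivative (\<lambda>s. U (G b s)) t" for t
  proof -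
    have "G b t = x + exp (K * \<bar>t\<bar>) *\<^sub>R apply_bcontfun b t"
      by (rule G_def)
    also have "\<dots> = x + antiderivative (\<lambda>s. U (G b s)) t"
      unfolding b[of t] by (simp add: exp_minus)
    finally show ?thesis .
  qed
  show ?thesis
  proof (rule that)
    show "G b 0 = x" using G[of 0] by simp
    have "((\<lambda>t. x + antiderivative (\<lambda>s. U (G b s)) t) has_vector_derivative 0 + U (G b t)) (at t)" for t
      by (intro has_vector_derivative_add has_vector_derivative_const
          has_vector_derivative_antiderivative contUG)
    note der = this
    show "solves_ode U (G b)"
      unfolding solves_ode_def
    proof
      fix t
      show "(G b has_vector_derivative U (G b t)) (at t)"
        using has_vector_derivative_transform_within_open[OF der[of t] open_UNIV UNIV_I G[symmetric]]
        by (simp only: add_0)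
    qed
  qed
qed

text \<open>The squared norm is differentiable, and \<open>2 a b \<le> a\<^sup>2 + b\<^sup>2\<close> absorbs the inhomogeneous term; hence the
  exponent \<open>2 L + 1\<close>.\<close>

lemma gronwall_square:
  fixes z :: "real \<Rightarrow> 'a::real_inner"
  assumes z: "\<And>s. 0 \<le> s \<Longrightarrow> s \<le> t \<Longrightarrow> (z has_vector_derivative z' s) (at s)"
    and bound: "\<And>s. 0 \<le> s \<Longrightarrow> s \<le> t \<Longrightarrow> norm (z' s) \<le> L * norm (z s) + e"
    and "0 \<le> t" "0 \<le> L" "0 \<le> e"
  shows "(norm (z t))\<^sup>2 \<le> ((norm (z 0))\<^sup>2 + e\<^sup>2 * t) * exp ((2 * L + 1) * t)"
proof -
  define K where "K = 2 * L + 1"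
  have K: "K \<ge> 0" using \<open>0 \<le> L\<close> by (simp add: K_def)
  let ?m = "\<lambda>s. exp (- (K * s)) * (z s \<bullet> z s) - e\<^sup>2 * s"
  have "?m t \<le> ?m 0"
  proof (rule DERIV_nonpos_imp_nonincreasing[OF \<open>0 \<le> t\<close>])
    fix s assume s: "0 \<le> s" "s \<le> t"
    let ?d = "exp (- (K * s)) * (2 * (z s \<bullet> z' s) - K * (z s \<bullet> z s)) - e\<^sup>2"
    have "((\<lambda>s. z s \<bullet> z s) has_vector_derivative z s \<bullet> z' s + z' s \<bullet> z s) (at s)"
      by (rule bounded_bilinear.has_vector_derivative[OF bounded_bilinear_inner z[OF s] z[OF s]])
    then have "DERIV (\<lambda>s. z s \<bullet> z s) s :> 2 * (z s \<bullet> z' s)"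
      by (simp add: has_real_derivative_iff_has_vector_derivative inner_commute)
    then have "DERIV ?m s :> ?d"
      by (auto intro!: derivative_eq_intros simp: algebra_simps)
    moreover have "?d \<le> 0"
    proof -
      have "2 * (z s \<bullet> z' s) \<le> 2 * (norm (z s) * norm (z' s))"
        using norm_cauchy_schwarz[of "z s" "z' s"] by simp
      also have "\<dots> \<le> 2 * (norm (z s) * (L * norm (z s) + e))"
        using bound[OF s] by (intro mult_left_mono) auto
      also have "\<dots> = 2 * L * (norm (z s))\<^sup>2 + 2 * norm (z s) * e"
        by (simp add: algebra_simps power2_eq_square)
      also have "\<dots> \<le> 2 * L * (norm (z s))\<^sup>2 + ((norm (z s))\<^sup>2 + e\<^sup>2)"
        using sum_squares_bound[of "norm (z s)" e] by simp
      also have "\<dots> = K * (z s \<bullet> z s) + e\<^sup>2"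
        by (simp add: K_def algebra_simps power2_norm_eq_inner)
      finally have "2 * (z s \<bullet> z' s) - K * (z s \<bullet> z s) \<le> e\<^sup>2" by simp
      then have "exp (- (K * s)) * (2 * (z s \<bullet> z' s) - K * (z s \<bullet> z s)) \<le> exp (- (K * s)) * e\<^sup>2"
        by (intro mult_left_mono) auto
      also have "\<dots> \<le> 1 * e\<^sup>2"
        using K s by (intro mult_right_mono) auto
      finally show ?thesis by simp
    qed
    ultimately show "\<exists>y. DERIV ?m s :> y \<and> y \<le> 0" by blast
  qed
  then have "exp (- (K * t)) * (norm (z t))\<^sup>2 \<le> (norm (z 0))\<^sup>2 + e\<^sup>2 * t"
    by (simp add: power2_norm_eq_inner)
  then have "exp (K * t) * (exp (- (K * t)) * (norm (z t))\<^sup>2) \<le> exp (K * t) * ((norm (z 0))\<^sup>2 + e\<^sup>2 * t)"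
    by (intro mult_left_mono) auto
  moreover have "exp (K * t) * (exp (- (K * t)) * (norm (z t))\<^sup>2) = (norm (z t))\<^sup>2"
    by (simp add: exp_minus)
  ultimately show ?thesis
    by (simp only: K_def mult.commute)
qed

lemma solves_ode_dist:
  fixes U :: "'a::euclidean_space \<Rightarrow> 'a"
  assumes L: "L > 0" "\<And>x y. norm (U x - U y) \<le> L * norm (x - y)"
    and c: "solves_ode U c" "solves_ode U d"
  shows "(norm (c t - d t))\<^sup>2 \<le> (norm (c 0 - d 0))\<^sup>2 * exp ((2 * L + 1) * \<bar>t\<bar>)"
proof -
  have fwd: "(norm (c t - d t))\<^sup>2 \<le> (norm (c 0 - d 0))\<^sup>2 * exp ((2 * L + 1) * t)"
    if "0 \<le> t" and L': "\<And>x y. norm (U x - U y) \<le> L * norm (x - y)"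
      and c: "solves_ode U c" "solves_ode U d" for U :: "'a \<Rightarrow> 'a" and c d t
  proof -
    have "(norm (c t - d t))\<^sup>2 \<le> ((norm (c 0 - d 0))\<^sup>2 + 0\<^sup>2 * t) * exp ((2 * L + 1) * t)"
    proof (rule gronwall_square[where z' = "\<lambda>s. U (c s) - U (d s)"])
      show "((\<lambda>s. c s - d s) has_vector_derivative U (c s) - U (d s)) (at s)" for s
        using c by (intro has_vector_derivative_diff solves_odeD)
      show "norm (U (c s) - U (d s)) \<le> L * norm (c s - d s) + 0" for s
        using L' by simp
    qed (use that L in auto)
    then show ?thesis by simp
  qed
  show ?thesis
  proof (cases "0 \<le> t")
    case True
    then show ?thesis using fwd[OF True L(2) c] by simp
  next
    case False
    have "norm (- U x - - U y) \<le> L * norm (x - y)" for x y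
      using L(2)[of y x] by (simp add: norm_minus_commute)
    then show ?thesis
      using fwd[of "-t" "\<lambda>x. - U x", OF _ _ solves_ode_reverse[OF c(1)] solves_ode_reverse[OF c(2)]]
        False by simp
  qed
qed

lemma solves_ode_unique:
  fixes U :: "'a::euclidean_space \<Rightarrow> 'a"
  assumes L: "L > 0" "\<And>x y. norm (U x - U y) \<le> L * norm (x - y)"
    and c: "solves_ode U c" "solves_ode U d" "c 0 = d 0"
  shows "c = d"
proof
  fix t show "c t = d t"
    using solves_ode_dist[OF L c(1,2), of t] c(3) by simp
qed

section \<open>Topology and measurable structure of the torus\<close>

lemma continuous_on_torus_iff:
  "continuous_on UNIV f \<longleftrightarrow> continuous_on UNIV (\<lambda>y. f (torus_proj y))"
proof -
  have "(\<lambda>y. f (torus_proj y)) -` B = torus_proj -` (f -` B)" for B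
    by auto
  then show ?thesis
    by (simp add: continuous_on_open_vimage open_torus_def)
qed

lemma continuous_on_proj: "continuous_on A torus_proj"
proof -
  have "continuous_on UNIV torus_proj"
    by (simp add: continuous_on_open_vimage open_torus_def)
  then show ?thesis using continuous_on_subset by blast
qed

text \<open>The phase \<open>\<theta>\<close> covers cosines and sines at once: derivatives of a wave are multiples of waves, and products
  are sums of two waves.\<close>

definition wave :: "int \<Rightarrow> int \<Rightarrow> real \<Rightarrow> torus \<Rightarrow> real" where
  "wave a b \<theta> x = cos (2 * pi * (of_int a * rep_torus x $ 1 + of_int b * rep_torus x $ 2) + \<theta>)"

lemma wave_proj: "wave a b \<theta> (torus_proj y) = cos (2 * pi * (of_int a * y $ 1 + of_int b * y $ 2) + \<theta>)"
proof -
  obtain k where k: "k \<in> lattice" "rep_torus (torus_proj y) = y + k"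
    using proj_eq_latticeE[of "rep_torus (torus_proj y)" y] by auto
  then obtain m n where mn: "k $ 1 = of_int m" "k $ 2 = of_int n"
    unfolding lattice_def by (metis (mono_tags) Ints_cases mem_Collect_eq)
  have "wave a b \<theta> (torus_proj y) =
      cos ((2 * pi * (of_int a * y $ 1 + of_int b * y $ 2) + \<theta>) + of_int (a * m + b * n) * (2 * of_real pi))"
    by (simp add: wave_def k mn algebra_simps)
  also have "\<dots> = cos (2 * pi * (of_int a * y $ 1 + of_int b * y $ 2) + \<theta>)"
    by (rule cos.plus_of_int)
  finally show ?thesis .
qed

lemma continuous_wave: "continuous_on A (wave a b \<theta>)"
proof -
  have "continuous_on UNIV (wave a b \<theta>)"
    unfolding continuous_on_torus_iff wave_proj by (intro continuous_intros)
  then show ?thesis using continuous_on_subset by blast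
qed

lemma Ints_of_same_angle:
  assumes "cos (2 * pi * s) = cos (2 * pi * t)" "cos (2 * pi * s - pi / 2) = cos (2 * pi * t - pi / 2)"
  shows "s - t \<in> \<int>"
proof -
  have "sin (2 * pi * s) = sin (2 * pi * t)"
    using assms(2) by (simp add: cos_diff)
  then obtain n :: int where "2 * pi * s = 2 * pi * t + 2 * pi * n"
    using assms(1) sin_cos_eq_iff[of "2 * pi * s" "2 * pi * t"] by auto
  then have "2 * pi * (s - t) = 2 * pi * n" by (simp add: algebra_simps)
  then have "s - t = of_int n" by simp
  then show ?thesis by simp
qed

text \<open>The cosine and the sine of one coordinate determine it modulo 1.\<close>

lemma waves_separate:
  assumes "x \<noteq> y" shows "\<exists>a b \<theta>. wave a b \<theta> x \<noteq> wave a b \<theta> y"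
proof (rule ccontr)
  assume "\<not> ?thesis"
  then have eq: "wave a b \<theta> x = wave a b \<theta> y" for a b \<theta> by blast
  have "rep_torus x $ i - rep_torus y $ i \<in> \<int>" for i
  proof -
    have "i = 1 \<or> i = 2" by (rule exhaust_2)
    then show ?thesis
      using eq[of 1 0 0] eq[of 1 0 "- (pi/2)"] eq[of 0 1 0] eq[of 0 1 "- (pi/2)"]
      by (auto simp: wave_def intro!: Ints_of_same_angle)
  qed
  then have "torus_proj (rep_torus x) = torus_proj (rep_torus y)"
    unfolding proj_eq_iff lattice_equiv_def by blast
  then show False using assms by simp
qed

instance torus :: t2_space
proof
  fix x y :: torus assume "x \<noteq> y"
  then obtain a b \<theta> where "wave a b \<theta> x \<noteq> wave a b \<theta> y"
    using waves_separate by blast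
  then obtain U V where UV: "open U" "open V" "wave a b \<theta> x \<in> U" "wave a b \<theta> y \<in> V" "U \<inter> V = {}"
    using hausdorff by metis
  have op: "open (wave a b \<theta> -` W)" if "open W" for W
    using continuous_wave[of UNIV a b \<theta>] that by (simp add: continuous_on_open_vimage)
  show "\<exists>U V. open U \<and> open V \<and> x \<in> U \<and> y \<in> V \<and> U \<inter> V = {}"
    using UV by (intro exI[of _ "wave a b \<theta> -` U"] exI[of _ "wave a b \<theta> -` V"]) (auto intro: op)
qed

lemma compact_torus: "compact (UNIV :: torus set)"
proof -
  have "torus_proj ` cbox 0 1 = UNIV"
  proof -
    have "x \<in> torus_proj ` cbox 0 1" for x
      using frac_vec_unit_cell[of "rep_torus x"] unit_cell_subset_cbox
      by (intro image_eqI[of _ _ "frac_vec (rep_torus x)"]) auto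
    then show ?thesis by auto
  qed
  then show ?thesis
    using compact_continuous_image[OF continuous_on_proj compact_cbox, of 0 1] by simp
qed

lemma bounded_continuous_torus:
  fixes f :: "torus \<Rightarrow> 'b::real_normed_vector"
  assumes "continuous_on UNIV f"
  obtains B where "B > 0" "\<And>x. norm (f x) \<le> B"
proof -
  have "bounded (range f)"
    by (rule compact_imp_bounded[OF compact_continuous_image[OF assms compact_torus]])
  then obtain B where B: "B > 0" "\<forall>z\<in>range f. norm z \<le> B"
    unfolding bounded_pos by (elim exE conjE)
  then show ?thesis by (intro that[of B]) auto
qed

lemma measurable_proj [measurable]: "torus_proj \<in> borel \<rightarrow>\<^sub>M borel"
  by (rule borel_measurable_continuous_onI[OF continuous_on_proj])

definition cell_rep :: "torus \<Rightarrow> real^2" where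
  "cell_rep x = frac_vec (rep_torus x)"

lemma proj_cell_rep [simp]: "torus_proj (cell_rep x) = x"
  by (simp add: cell_rep_def)

lemma cell_rep_in: "cell_rep x \<in> unit_cell"
  by (simp add: cell_rep_def frac_vec_unit_cell)

lemma frac_vec_cell: "y \<in> unit_cell \<Longrightarrow> frac_vec y = y"
  by (simp add: unit_cell_def frac_vec_def vec_eq_iff frac_eq)

lemma frac_vec_eq: "torus_proj x = torus_proj y \<Longrightarrow> frac_vec x = frac_vec y"
proof (erule proj_eq_latticeE)
  fix k assume k: "k \<in> lattice" "x = y + k"
  have "frac (y $ i + k $ i) = frac (y $ i)" for i
    using k by (auto simp: lattice_def frac_def elim!: Ints_cases)
  then show ?thesis using k by (simp add: frac_vec_def vec_eq_iff)
qed

lemma cell_rep_proj: "y \<in> unit_cell \<Longrightarrow> cell_rep (torus_proj y) = y"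
  using frac_vec_eq[of "rep_torus (torus_proj y)" y] by (simp add: cell_rep_def frac_vec_cell)

text \<open>The cell is a countable union of compact squares, and the projection maps compact sets to
  closed sets.\<close>

lemma measurable_cell_rep [measurable]: "cell_rep \<in> borel \<rightarrow>\<^sub>M borel"
proof -
  define K where "K n = (cbox 0 (\<chi> i. 1 - 1 / real (Suc n)) :: (real^2) set)" for n
  have K_sub: "K n \<subseteq> unit_cell" for n
    by (auto simp: K_def mem_box_cart unit_cell_def) (smt (verit) divide_pos_pos of_nat_0_le_iff)
  have K_all: "\<exists>n. y \<in> K n" if "y \<in> unit_cell" for y
  proof -
    have y: "0 \<le> y $ i" "y $ i < 1" for i
      using that by (auto simp: unit_cell_def)
    define m where "m = max (y $ 1) (y $ 2)"
    have "m < 1" using y by (simp add: m_def)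
    then obtain n where n: "inverse (real (Suc n)) < 1 - m"
      using reals_Archimedean[of "1 - m"] by auto
    have "y $ i \<le> m" for i
      using exhaust_2[of i] by (auto simp: m_def)
    then have "y $ i \<le> 1 - 1 / real (Suc n)" for i
      using n by (smt (verit) inverse_eq_divide)
    then show ?thesis using y by (auto simp: K_def mem_box_cart)
  qed
  have "cell_rep -` S \<inter> space borel \<in> sets borel" if "closed S" for S
  proof -
    have "cell_rep -` S = (\<Union>n. torus_proj ` (S \<inter> K n))"
    proof
      show "cell_rep -` S \<subseteq> (\<Union>n. torus_proj ` (S \<inter> K n))"
      proof
        fix x assume "x \<in> cell_rep -` S"
        moreover obtain n where "cell_rep x \<in> K n" using K_all cell_rep_in by blast
        ultimately show "x \<in> (\<Union>n. torus_proj ` (S \<inter> K n))"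
          by (intro UN_I[of n] image_eqI[of _ _ "cell_rep x"]) auto
      qed
      show "(\<Union>n. torus_proj ` (S \<inter> K n)) \<subseteq> cell_rep -` S"
        using K_sub cell_rep_proj by fastforce
    qed
    moreover have "torus_proj ` (S \<inter> K n) \<in> sets borel" for n
      unfolding K_def
      by (intro borel_compact compact_continuous_image continuous_on_proj closed_Int_compact that compact_cbox)
    ultimately show ?thesis
      by (auto intro!: sets.countable_nat_UN)
  qed
  then show ?thesis
    unfolding borel_eq_closed[where 'a="real^2"]
    by (intro measurable_measure_of) auto
qed

section \<open>The flow of a smooth vector field\<close>

lemma torus_smooth_C_k: "torus_smooth u \<Longrightarrow> C_k n (\<lambda>y. u (torus_proj y))"
  by (simp add: torus_smooth_def C_infinity_def)

lemma torus_smooth_continuous: "torus_smooth f \<Longrightarrow> continuous_on UNIV f"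
  using C_k_continuous[OF torus_smooth_C_k] by (subst continuous_on_torus_iff)

definition flow_lift :: "vector_field \<Rightarrow> real \<Rightarrow> real^2 \<Rightarrow> real^2" where
  "flow_lift u t y = (THE c. c 0 = y \<and> solves_ode (\<lambda>y. u (torus_proj y)) c) t"

locale smooth_field =
  fixes u :: vector_field
  assumes smooth: "torus_smooth u"
begin

abbreviation U where "U \<equiv> \<lambda>y. u (torus_proj y)"

abbreviation F where "F \<equiv> flow_lift u"

lemma lipschitz_field:
  obtains L where "L > 0" "\<And>x y. norm (U x - U y) \<le> L * norm (x - y)"
    "\<And>y v. norm (frechet_derivative U (at y) v) \<le> L * norm v"
  using periodic_lipschitz[OF periodic_lift torus_smooth_C_k[OF smooth]] by metis

lemma flow_lift_exists1: "\<exists>!c. c 0 = y \<and> solves_ode U c"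
proof -
  obtain L where L: "L > 0" "\<And>x y. norm (U x - U y) \<le> L * norm (x - y)"
    using lipschitz_field by metis
  obtain M where M: "\<And>x. norm (U x) \<le> M"
    using bounded_continuous_torus[OF torus_smooth_continuous[OF smooth]] by metis
  obtain c where "c 0 = y" "solves_ode U c"
    using solves_ode_exists[of L U M y, OF L M] by metis
  then show ?thesis
    using solves_ode_unique[of L U, OF L] by (intro ex1I[of _ c]) auto
qed

lemma flow_lift: "F 0 y = y" "solves_ode U (\<lambda>t. F t y)"
  using theI'[OF flow_lift_exists1[of y]] by (simp_all add: flow_lift_def)

lemma flow_lift_unique: "solves_ode U c \<Longrightarrow> c t = F t (c 0)"
  using flow_lift_exists1[of "c 0"] flow_lift[of "c 0"] by (metis (no_types, lifting))

lemma has_vector_derivative_flow_lift: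
  "((\<lambda>t. F t y) has_vector_derivative U (F t y)) (at t)"
  by (rule solves_odeD[OF flow_lift(2)])

lemma flow_lift_add: "F (t + s) y = F t (F s y)"
  using flow_lift_unique[OF solves_ode_shift[OF flow_lift(2)], of t s y] by simp

lemma flow_lift_lattice:
  assumes "k \<in> lattice" shows "F t (y + k) = F t y + k"
proof -
  have "solves_ode U (\<lambda>t. F t y + k)"
    unfolding solves_ode_def using assms has_vector_derivative_flow_lift
    by (auto simp: has_vector_derivative_add_const)
  from flow_lift_unique[OF this, of t] show ?thesis by (simp add: flow_lift)
qed

lemma flow_proj: "flow u t (torus_proj y) = torus_proj (F t y)"
proof -
  have "(THE \<gamma>. integral_curve u \<gamma> \<and> \<gamma> 0 = torus_proj y) = (\<lambda>t. torus_proj (F t y))"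
  proof (rule the_equality)
    show "integral_curve u (\<lambda>t. torus_proj (F t y)) \<and> torus_proj (F 0 y) = torus_proj y"
      using has_vector_derivative_flow_lift by (auto simp: integral_curve_def flow_lift)
    fix \<gamma> assume g: "integral_curve u \<gamma> \<and> \<gamma> 0 = torus_proj y"
    then obtain c where c: "\<And>t. \<gamma> t = torus_proj (c t)" "\<And>t. (c has_vector_derivative u (\<gamma> t)) (at t)"
      unfolding integral_curve_def by blast
    then have "solves_ode U c" by (simp add: solves_ode_def)
    then have ct: "c t = F t (c 0)" for t by (rule flow_lift_unique)
    have "torus_proj (c 0) = torus_proj y" using g c by simp
    then obtain k where k: "k \<in> lattice" "c 0 = y + k" by (rule proj_eq_latticeE)
    show "\<gamma> = (\<lambda>t. torus_proj (F t y))"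
    proof
      fix t
      have "c t = F t y + k"
        unfolding ct[of t] k(2) by (rule flow_lift_lattice[OF k(1)])
      then show "\<gamma> t = torus_proj (F t y)" using c(1)[of t] k(1) by simp
    qed
  qed
  then show ?thesis by (simp add: flow_def)
qed

lemma flow_0 [simp]: "flow u 0 x = x"
  by (cases x rule: torus_cases) (simp add: flow_proj flow_lift)

lemma flow_add: "flow u (t + s) x = flow u t (flow u s x)"
  by (cases x rule: torus_cases) (simp add: flow_proj flow_lift_add)

lemma flow_uminus [simp]: "flow u (- t) (flow u t x) = x" "flow u t (flow u (- t) x) = x"
  using flow_add[of "-t" t x] flow_add[of t "-t" x] by simp_all

lemma flow_lift_dist:
  obtains K where "K > 0"
    "\<And>t x y. norm (F t x - F t y) \<le> exp (K * \<bar>t\<bar>) * norm (x - y)"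
proof -
  obtain L where L: "L > 0" "\<And>x y. norm (U x - U y) \<le> L * norm (x - y)"
    using lipschitz_field by metis
  have "norm (F t x - F t y) \<le> exp ((2 * L + 1) * \<bar>t\<bar>) * norm (x - y)" for t x y
  proof -
    have "(norm (F t x - F t y))\<^sup>2 \<le> (norm (F 0 x - F 0 y))\<^sup>2 * exp ((2 * L + 1) * \<bar>t\<bar>)"
      by (rule solves_ode_dist[of L U, OF L flow_lift(2) flow_lift(2)])
    also have "\<dots> \<le> (norm (x - y))\<^sup>2 * (exp ((2 * L + 1) * \<bar>t\<bar>))\<^sup>2"
      using L(1) self_le_power[of "exp ((2 * L + 1) * \<bar>t\<bar>)" 2] by (auto simp: flow_lift intro!: mult_left_mono)
    also have "\<dots> = (exp ((2 * L + 1) * \<bar>t\<bar>) * norm (x - y))\<^sup>2"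
      by (simp add: power_mult_distrib mult.commute)
    finally show ?thesis by (rule power2_le_imp_le) simp
  qed
  then show ?thesis using L(1) by (intro that[of "2 * L + 1"]) auto
qed

lemma continuous_flow_lift: "continuous_on UNIV (\<lambda>(t, y). F t y)"
proof (rule continuous_at_imp_continuous_on, rule ballI)
  fix p :: "real \<times> (real^2)"
  obtain t0 y0 where p: "p = (t0, y0)" by (cases p)
  obtain K where K: "\<And>t x y. norm (F t x - F t y) \<le> exp (K * \<bar>t\<bar>) * norm (x - y)"
    using flow_lift_dist by metis
  have cont: "isCont (\<lambda>t. F t y0) t0"
    by (rule has_vector_derivative_continuous[OF has_vector_derivative_flow_lift])
  have "((\<lambda>q. F (fst q) (snd q) - F t0 y0) \<longlongrightarrow> 0) (at p)"
  proof (rule Lim_null_comparison)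
    show "\<forall>\<^sub>F q in at p. norm (F (fst q) (snd q) - F t0 y0) \<le>
        exp (K * \<bar>fst q\<bar>) * norm (snd q - y0) + norm (F (fst q) y0 - F t0 y0)"
      using norm_triangle_ineq[of "F t x - F t y0" "F t y0 - F t0 y0" for t x]
      by (intro always_eventually) (smt (verit) K add_diff_cancel diff_add_eq add.commute diff_diff_eq2)
    have "(fst \<longlongrightarrow> t0) (at p)"
      using tendsto_fst[OF tendsto_ident_at, of p UNIV] p by simp
    from isCont_tendsto_compose[OF cont this]
    have "((\<lambda>q. F (fst q) y0) \<longlongrightarrow> F t0 y0) (at p)" .
    then have "((\<lambda>q. exp (K * \<bar>fst q\<bar>) * norm (snd q - y0) + norm (F (fst q) y0 - F t0 y0)) \<longlongrightarrow>
        exp (K * \<bar>fst p\<bar>) * norm (snd p - y0) + norm (F t0 y0 - F t0 y0)) (at p)"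
      by (intro tendsto_intros) 
    then show "((\<lambda>q. exp (K * \<bar>fst q\<bar>) * norm (snd q - y0) + norm (F (fst q) y0 - F t0 y0)) \<longlongrightarrow> 0) (at p)"
      by (simp add: p)
  qed
  then show "isCont (\<lambda>(t, y). F t y) p"
    unfolding isCont_def case_prod_beta p by (simp add: LIM_zero_iff)
qed

lemma continuous_flow_lift_compose:
  assumes "continuous_on A f" "continuous_on A g"
  shows "continuous_on A (\<lambda>s. F (f s) (g s))"
  using continuous_on_compose2[OF continuous_flow_lift continuous_on_Pair[OF assms]] by simp

lemma continuous_flow: "continuous_on UNIV (\<lambda>x. flow u t x)"
  unfolding continuous_on_torus_iff flow_proj
  by (intro continuous_on_compose2[OF continuous_on_proj] continuous_flow_lift_compose continuous_intros) auto

lemma continuous_flow_time: "continuous_on A (\<lambda>t. flow u t x)"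
proof (cases x rule: torus_cases)
  case (1 y)
  show ?thesis unfolding 1 flow_proj
    by (intro continuous_on_compose2[OF continuous_on_proj] continuous_flow_lift_compose continuous_intros) auto
qed

lemma measurable_flow_pair: "(\<lambda>(t, x). flow u t x) \<in> borel \<Otimes>\<^sub>M borel \<rightarrow>\<^sub>M borel"
proof -
  have "(\<lambda>(t, x). flow u t x) = (\<lambda>p. torus_proj ((\<lambda>(t, y). F t y) (fst p, cell_rep (snd p))))"
    using flow_proj[of _ "cell_rep _"] by (auto simp: fun_eq_iff)
  moreover have [measurable]: "(\<lambda>(t, y). F t y) \<in> borel \<Otimes>\<^sub>M borel \<rightarrow>\<^sub>M borel"
    unfolding borel_prod by (rule borel_measurable_continuous_onI[OF continuous_flow_lift])
  ultimately show ?thesis by simp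
qed

lemma measurable_flow_compose [measurable (raw)]:
  assumes "f \<in> M \<rightarrow>\<^sub>M borel" "g \<in> M \<rightarrow>\<^sub>M borel"
  shows "(\<lambda>s. flow u (f s) (g s)) \<in> M \<rightarrow>\<^sub>M borel"
  using measurable_compose[OF measurable_Pair[OF assms] measurable_flow_pair] by simp

end

section \<open>Lebesgue measure on the torus\<close>

lemma sets_torus_lebesgue [simp, measurable_cong]: "sets torus_lebesgue = sets borel"
  by (simp add: torus_lebesgue_def)

lemma space_torus_lebesgue [simp]: "space torus_lebesgue = UNIV"
  by (simp add: torus_lebesgue_def)

lemma unit_cell_sets [measurable]: "unit_cell \<in> sets borel"
  unfolding unit_cell_def by measurable

lemma torus_lebesgue_unit_cell:
  "torus_lebesgue = distr (restrict_space lborel unit_cell) borel torus_proj"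
  by (simp add: torus_lebesgue_def unit_cell_def)

lemma measurable_proj_restrict: "torus_proj \<in> restrict_space lborel unit_cell \<rightarrow>\<^sub>M borel"
  by (rule measurable_restrict_space1) simp

lemma integral_torus:
  fixes f :: "torus \<Rightarrow> real"
  assumes [measurable]: "f \<in> borel_measurable borel"
  shows "(\<integral>x. f x \<partial>torus_lebesgue) = (\<integral>y. indicator unit_cell y *\<^sub>R f (torus_proj y) \<partial>lborel)"
  unfolding torus_lebesgue_unit_cell
  by (simp add: integral_distr[OF measurable_proj_restrict] integral_restrict_space)

lemma emeasure_torus:
  assumes "A \<in> sets borel"
  shows "emeasure torus_lebesgue A = emeasure lborel (torus_proj -` A \<inter> unit_cell)"
proof -
  have "torus_proj -` A \<in> sets borel"
    using measurable_sets[OF measurable_proj assms] by simp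
  then show ?thesis
    unfolding torus_lebesgue_unit_cell using assms
    by (subst emeasure_distr[OF measurable_proj_restrict])
      (auto simp: space_restrict_space emeasure_restrict_space)
qed

text \<open>The chosen coordinate comes first, so that the inner integral in Fubini's theorem runs over it.\<close>

definition vec_at :: "2 \<Rightarrow> real \<Rightarrow> real \<Rightarrow> real^2" where
  "vec_at i a b = (\<chi> j. if j = i then a else b)"

lemma continuous_vec_at [continuous_intros]:
  "continuous_on S f \<Longrightarrow> continuous_on S g \<Longrightarrow> continuous_on S (\<lambda>s. vec_at i (f s) (g s))"
  unfolding vec_at_def
proof (rule continuous_on_vec_lambda)
  fix j
  assume "continuous_on S f" "continuous_on S g"
  then show "continuous_on S (\<lambda>s. if j = i then f s else g s)" by (cases "j = i") auto
qed

lemma measurable_vec_at: "(\<lambda>(a, b). vec_at i a b) \<in> lborel \<Otimes>\<^sub>M lborel \<rightarrow>\<^sub>M borel"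
proof -
  have "(\<lambda>p. vec_at i (fst p) (snd p)) \<in> borel \<rightarrow>\<^sub>M borel"
    by (intro borel_measurable_continuous_onI continuous_intros)
  then show ?thesis by (simp add: lborel_prod split_beta)
qed

lemma Basis_vec2: "(Basis :: (real^2) set) = range (\<lambda>j. axis j 1)"
  by (auto simp: Basis_vec_def)

lemma lborel_vec2: "(lborel :: (real^2) measure) = distr (lborel \<Otimes>\<^sub>M lborel) borel (\<lambda>(a, b). vec_at i a b)"
proof (rule lborel_eqI)
  fix l u :: "real^2" assume le: "\<And>b. b \<in> Basis \<Longrightarrow> l \<bullet> b \<le> u \<bullet> b"
  obtain k where k: "k \<noteq> i" "UNIV = {i, k}"
    using exhaust_2[of i] UNIV_2 by (cases "i = 1") (auto intro: that[of 1] that[of 2])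
  have all: "(\<forall>j. P j) \<longleftrightarrow> P i \<and> P k" for P :: "2 \<Rightarrow> bool"
    using k by (metis UNIV_I insertE singletonD)
  have lu: "l $ j \<le> u $ j" for j
    using le[of "axis j 1"] by (simp add: Basis_vec2 inner_axis)
  have m: "(\<lambda>(a, b). vec_at i a b) \<in> lborel \<Otimes>\<^sub>M lborel \<rightarrow>\<^sub>M borel"
    by (rule measurable_vec_at)
  have pre: "(\<lambda>(a, b). vec_at i a b) -` box l u = {l $ i <..< u $ i} \<times> {l $ k <..< u $ k}"
    using k(1) by (auto simp: mem_box_cart vec_at_def all)
  have "emeasure (distr (lborel \<Otimes>\<^sub>M lborel) borel (\<lambda>(a, b). vec_at i a b)) (box l u)
      = emeasure (lborel \<Otimes>\<^sub>M lborel) ({l $ i <..< u $ i} \<times> {l $ k <..< u $ k})"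
    by (subst emeasure_distr[OF m]) (auto simp: pre space_pair_measure)
  also have "\<dots> = ennreal (u $ i - l $ i) * ennreal (u $ k - l $ k)"
    using lu by (simp add: lborel.emeasure_pair_measure_Times)
  also have "\<dots> = ennreal (\<Prod>j\<in>UNIV. (u - l) $ j)"
    using lu k(1) by (simp add: k(2) ennreal_mult)
  also have "(\<Prod>j\<in>UNIV. (u - l) $ j) = (\<Prod>b\<in>Basis. (u - l) \<bullet> b)"
    unfolding Basis_vec2 by (subst prod.reindex) (auto simp: inj_on_def axis_eq_axis inner_axis)
  finally show "emeasure (distr (lborel \<Otimes>\<^sub>M lborel) borel (\<lambda>(a, b). vec_at i a b)) (box l u)
    = ennreal (\<Prod>b\<in>Basis. (u - l) \<bullet> b)" .
qed simp

lemma indicator_unit_cell_vec_at: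
  "indicator unit_cell (vec_at i a b) = (indicator {0..<1} a * indicator {0..<1} b :: real)"
proof -
  obtain k where k: "k \<noteq> i" "UNIV = {i, k}"
    using exhaust_2[of i] UNIV_2 by (cases "i = 1") (auto intro: that[of 1] that[of 2])
  have all: "(\<forall>j. P j) \<longleftrightarrow> P i \<and> P k" for P :: "2 \<Rightarrow> bool"
    using k by (metis UNIV_I insertE singletonD)
  show ?thesis
    using k(1) by (simp add: unit_cell_def vec_at_def all indicator_def)
qed

lemma emeasure_unit_cell: "emeasure lborel unit_cell = 1"
proof -
  have ind: "indicator unit_cell (vec_at 1 a b) = (indicator ({0..<1} \<times> {0..<1}) (a, b) :: ennreal)" for a b
    using indicator_unit_cell_vec_at[of 1 a b]
    by (auto simp: indicator_def split: if_splits)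
  have m: "(\<lambda>(a, b). vec_at 1 a b) \<in> lborel \<Otimes>\<^sub>M lborel \<rightarrow>\<^sub>M borel"
    by (rule measurable_vec_at)
  have "emeasure lborel unit_cell = (\<integral>\<^sup>+y. indicator unit_cell y \<partial>lborel)"
    by simp
  also have "\<dots> = (\<integral>\<^sup>+p. indicator unit_cell (vec_at 1 (fst p) (snd p)) \<partial>(lborel \<Otimes>\<^sub>M lborel))"
    by (subst lborel_vec2[of 1], subst nn_integral_distr[OF m]) (auto simp: split_beta)
  also have "\<dots> = emeasure (lborel \<Otimes>\<^sub>M lborel) ({0..<1::real} \<times> {0..<1::real})"
    by (simp add: ind)
  also have "\<dots> = 1"
    by (simp add: lborel.emeasure_pair_measure_Times)
  finally show ?thesis .
qed

lemma prob_space_torus: "prob_space torus_lebesgue"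
  by (rule prob_spaceI) (simp add: emeasure_torus emeasure_unit_cell)

interpretation torus: prob_space torus_lebesgue
  by (rule prob_space_torus)

lemma integrable_bounded_torus:
  fixes f :: "torus \<Rightarrow> real"
  assumes "f \<in> borel_measurable borel" "\<And>x. \<bar>f x\<bar> \<le> B"
  shows "integrable torus_lebesgue f"
  using assms by (intro torus.integrable_const_bound[where B = B]) auto

lemma borel_measurable_continuous_torus:
  "continuous_on UNIV f \<Longrightarrow> f \<in> borel_measurable borel" for f :: "torus \<Rightarrow> 'b::topological_space"
  by (rule borel_measurable_continuous_onI)

lemma integrable_continuous_torus:
  fixes f :: "torus \<Rightarrow> real"
  assumes "continuous_on UNIV f"
  shows "integrable torus_lebesgue f"
proof -
  obtain B where "\<And>x. norm (f x) \<le> B" using bounded_continuous_torus[OF assms] by metis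
  then show ?thesis
    using borel_measurable_continuous_torus[OF assms]
    by (intro integrable_bounded_torus[of f B]) auto
qed

lemma integrable_mult_continuous:
  fixes p f :: "torus \<Rightarrow> real"
  assumes "integrable torus_lebesgue p" "continuous_on UNIV f"
  shows "integrable torus_lebesgue (\<lambda>x. p x * f x)"
proof -
  obtain B where B: "\<And>x. norm (f x) \<le> B" using bounded_continuous_torus[OF assms(2)] by metis
  have [measurable]: "f \<in> borel_measurable borel" "p \<in> borel_measurable borel"
    using borel_measurable_continuous_torus[OF assms(2)] borel_measurable_integrable[OF assms(1)]
    by auto
  show ?thesis
  proof (rule Bochner_Integration.integrable_bound)
    show "integrable torus_lebesgue (\<lambda>x. B * norm (p x))"
      using assms(1) by simp
    show "AE x in torus_lebesgue. norm (p x * f x) \<le> norm (B * norm (p x))"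
      using B order_trans[OF abs_ge_zero B[unfolded real_norm_def]]
      by (intro always_eventually allI) (simp add: abs_mult mult.commute mult_right_mono)
  qed simp
qed

text \<open>The lift of a nonempty open set meets the interior of the unit cell in a nonempty open set, which is not
  negligible.\<close>

lemma eq_0_if_integral_0:
  fixes f :: "torus \<Rightarrow> real"
  assumes cont: "continuous_on UNIV f" and nonneg: "\<And>x. 0 \<le> f x"
    and int: "(\<integral>x. f x \<partial>torus_lebesgue) = 0"
  shows "f x = 0"
proof (rule ccontr)
  assume "f x \<noteq> 0"
  let ?W = "(\<lambda>y. f (torus_proj y)) -` {0<..}"
  have W: "open ?W"
    using cont by (simp add: continuous_on_torus_iff continuous_on_open_vimage)
  have "AE x in torus_lebesgue. f x = 0"
    using integral_nonneg_eq_0_iff_AE[OF integrable_continuous_torus[OF cont]] nonneg int by auto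
  then have "AE x in torus_lebesgue. x \<notin> f -` {0<..}"
    by (auto elim!: eventually_mono)
  moreover have fW: "f -` {0<..} \<in> sets borel"
    using measurable_sets[OF borel_measurable_continuous_torus[OF cont], of "{0<..}"] by simp
  ultimately have "emeasure torus_lebesgue (f -` {0<..}) = 0"
    by (subst (asm) AE_iff_measurable[of "f -` {0<..}"]) auto
  moreover have "torus_proj -` (f -` {0<..}) = ?W" by auto
  ultimately have "emeasure lborel (?W \<inter> unit_cell) = 0"
    using emeasure_torus[OF fW] by simp
  moreover have WI: "?W \<inter> box 0 1 \<subseteq> ?W \<inter> unit_cell"
    by (auto simp: unit_cell_def mem_box_cart less_imp_le)
  moreover have "?W \<inter> unit_cell \<in> sets borel"
    using W by auto
  ultimately have "emeasure lborel (?W \<inter> box 0 1) = 0"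
    by (metis emeasure_mono le_zero_eq sets_lborel)
  then have "?W \<inter> box 0 1 \<in> null_sets lborel"
    using W by (intro null_setsI) auto
  then have "negligible (?W \<inter> box 0 1)"
    using null_sets_completionI by (auto simp: negligible_iff_null_sets)
  then have "?W \<inter> box 0 1 = {}"
    using W open_not_negligible[of "?W \<inter> box 0 1"] by (auto simp: open_Int)
  moreover have "?W \<inter> box 0 1 \<noteq> {}"
  proof -
    have "cell_rep x \<in> ?W" using \<open>f x \<noteq> 0\<close> nonneg[of x] by simp
    moreover have "cell_rep x \<in> closure (box 0 1)"
    proof -
      have "box 0 (1 :: real^2) \<noteq> {}" by (simp add: interval_ne_empty_cart)
      then show ?thesis
        using cell_rep_in[of x] unit_cell_subset_cbox by (auto simp: closure_box)
    qed
    ultimately show ?thesis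
      using W unfolding closure_iff_nhds_not_empty by blast
  qed
  ultimately show False by contradiction
qed

section \<open>Derivatives of functions on the torus along vector fields\<close>

definition torus_C1 :: "(torus \<Rightarrow> 'b::euclidean_space) \<Rightarrow> bool" where
  "torus_C1 \<phi> \<longleftrightarrow> C_k (Suc 0) (\<lambda>y. \<phi> (torus_proj y))"

text \<open>Every point over \<open>x\<close> gives the same value, since the lift of \<open>\<phi>\<close> is periodic.\<close>

definition Lie :: "vector_field \<Rightarrow> (torus \<Rightarrow> 'b::euclidean_space) \<Rightarrow> torus \<Rightarrow> 'b" where
  "Lie Z \<phi> x = frechet_derivative (\<lambda>y. \<phi> (torus_proj y)) (at (rep_torus x)) (Z x)"

lemma torus_C1_smooth: "torus_smooth \<phi> \<Longrightarrow> torus_C1 \<phi>"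
  unfolding torus_C1_def by (rule torus_smooth_C_k)

lemma torus_C1_derivative:
  "torus_C1 \<phi> \<Longrightarrow> ((\<lambda>y. \<phi> (torus_proj y)) has_derivative
      frechet_derivative (\<lambda>y. \<phi> (torus_proj y)) (at y)) (at y)"
  unfolding torus_C1_def by (rule C_k_SucD_derivative)

lemma torus_C1_continuous: "torus_C1 \<phi> \<Longrightarrow> continuous_on UNIV \<phi>"
  unfolding torus_C1_def by (subst continuous_on_torus_iff) (rule C_k_continuous)

lemma Lie_proj:
  assumes "torus_C1 \<phi>"
  shows "Lie Z \<phi> (torus_proj y) = frechet_derivative (\<lambda>y. \<phi> (torus_proj y)) (at y) (Z (torus_proj y))"
proof -
  have "\<And>y. (\<lambda>y. \<phi> (torus_proj y)) differentiable (at y)"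
    using assms by (auto simp: torus_C1_def)
  from periodic_rep[OF periodic_frechet_derivative[OF periodic_lift this]]
  show ?thesis by (simp add: Lie_def)
qed

lemma Lie_eqI:
  assumes "torus_C1 \<phi>" "((\<lambda>y. \<phi> (torus_proj y)) has_derivative D) (at y)"
  shows "Lie Z \<phi> (torus_proj y) = D (Z (torus_proj y))"
  using frechet_derivative_at[OF assms(2)] by (simp add: Lie_proj[OF assms(1)])

lemma torus_C1_const: "torus_C1 (\<lambda>x. c)"
  unfolding torus_C1_def by (rule C_k_const)

lemma torus_C1_add: "torus_C1 \<phi> \<Longrightarrow> torus_C1 \<psi> \<Longrightarrow> torus_C1 (\<lambda>x. \<phi> x + \<psi> x)"
  unfolding torus_C1_def by (rule C_k_add)

lemma torus_C1_mult:
  "torus_C1 \<phi> \<Longrightarrow> torus_C1 \<psi> \<Longrightarrow> torus_C1 (\<lambda>x. \<phi> x * \<psi> x)" for \<phi> \<psi> :: "torus \<Rightarrow> real"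
  unfolding torus_C1_def by (rule C_k_mult)

lemma Lie_const [simp]: "Lie Z (\<lambda>x. c) x = 0"
  by (cases x rule: torus_cases) (simp add: Lie_eqI[OF torus_C1_const has_derivative_const])

lemma Lie_add:
  assumes "torus_C1 \<phi>" "torus_C1 \<psi>"
  shows "Lie Z (\<lambda>x. \<phi> x + \<psi> x) x = Lie Z \<phi> x + Lie Z \<psi> x"
proof (cases x rule: torus_cases)
  case (1 y)
  show ?thesis unfolding 1
    using Lie_eqI[OF torus_C1_add[OF assms] has_derivative_add[OF torus_C1_derivative[OF assms(1)]
          torus_C1_derivative[OF assms(2)]]] assms by (simp add: Lie_proj)
qed

lemma Lie_mult:
  fixes \<phi> \<psi> :: "torus \<Rightarrow> real"
  assumes "torus_C1 \<phi>" "torus_C1 \<psi>"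
  shows "Lie Z (\<lambda>x. \<phi> x * \<psi> x) x = \<phi> x * Lie Z \<psi> x + Lie Z \<phi> x * \<psi> x"
proof (cases x rule: torus_cases)
  case (1 y)
  show ?thesis unfolding 1
    using Lie_eqI[OF torus_C1_mult[OF assms] has_derivative_mult[OF torus_C1_derivative[OF assms(1)]
          torus_C1_derivative[OF assms(2)]]] assms by (simp add: Lie_proj)
qed

lemma linear_Lie:
  assumes "torus_C1 \<phi>"
  shows "linear (frechet_derivative (\<lambda>y. \<phi> (torus_proj y)) (at y))"
  using has_derivative_linear[OF torus_C1_derivative[OF assms]] .

lemma Lie_field_add:
  assumes "torus_C1 \<phi>"
  shows "Lie (\<lambda>x. Z x + W x) \<phi> x = Lie Z \<phi> x + Lie W \<phi> x"
  unfolding Lie_def by (rule linear_add[OF linear_Lie[OF assms]])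

lemma Lie_field_scale:
  assumes "torus_C1 \<phi>"
  shows "Lie (\<lambda>x. a x *\<^sub>R Z x) \<phi> x = a x *\<^sub>R Lie Z \<phi> x"
  unfolding Lie_def by (rule linear_scale[OF linear_Lie[OF assms]])

lemma Lie_nth:
  assumes "torus_C1 Z"
  shows "Lie W (\<lambda>x. Z x $ i) x = Lie W Z x $ i"
proof (cases x rule: torus_cases)
  case (1 y)
  have "torus_C1 (\<lambda>x. Z x $ i)"
    using assms unfolding torus_C1_def by (rule C_k_bounded_linear[OF bounded_linear_vec_nth])
  then show ?thesis unfolding 1
    using Lie_eqI[OF _ bounded_linear.has_derivative[OF bounded_linear_vec_nth torus_C1_derivative[OF assms]]]
      assms by (simp add: Lie_proj)
qed

lemma Lie_partials:
  fixes \<phi> :: "torus \<Rightarrow> real"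
  assumes "torus_C1 \<phi>"
  shows "Lie W \<phi> x = W x $ 1 * Lie (\<lambda>_. axis 1 1) \<phi> x + W x $ 2 * Lie (\<lambda>_. axis 2 1) \<phi> x"
proof -
  have "W x = (W x $ 1) *\<^sub>R axis 1 1 + (W x $ 2) *\<^sub>R axis 2 1"
    by (simp add: vec_eq_iff forall_2 axis_def)
  then have "Lie W \<phi> x = Lie (\<lambda>x. (W x $ 1) *\<^sub>R axis 1 1 + (W x $ 2) *\<^sub>R axis 2 1) \<phi> x"
    by (simp add: Lie_def)
  also have "\<dots> = W x $ 1 * Lie (\<lambda>_. axis 1 1) \<phi> x + W x $ 2 * Lie (\<lambda>_. axis 2 1) \<phi> x"
    by (simp add: Lie_field_add[OF assms] Lie_field_scale[OF assms])
  finally show ?thesis .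
qed

lemma continuous_Lie:
  assumes "torus_C1 \<phi>" "continuous_on UNIV Z"
  shows "continuous_on UNIV (Lie Z \<phi>)"
  unfolding continuous_on_torus_iff Lie_proj[OF assms(1)]
  using continuous_directional_derivative[OF assms(1)[unfolded torus_C1_def] continuous_on_id]
    assms(2)[unfolded continuous_on_torus_iff] by simp

lemma torus_smooth_const: "torus_smooth (\<lambda>x. c)"
  by (simp add: torus_smooth_def C_infinity_def C_k_const)

lemma torus_smooth_add: "torus_smooth \<phi> \<Longrightarrow> torus_smooth \<psi> \<Longrightarrow> torus_smooth (\<lambda>x. \<phi> x + \<psi> x)"
  by (simp add: torus_smooth_def C_infinity_def C_k_add)

lemma torus_smooth_mult:
  "torus_smooth \<phi> \<Longrightarrow> torus_smooth \<psi> \<Longrightarrow> torus_smooth (\<lambda>x. \<phi> x * \<psi> x)" for \<phi> \<psi> :: "torus \<Rightarrow> real"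
  by (simp add: torus_smooth_def C_infinity_def C_k_mult)

lemma torus_smooth_minus:
  "torus_smooth \<phi> \<Longrightarrow> torus_smooth (\<lambda>x. - \<phi> x)" for \<phi> :: "torus \<Rightarrow> real"
  using torus_smooth_mult[OF torus_smooth_const[of "-1"]] by simp

lemma torus_smooth_diff:
  "torus_smooth \<phi> \<Longrightarrow> torus_smooth \<psi> \<Longrightarrow> torus_smooth (\<lambda>x. \<phi> x - \<psi> x)" for \<phi> \<psi> :: "torus \<Rightarrow> real"
  using torus_smooth_add[OF _ torus_smooth_minus] by simp

lemma torus_smooth_inverse:
  "torus_smooth \<phi> \<Longrightarrow> (\<And>x. \<phi> x \<noteq> 0) \<Longrightarrow> torus_smooth (\<lambda>x. inverse (\<phi> x))" for \<phi> :: "torus \<Rightarrow> real"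
  by (simp add: torus_smooth_def C_infinity_def C_k_inverse)

lemma torus_smooth_scaleR:
  "torus_smooth \<phi> \<Longrightarrow> torus_smooth Z \<Longrightarrow> torus_smooth (\<lambda>x. \<phi> x *\<^sub>R Z x)"
  by (simp add: torus_smooth_def C_infinity_def C_k_bounded_bilinear[OF bounded_bilinear_scaleR])

lemma torus_smooth_nth: "torus_smooth Z \<Longrightarrow> torus_smooth (\<lambda>x. Z x $ i)"
  by (simp add: torus_smooth_def C_infinity_def C_k_bounded_linear[OF bounded_linear_vec_nth])

lemma torus_smooth_Lie:
  assumes "torus_smooth Z" "torus_smooth \<phi>" shows "torus_smooth (Lie Z \<phi>)"
  unfolding torus_smooth_def C_infinity_def Lie_proj[OF torus_C1_smooth[OF assms(2)]]
  by (intro allI C_k_directional_derivative torus_smooth_C_k assms)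

text \<open>Opposite sides of the unit cell have the same image on the torus, so the boundary terms cancel.\<close>

lemma integral_partial_derivative_0:
  fixes \<phi> :: "torus \<Rightarrow> real"
  assumes "torus_C1 \<phi>"
  shows "(\<integral>x. Lie (\<lambda>_. axis i 1) \<phi> x \<partial>torus_lebesgue) = 0"
proof -
  let ?F = "\<lambda>y. \<phi> (torus_proj y)"
  let ?D = "\<lambda>y. frechet_derivative ?F (at y) (axis i 1)"
  have contD: "continuous_on UNIV ?D"
    using assms C_k_continuous[of 0 ?D] by (auto simp: torus_C1_def)
  have meas: "Lie (\<lambda>_. axis i 1) \<phi> \<in> borel_measurable borel"
    by (intro borel_measurable_continuous_torus continuous_Lie assms continuous_intros)
  have m: "(\<lambda>(a, b). vec_at i a b) \<in> lborel \<Otimes>\<^sub>M lborel \<rightarrow>\<^sub>M borel"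
    by (rule measurable_vec_at)
  have [measurable]: "?D \<in> borel_measurable borel"
    by (rule borel_measurable_continuous_onI[OF contD])
  obtain B where B: "\<And>x. norm (Lie (\<lambda>_. axis i 1) \<phi> x) \<le> B"
    using bounded_continuous_torus[OF continuous_Lie[OF assms continuous_on_const]] by metis
  have DB: "\<bar>?D y\<bar> \<le> B" for y
    using B[of "torus_proj y"] by (simp add: Lie_proj[OF assms])
  let ?G = "\<lambda>a b. indicator {0..<1} a * indicator {0..<1} b * ?D (vec_at i a b)"
  have mp: "(\<lambda>p. vec_at i (fst p) (snd p)) \<in> borel_measurable (lborel \<Otimes>\<^sub>M lborel)"
    using m by (simp add: split_beta)
  have int: "integrable (lborel \<Otimes>\<^sub>M lborel) (\<lambda>(a, b). ?G a b)"
  proof (rule Bochner_Integration.integrable_bound)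
    show "integrable (lborel \<Otimes>\<^sub>M lborel) (\<lambda>p. B * indicator ({0..<1::real} \<times> {0..<1::real}) p)"
      by (intro integrable_mult_right integrable_real_indicator)
        (auto simp: lborel.emeasure_pair_measure_Times)
    have hD: "(\<lambda>p. ?D (vec_at i (fst p) (snd p))) \<in> borel_measurable (lborel \<Otimes>\<^sub>M lborel)"
      by (rule measurable_compose[OF mp]) fact
    have hI: "(\<lambda>p. indicator {0..<1::real} (fst p) * indicator {0..<1::real} (snd p) :: real)
        \<in> borel_measurable (lborel \<Otimes>\<^sub>M lborel)"
      unfolding indicator_times[symmetric] by (intro borel_measurable_indicator pair_measureI) auto
    have "(\<lambda>p. indicator {0..<1} (fst p) * indicator {0..<1} (snd p) * ?D (vec_at i (fst p) (snd p)))
        \<in> borel_measurable (lborel \<Otimes>\<^sub>M lborel)"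
      by (rule borel_measurable_times[OF hI hD])
    then show "(\<lambda>(a, b). ?G a b) \<in> borel_measurable (lborel \<Otimes>\<^sub>M lborel)"
      by (simp only: case_prod_beta')
    have "norm (?G a b) \<le> norm (B * indicator ({0..<1::real} \<times> {0..<1::real}) (a, b))" for a b
    proof (cases "a \<in> {0..<1} \<and> b \<in> {0..<1}")
      case True
      then show ?thesis using order_trans[OF DB[of "vec_at i a b"] abs_ge_self] by simp
    next
      case False
      then have "?G a b = 0" by (auto simp: indicator_def)
      then show ?thesis by (simp only: norm_zero norm_ge_zero)
    qed
    then show "AE p in lborel \<Otimes>\<^sub>M lborel. norm (case p of (a, b) \<Rightarrow> ?G a b) \<le>
        norm (B * indicator ({0..<1::real} \<times> {0..<1::real}) p)"
      by (intro always_eventually allI) (simp only: split_paired_all prod.case)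
  qed
  have inner: "(\<integral>a. ?G a b \<partial>lborel) = 0" for b
  proof -
    have der: "DERIV (\<lambda>a. ?F (vec_at i a b)) a :> ?D (vec_at i a b)" for a
    proof -
      have "((\<lambda>a. vec_at i a b) has_derivative (\<lambda>s. s *\<^sub>R axis i 1)) (at a)"
      proof -
        have "(\<lambda>a. vec_at i a b) = (\<lambda>a. vec_at i 0 b + a *\<^sub>R axis i 1)"
          by (auto simp: vec_at_def axis_def vec_eq_iff)
        moreover have "((\<lambda>a. vec_at i 0 b + a *\<^sub>R axis i 1) has_derivative (\<lambda>s. s *\<^sub>R axis i 1)) (at a)"
          by (auto intro!: derivative_eq_intros)
        ultimately show ?thesis by (simp only:)
      qed
      from has_derivative_compose[OF this torus_C1_derivative[OF assms]]
      have "((\<lambda>a. ?F (vec_at i a b)) has_derivative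
          (\<lambda>s. frechet_derivative ?F (at (vec_at i a b)) (s *\<^sub>R axis i 1))) (at a)" .
      moreover have "(\<lambda>s. frechet_derivative ?F (at (vec_at i a b)) (s *\<^sub>R axis i 1)) =
          (*) (?D (vec_at i a b))"
        by (simp add: linear_scale[OF linear_Lie[OF assms]] fun_eq_iff mult.commute)
      ultimately show ?thesis by (simp add: has_field_derivative_def)
    qed
    have "(\<integral>a. ?D (vec_at i a b) * indicator {0..1} a \<partial>lborel) = ?F (vec_at i 1 b) - ?F (vec_at i 0 b)"
    proof (rule integral_FTC_Icc_real)
      have "continuous_on UNIV (\<lambda>a. ?D (vec_at i a b))"
        by (intro continuous_on_compose2[OF contD] continuous_intros) auto
      then show "isCont (\<lambda>a. ?D (vec_at i a b)) a" for a
        by (simp add: continuous_on_eq_continuous_at)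
    qed (use der in auto)
    also have "torus_proj (vec_at i 1 b) = torus_proj (vec_at i 0 b)"
      by (auto simp: proj_eq_iff lattice_equiv_def vec_at_def)
    finally have *: "(\<integral>a. ?D (vec_at i a b) * indicator {0..1} a \<partial>lborel) = 0" by simp
    have "(\<integral>a. ?G a b \<partial>lborel) = (\<integral>a. indicator {0..<1} b * (?D (vec_at i a b) * indicator {0..1} a) \<partial>lborel)"
    proof (rule integral_cong_AE)
      have [measurable]: "(\<lambda>a. vec_at i a b) \<in> borel_measurable borel"
        by (intro borel_measurable_continuous_onI continuous_intros)
      show "(\<lambda>a. ?G a b) \<in> borel_measurable lborel" by measurable
      show "(\<lambda>a. indicator {0..<1} b * (?D (vec_at i a b) * indicator {0..1} a)) \<in> borel_measurable lborel"
        by measurable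
      show "AE a in lborel. ?G a b = indicator {0..<1} b * (?D (vec_at i a b) * indicator {0..1} a)"
        using AE_lborel_singleton[of "1::real"] by eventually_elim (auto simp: indicator_def)
    qed
    then show ?thesis using * by simp
  qed
  have "(\<integral>x. Lie (\<lambda>_. axis i 1) \<phi> x \<partial>torus_lebesgue) = (\<integral>y. indicator unit_cell y *\<^sub>R ?D y \<partial>lborel)"
    by (simp add: integral_torus[OF meas] Lie_proj[OF assms])
  also have "\<dots> = (\<integral>p. (case p of (a, b) \<Rightarrow> ?G a b) \<partial>(lborel \<Otimes>\<^sub>M lborel))"
    by (subst lborel_vec2[of i], subst integral_distr[OF m])
      (auto simp: case_prod_beta' indicator_unit_cell_vec_at)
  also have "\<dots> = (\<integral>b. (\<integral>a. ?G a b \<partial>lborel) \<partial>lborel)"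
    using lborel_pair.integral_snd[OF int] by simp
  also have "\<dots> = 0" by (simp add: inner)
  finally show ?thesis .
qed

section \<open>The generator of a flow\<close>

context smooth_field
begin

lemma continuous_u: "continuous_on UNIV u"
  by (rule torus_smooth_continuous[OF smooth])

lemma flow_has_derivative:
  fixes \<phi> :: "torus \<Rightarrow> 'b::euclidean_space"
  assumes "torus_C1 \<phi>"
  shows "((\<lambda>t. \<phi> (flow u t x)) has_vector_derivative Lie u \<phi> (flow u t x)) (at t)"
proof (cases x rule: torus_cases)
  case (1 y)
  have "((\<lambda>y. \<phi> (torus_proj y)) \<circ> (\<lambda>t. F t y) has_vector_derivative
      frechet_derivative (\<lambda>y. \<phi> (torus_proj y)) (at (F t y)) (U (F t y))) (at t)"
    by (rule vector_derivative_diff_chain_within[OF has_vector_derivative_flow_lift,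
          OF has_derivative_at_withinI[OF torus_C1_derivative[OF assms]]])
  then show ?thesis
    by (simp add: o_def 1 flow_proj Lie_proj[OF assms])
qed

lemma flow_has_real_derivative:
  fixes \<phi> :: "torus \<Rightarrow> real"
  assumes "torus_C1 \<phi>"
  shows "((\<lambda>t. \<phi> (flow u t x)) has_real_derivative Lie u \<phi> (flow u t x)) (at t)"
  using flow_has_derivative[OF assms] by (simp add: has_real_derivative_iff_has_vector_derivative)

lemma flow_increment_bound:
  fixes \<phi> :: "torus \<Rightarrow> real"
  assumes "torus_C1 \<phi>" "\<And>x. \<bar>Lie u \<phi> x\<bar> \<le> B"
  shows "\<bar>\<phi> (flow u t x) - \<phi> x\<bar> \<le> B * \<bar>t\<bar>"
proof -
  have "norm (\<phi> (flow u t x) - \<phi> (flow u 0 x)) \<le> B * norm (t - 0)"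
    by (rule field_differentiable_bound[of UNIV "\<lambda>t. \<phi> (flow u t x)" "\<lambda>t. Lie u \<phi> (flow u t x)"])
      (use assms(2) flow_has_real_derivative[OF assms(1)] in auto)
  then show ?thesis by simp
qed

lemma difference_quotient_limit:
  fixes \<phi> :: "torus \<Rightarrow> real"
  assumes "torus_C1 \<phi>"
  shows "(\<lambda>n. real (Suc n) * (\<phi> (flow u (1 / real (Suc n)) x) - \<phi> x)) \<longlonglongrightarrow> Lie u \<phi> x"
proof -
  have "((\<lambda>h. (\<phi> (flow u (0 + h) x) - \<phi> (flow u 0 x)) / h) \<longlongrightarrow> Lie u \<phi> (flow u 0 x)) (at 0)"
    using flow_has_real_derivative[OF assms, of x 0] by (simp add: DERIV_def)
  moreover have "filterlim (\<lambda>n. 1 / real (Suc n)) (at 0) sequentially"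
    unfolding filterlim_at using LIMSEQ_inverse_real_of_nat by (simp add: inverse_eq_divide)
  ultimately have "(\<lambda>n. (\<phi> (flow u (0 + 1 / real (Suc n)) x) - \<phi> (flow u 0 x)) / (1 / real (Suc n)))
      \<longlonglongrightarrow> Lie u \<phi> (flow u 0 x)"
    by (rule filterlim_compose)
  then show ?thesis by (simp add: mult.commute)
qed

lemma measurable_flow [measurable]: "flow u t \<in> borel \<rightarrow>\<^sub>M borel"
  by (rule borel_measurable_continuous_onI[OF continuous_flow])

lemma difference_quotient_integral_limit:
  fixes \<phi> q :: "torus \<Rightarrow> real"
  assumes \<phi>: "torus_C1 \<phi>" and q: "integrable torus_lebesgue q"
  shows "(\<lambda>n. \<integral>x. q x * (real (Suc n) * (\<phi> (flow u (1 / real (Suc n)) x) - \<phi> x)) \<partial>torus_lebesgue)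
    \<longlonglongrightarrow> (\<integral>x. q x * Lie u \<phi> x \<partial>torus_lebesgue)"
proof -
  have cont: "continuous_on UNIV \<phi>" "continuous_on UNIV (Lie u \<phi>)"
    using \<phi> by (auto intro: torus_C1_continuous continuous_Lie continuous_u)
  have [measurable]: "\<phi> \<in> borel_measurable borel" "Lie u \<phi> \<in> borel_measurable borel"
      "q \<in> borel_measurable borel"
    using cont borel_measurable_continuous_torus borel_measurable_integrable[OF q] by auto
  obtain B where B: "\<And>x. norm (Lie u \<phi> x) \<le> B"
    using bounded_continuous_torus[OF cont(2)] by metis
  have bound: "norm (q x * (real (Suc n) * (\<phi> (flow u (1 / real (Suc n)) x) - \<phi> x))) \<le> B * norm (q x)"
    for n x
  proof -
    have "\<bar>\<phi> (flow u (1 / real (Suc n)) x) - \<phi> x\<bar> \<le> B * \<bar>1 / real (Suc n)\<bar>"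
      using B by (intro flow_increment_bound[OF \<phi>]) auto
    then have "real (Suc n) * \<bar>\<phi> (flow u (1 / real (Suc n)) x) - \<phi> x\<bar> \<le> B"
      by (simp add: field_simps)
    then have "\<bar>q x\<bar> * (real (Suc n) * \<bar>\<phi> (flow u (1 / real (Suc n)) x) - \<phi> x\<bar>) \<le> \<bar>q x\<bar> * B"
      by (rule mult_left_mono) simp
    then show ?thesis by (simp add: abs_mult mult.commute)
  qed
  show ?thesis
  proof (rule integral_dominated_convergence[where w = "\<lambda>x. B * norm (q x)"])
    show "integrable torus_lebesgue (\<lambda>x. B * norm (q x))" using q by simp
    show "AE x in torus_lebesgue. (\<lambda>n. q x * (real (Suc n) * (\<phi> (flow u (1 / real (Suc n)) x) - \<phi> x)))
        \<longlonglongrightarrow> q x * Lie u \<phi> x"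
      by (intro always_eventually allI tendsto_mult difference_quotient_limit \<phi> tendsto_const)
    show "AE x in torus_lebesgue. norm (q x * (real (Suc n) * (\<phi> (flow u (1 / real (Suc n)) x) - \<phi> x)))
        \<le> B * norm (q x)" for n
      by (intro always_eventually allI bound)
  qed simp_all
qed

lemma flow_invariant_integral:
  fixes h f :: "torus \<Rightarrow> real"
  assumes inv: "flow_invariant u (density torus_lebesgue (\<lambda>x. ennreal (h x)))"
    and h: "h \<in> borel_measurable borel" "\<And>x. 0 \<le> h x" and f: "f \<in> borel_measurable borel"
  shows "(\<integral>x. f (flow u t x) * h x \<partial>torus_lebesgue) = (\<integral>x. f x * h x \<partial>torus_lebesgue)"
proof -
  note [measurable] = h(1) f
  let ?M = "density torus_lebesgue (\<lambda>x. ennreal (h x))"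
  have dens: "(\<integral>x. k x * h x \<partial>torus_lebesgue) = (\<integral>x. k x \<partial>?M)" if "k \<in> borel_measurable borel" for k
    using that h(2) by (subst integral_density) (auto simp: mult.commute)
  have "(\<integral>x. f x \<partial>?M) = (\<integral>x. f x \<partial>distr ?M borel (flow u t))"
    using inv by (simp add: flow_invariant_def)
  also have "\<dots> = (\<integral>x. f (flow u t x) \<partial>?M)"
    by (rule integral_distr) auto
  finally show ?thesis by (simp add: dens)
qed

text \<open>Differentiate the invariance of the measure \<open>h dx\<close> in time, integrate by parts, and test the
  resulting divergence against itself.\<close>

lemma flow_invariant_divergence:
  fixes h :: "torus \<Rightarrow> real"
  assumes inv: "flow_invariant u (density torus_lebesgue (\<lambda>x. ennreal (h x)))"
    and h: "torus_smooth h" "\<And>x. 0 < h x"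
  shows "Lie u h x + h x * (Lie (\<lambda>_. axis 1 1) (\<lambda>x. u x $ 1) x + Lie (\<lambda>_. axis 2 1) (\<lambda>x. u x $ 2) x) = 0"
    (is "?\<delta> x = 0")
proof -
  have hm: "h \<in> borel_measurable borel"
    by (intro borel_measurable_continuous_torus torus_smooth_continuous h)
  have inth: "integrable torus_lebesgue h"
    by (intro integrable_continuous_torus torus_smooth_continuous h)
  have weak: "(\<integral>x. h x * Lie u \<phi> x \<partial>torus_lebesgue) = 0" if \<phi>: "torus_C1 \<phi>" for \<phi>
  proof -
    have fm [measurable]: "\<phi> \<in> borel_measurable borel"
      by (intro borel_measurable_continuous_torus torus_C1_continuous \<phi>)
    have "(\<integral>x. h x * (c * (\<phi> (flow u t x) - \<phi> x)) \<partial>torus_lebesgue) = 0" for c t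
    proof -
      have "continuous_on UNIV (\<lambda>x. \<phi> (flow u t x))"
        by (rule continuous_on_compose2[OF torus_C1_continuous[OF \<phi>] continuous_flow]) simp
      from integrable_mult_continuous[OF inth this]
      have i1: "integrable torus_lebesgue (\<lambda>x. \<phi> (flow u t x) * h x)"
        by (simp add: mult.commute)
      have i2: "integrable torus_lebesgue (\<lambda>x. \<phi> x * h x)"
        using integrable_mult_continuous[OF inth torus_C1_continuous[OF \<phi>]] by (simp add: mult.commute)
      have "(\<integral>x. h x * (c * (\<phi> (flow u t x) - \<phi> x)) \<partial>torus_lebesgue)
          = (\<integral>x. c * (\<phi> (flow u t x) * h x - \<phi> x * h x) \<partial>torus_lebesgue)"
        by (intro Bochner_Integration.integral_cong refl) (simp add: algebra_simps)
      also have "\<dots> = 0"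
        using flow_invariant_integral[OF inv hm less_imp_le[OF h(2)] fm, of t] i1 i2 by simp
      finally show ?thesis .
    qed
    then have "(\<lambda>n. 0) \<longlonglongrightarrow> (\<integral>x. h x * Lie u \<phi> x \<partial>torus_lebesgue)"
      using difference_quotient_integral_limit[OF \<phi> inth] by (simp only:)
    then show ?thesis by (rule LIMSEQ_unique[OF _ tendsto_const])
  qed
  have sm: "torus_smooth (\<lambda>x. u x $ i)" for i by (rule torus_smooth_nth[OF smooth])
  have axsm: "torus_smooth (\<lambda>_. axis i 1)" for i by (rule torus_smooth_const)
  have smd: "torus_smooth ?\<delta>"
    by (intro torus_smooth_add torus_smooth_mult torus_smooth_Lie h smooth sm axsm)
  \<comment> \<open>The square of the divergence is itself a divergence, up to a term that the weak identity annihilates.\<close>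
  have pt: "?\<delta> x * ?\<delta> x = Lie (\<lambda>_. axis 1 1) (\<lambda>x. ?\<delta> x * (h x * u x $ 1)) x
      + Lie (\<lambda>_. axis 2 1) (\<lambda>x. ?\<delta> x * (h x * u x $ 2)) x - h x * Lie u ?\<delta> x" for x
  proof -
    have L: "Lie W (\<lambda>x. ?\<delta> x * (h x * u x $ i)) x =
        ?\<delta> x * (h x * Lie W (\<lambda>x. u x $ i) x + Lie W h x * u x $ i) + Lie W ?\<delta> x * (h x * u x $ i)"
      for i W
      using Lie_mult[OF torus_C1_smooth[OF smd] torus_C1_smooth[OF torus_smooth_mult[OF h(1) sm]], of W i x]
        Lie_mult[OF torus_C1_smooth[OF h(1)] torus_C1_smooth[OF sm], of W i x] by simp
    have e1: "Lie u h x = u x $ 1 * Lie (\<lambda>_. axis 1 1) h x + u x $ 2 * Lie (\<lambda>_. axis 2 1) h x"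
      by (rule Lie_partials[OF torus_C1_smooth[OF h(1)]])
    have e2: "Lie u ?\<delta> x = u x $ 1 * Lie (\<lambda>_. axis 1 1) ?\<delta> x + u x $ 2 * Lie (\<lambda>_. axis 2 1) ?\<delta> x"
      by (rule Lie_partials[OF torus_C1_smooth[OF smd]])
    have gen: "d * d = (d * (hh * a + h1 * v1) + d1 * (hh * v1)) + (d * (hh * b + h2 * v2) + d2 * (hh * v2))
        - hh * (v1 * d1 + v2 * d2)"
      if "d = (v1 * h1 + v2 * h2) + hh * (a + b)" for d hh a b h1 h2 v1 v2 d1 d2 :: real
    proof -
      have "d * d = d * ((v1 * h1 + v2 * h2) + hh * (a + b))" using that by simp
      then show ?thesis by (simp add: algebra_simps)
    qed
    show ?thesis
      unfolding L e2 by (rule gen) (simp only: e1)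
  qed
  have C: "torus_C1 (\<lambda>x. ?\<delta> x * (h x * u x $ i))" for i
    by (intro torus_C1_smooth torus_smooth_mult smd h sm)
  have cont: "continuous_on UNIV (Lie (\<lambda>_. axis j 1) (\<lambda>x. ?\<delta> x * (h x * u x $ i)))"
    "continuous_on UNIV (\<lambda>x. h x * Lie u ?\<delta> x)" for i j
    by (intro continuous_Lie C continuous_on_const continuous_on_mult continuous_u
        torus_smooth_continuous[OF h(1)] torus_C1_smooth smd)+
  have "(\<integral>x. ?\<delta> x * ?\<delta> x \<partial>torus_lebesgue) = 0"
    unfolding pt using weak[OF torus_C1_smooth[OF smd]]
    by (simp add: integral_partial_derivative_0[OF C] integrable_continuous_torus[OF cont(1)]
        integrable_continuous_torus[OF cont(2)])
  then have "?\<delta> x * ?\<delta> x = 0"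
    using torus_smooth_continuous[OF smd]
    by (intro eq_0_if_integral_0[of "\<lambda>x. ?\<delta> x * ?\<delta> x"] continuous_on_mult) auto
  then show ?thesis by simp
qed

end

section \<open>A moving frame and the derivative of the flow\<close>

definition det2 :: "real^2 \<Rightarrow> real^2 \<Rightarrow> real" where
  "det2 a b = a $ 1 * b $ 2 - a $ 2 * b $ 1"

text \<open>If the determinant vanishes, one of the two vectors turned by a right angle is orthogonal to both.\<close>

lemma det2_nonzero_if_span:
  assumes "span {a, b} = UNIV" shows "det2 a b \<noteq> 0"
proof
  assume "det2 a b = 0"
  define n where "n = (if a = 0 then vector [- b $ 2, b $ 1] else vector [- a $ 2, a $ 1] :: real^2)"
  have "a \<bullet> n = 0"
    by (cases "a = 0") (auto simp: n_def inner_vec_def sum_2)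
  moreover have "b \<bullet> n = 0"
  proof (cases "a = 0")
    case True
    then show ?thesis by (simp add: n_def inner_vec_def sum_2)
  next
    case False
    then have "b \<bullet> n = det2 a b"
      by (simp add: n_def inner_vec_def sum_2 det2_def mult.commute)
    then show ?thesis using \<open>det2 a b = 0\<close> by simp
  qed
  ultimately have orth: "a \<bullet> n = 0" "b \<bullet> n = 0" .
  have "x \<bullet> n = 0" if "x \<in> span {a, b}" for x
    using that by (induction rule: span_induct_alt) (auto simp: inner_add_left orth)
  then have n0: "x \<bullet> n = 0" for x using assms by blast
  then have "n = 0" using inner_eq_zero_iff by blast
  then have "b = 0 \<or> a = 0" "a = 0 \<longrightarrow> b = 0"
    by (auto simp: n_def vec_eq_iff forall_2 vector_2 split: if_splits)
  then have "a = 0" "b = 0" 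
    using \<open>n = 0\<close> by (auto simp: n_def vec_eq_iff forall_2 vector_2 split: if_splits)
  then have "span {a, b} = {0}" by simp
  then have "axis 1 1 = (0::real^2)" using assms by (metis UNIV_I singletonD)
  then show False by (simp add: axis_eq_0_iff)
qed

locale transversal_pair = smooth_field u for u +
  fixes v :: vector_field and h :: "torus \<Rightarrow> real"
  assumes v_smooth: "torus_smooth v"
    and h_smooth: "torus_smooth h" and h_pos: "0 < h x"
    and invariant: "flow_invariant u (density torus_lebesgue (\<lambda>x. ennreal (h x)))"
    and transversal: "det2 (u x) (v x) \<noteq> 0"
begin

text \<open>The multiple of \<open>v\<close> for which the pair \<open>u, w\<close> has area 1 with respect to the invariant density \<open>h\<close>.\<close>

definition w :: vector_field where
  "w x = inverse (h x * det2 (u x) (v x)) *\<^sub>R v x"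

lemma smooth_det2: "torus_smooth (\<lambda>x. det2 (u x) (v x))"
  unfolding det2_def
  by (intro torus_smooth_diff torus_smooth_mult torus_smooth_nth smooth v_smooth)

lemma w_smooth: "torus_smooth w"
  unfolding w_def using transversal h_pos less_imp_neq[OF h_pos]
  by (intro torus_smooth_scaleR torus_smooth_inverse torus_smooth_mult smooth_det2 h_smooth v_smooth)
    (metis mult_eq_0_iff)

lemma det2_u_w: "det2 (u x) (w x) = inverse (h x)"
proof -
  have "det2 (u x) (w x) = inverse (h x * det2 (u x) (v x)) * det2 (u x) (v x)"
    by (simp add: det2_def w_def algebra_simps)
  then show ?thesis using transversal by simp
qed

definition bracket :: vector_field where
  "bracket x = Lie u w x - Lie w u x"

text \<open>The coefficient of \<open>u\<close> when \<open>bracket\<close> is expanded in the frame \<open>u, w\<close>.\<close>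

definition g :: "torus \<Rightarrow> real" where
  "g x = h x * det2 (bracket x) (w x)"

lemma frame_expansion: "z = (h x * det2 z (w x)) *\<^sub>R u x + (h x * det2 (u x) z) *\<^sub>R w x"
proof -
  have "det2 (u x) (w x) *\<^sub>R z = det2 z (w x) *\<^sub>R u x + det2 (u x) z *\<^sub>R w x"
    by (simp add: vec_eq_iff forall_2 det2_def algebra_simps)
  then have "h x *\<^sub>R (det2 (u x) (w x) *\<^sub>R z) = h x *\<^sub>R (det2 z (w x) *\<^sub>R u x + det2 (u x) z *\<^sub>R w x)"
    by simp
  then show ?thesis
    using h_pos[of x] by (simp add: det2_u_w scaleR_add_right)
qed

lemma torus_C1_u: "torus_C1 u" and torus_C1_w: "torus_C1 w" and torus_C1_h: "torus_C1 h"
  by (auto intro: torus_C1_smooth smooth w_smooth h_smooth)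

text \<open>The area \<open>h det(u, w)\<close> is constant and the flow preserves \<open>h dx\<close>, so the Lie derivative of
  \<open>w\<close> along \<open>u\<close> has no component outside of \<open>u\<close>.\<close>

lemma bracket_eq: "Lie u w x - Lie w u x = g x *\<^sub>R u x"
proof -
  have cu: "torus_C1 (\<lambda>x. u x $ i)" and cw: "torus_C1 (\<lambda>x. w x $ i)" for i
    by (auto intro: torus_C1_smooth torus_smooth_nth smooth w_smooth)
  have cuw: "torus_C1 (\<lambda>x. u x $ i * w x $ j)" for i j
    by (intro torus_C1_mult cu cw)
  let ?k = "\<lambda>x. u x $ 1 * w x $ 2 + (-1) * (u x $ 2 * w x $ 1)"
  have ck: "torus_C1 ?k" by (intro torus_C1_add torus_C1_mult cu cw torus_C1_const)
  have k: "?k x = inverse (h x)" for x using det2_u_w[of x] by (simp add: det2_def)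
  have hk: "h x * ?k x = 1" for x using h_pos[of x] by (simp only: k) simp
  have "Lie u (\<lambda>x. h x * ?k x) x = 0"
    by (simp only: hk) simp
  then have d1: "h x * Lie u ?k x + Lie u h x * ?k x = 0"
    by (simp only: Lie_mult[OF torus_C1_h ck])
  have "Lie u ?k x = Lie u (\<lambda>x. u x $ 1 * w x $ 2) x + Lie u (\<lambda>x. (-1) * (u x $ 2 * w x $ 1)) x"
    by (rule Lie_add[OF cuw torus_C1_mult[OF torus_C1_const cuw]])
  then have d2: "Lie u ?k x = (u x $ 1 * Lie u w x $ 2 + Lie u u x $ 1 * w x $ 2)
      - (u x $ 2 * Lie u w x $ 1 + Lie u u x $ 2 * w x $ 1)"
    using Lie_mult[OF torus_C1_const[of "-1"] cuw[of 2 1], of u x]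
    by (simp add: Lie_mult[OF cu cw] Lie_nth[OF torus_C1_u] Lie_nth[OF torus_C1_w])
  have div: "Lie u h x + h x * (Lie (\<lambda>_. axis 1 1) u x $ 1 + Lie (\<lambda>_. axis 2 1) u x $ 2) = 0"
    using flow_invariant_divergence[OF invariant h_smooth h_pos, of x]
    by (simp add: Lie_nth[OF torus_C1_u])
  have p: "Lie W u x $ i = W x $ 1 * Lie (\<lambda>_. axis 1 1) u x $ i + W x $ 2 * Lie (\<lambda>_. axis 2 1) u x $ i" for W i
    using Lie_partials[OF cu, of W i x] by (simp add: Lie_nth[OF torus_C1_u])
  \<comment> \<open>The expansion of the determinant of \<open>u\<close> and the bracket; the off-diagonal partial derivatives cancel.\<close>
  have alg: "hh * (a1 * (d2 - (w1 * p12 + w2 * p22)) - a2 * (d1 - (w1 * p11 + w2 * p21))) = 0"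
    if "hh * ((a1 * d2 + (a1 * p11 + a2 * p21) * w2) - (a2 * d1 + (a1 * p12 + a2 * p22) * w1)) + lh * (a1 * w2 + (-1) * (a2 * w1)) = 0"
      "lh + hh * (p11 + p22) = 0"
    for hh a1 a2 w1 w2 d1 d2 p11 p12 p21 p22 lh :: real
    using that by algebra
  have "h x * det2 (u x) (bracket x) = 0"
    unfolding det2_def bracket_def vector_minus_component p[of w]
    by (rule alg[OF d1[unfolded d2 p[of u]] div])
  note z = this
  have "bracket x = (h x * det2 (bracket x) (w x)) *\<^sub>R u x + (h x * det2 (u x) (bracket x)) *\<^sub>R w x"
    by (rule frame_expansion)
  also have "\<dots> = g x *\<^sub>R u x"
    by (simp only: z g_def scaleR_zero_left add_0_right)
  finally show ?thesis by (simp only: bracket_def)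
qed

lemma g_smooth: "torus_smooth g"
proof -
  have "torus_smooth (\<lambda>x. bracket x $ i)" for i
    unfolding bracket_def vector_minus_component
    by (intro torus_smooth_diff torus_smooth_nth torus_smooth_Lie smooth w_smooth)
  then show ?thesis
    unfolding g_def det2_def
    by (intro torus_smooth_mult torus_smooth_diff h_smooth torus_smooth_nth[OF w_smooth])
qed

definition shear :: "real \<Rightarrow> torus \<Rightarrow> real" where
  "shear t x = antiderivative (\<lambda>s. - g (flow u s x)) t"

text \<open>The candidate for the derivative of the flow: expand \<open>z\<close> in the frame \<open>u, w\<close> at the starting point and
  transport the frame.  No variational equation has to be solved, since the transported frame is known up to
  one integral.\<close>

definition flow_diff :: "real \<Rightarrow> real^2 \<Rightarrow> real^2 \<Rightarrow> real^2" where
  "flow_diff t y z = (let x = torus_proj y; x' = flow u t x in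
     (h x * det2 z (w x)) *\<^sub>R u x' + (h x * det2 (u x) z) *\<^sub>R (w x' + shear t x *\<^sub>R u x'))"

lemma continuous_g_flow: "continuous_on UNIV (\<lambda>s. - g (flow u s x))"
  by (intro continuous_on_minus continuous_on_compose2[OF torus_smooth_continuous[OF g_smooth] continuous_flow_time]) auto

lemma shear_0 [simp]: "shear 0 x = 0"
  by (simp add: shear_def)

lemma shear_has_derivative: "((\<lambda>t. shear t x) has_vector_derivative - g (flow u t x)) (at t)"
  unfolding shear_def by (rule has_vector_derivative_antiderivative[OF continuous_g_flow])

lemma flow_diff_0: "flow_diff 0 y z = z"
  by (simp add: flow_diff_def Let_def flip: frame_expansion)

text \<open>The candidate solves the variational equation: the derivative of \<open>shear\<close> compensates the bracket of \<open>u\<close>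
  and \<open>w\<close>.\<close>

lemma flow_diff_has_derivative:
  "((\<lambda>t. flow_diff t y z) has_vector_derivative
    frechet_derivative U (at (F t y)) (flow_diff t y z)) (at t)"
proof -
  define x where "x = torus_proj y"
  let ?x = "\<lambda>t. flow u t x"
  let ?D = "frechet_derivative U (at (F t y))"
  have lin: "linear ?D" by (rule linear_Lie[OF torus_C1_u])
  have D: "?D (Z (?x t)) = Lie Z u (?x t)" for Z
    using Lie_proj[OF torus_C1_u, of Z "F t y"] by (simp add: x_def flow_proj)
  have br: "Lie u w (?x t) = Lie w u (?x t) + g (?x t) *\<^sub>R u (?x t)"
    using bracket_eq[of "?x t"] by (simp add: algebra_simps)
  have "((\<lambda>t. (a *\<^sub>R u (?x t) + b *\<^sub>R (w (?x t) + shear t x *\<^sub>R u (?x t)))) has_vector_derivative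
     (a *\<^sub>R Lie u u (?x t) + b *\<^sub>R (Lie u w (?x t) + (shear t x *\<^sub>R Lie u u (?x t) + (- g (?x t)) *\<^sub>R u (?x t)))))
     (at t)" for a b
    by (intro has_vector_derivative_add 
        bounded_linear.has_vector_derivative[OF bounded_linear_scaleR_right]
        bounded_bilinear.has_vector_derivative[OF bounded_bilinear_scaleR]
        flow_has_derivative torus_C1_u torus_C1_w shear_has_derivative)
  moreover have "(a *\<^sub>R Lie u u (?x t) + b *\<^sub>R (Lie u w (?x t) + (shear t x *\<^sub>R Lie u u (?x t) + (- g (?x t)) *\<^sub>R u (?x t))))
     = ?D (a *\<^sub>R u (?x t) + b *\<^sub>R (w (?x t) + shear t x *\<^sub>R u (?x t)))" for a b
    by (simp add: linear_add[OF lin] linear_scale[OF lin] D br algebra_simps)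
  ultimately show ?thesis
    by (simp add: flow_diff_def Let_def x_def)
qed

lemma linear_flow_diff: "linear (flow_diff t y)"
  by (rule linearI) (simp_all add: flow_diff_def Let_def det2_def vec_eq_iff algebra_simps)

text \<open>The error of the linear approximation satisfies the variational equation up to a term quadratic in the
  increment, by the Taylor bound; the Gronwall estimate keeps it quadratic.\<close>

lemma flow_lift_has_derivative:
  assumes "0 \<le> t"
  shows "((\<lambda>y. F t y) has_derivative flow_diff t y) (at y)"
proof -
  obtain K where K: "K > 0" "\<And>x y. norm (U y - U x - frechet_derivative U (at x) (y - x)) \<le> K * (norm (y - x))\<^sup>2"
    using periodic_taylor[OF periodic_lift torus_smooth_C_k[OF smooth]] by metis
  obtain L where L: "L > 0" "\<And>y v. norm (frechet_derivative U (at y) v) \<le> L * norm v"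
    using lipschitz_field by metis
  obtain M where M: "M > 0" "\<And>t x y. norm (F t x - F t y) \<le> exp (M * \<bar>t\<bar>) * norm (x - y)"
    using flow_lift_dist by metis
  define c where "c = K * (exp (M * t))\<^sup>2"
  have c: "c \<ge> 0" using K by (simp add: c_def)
  define C where "C = c * sqrt (t * exp ((2 * L + 1) * t))"
  have bound: "norm (F t (y + z) - F t y - flow_diff t y z) \<le> C * (norm z)\<^sup>2" for z
  proof -
    let ?r = "\<lambda>s. F s (y + z) - F s y - flow_diff s y z"
    let ?D = "\<lambda>s. frechet_derivative U (at (F s y))"
    have "(norm (?r t))\<^sup>2 \<le> ((norm (?r 0))\<^sup>2 + (c * (norm z)\<^sup>2)\<^sup>2 * t) * exp ((2 * L + 1) * t)"
    proof (rule gronwall_square[where z' = "\<lambda>s. U (F s (y + z)) - U (F s y) - ?D s (flow_diff s y z)"])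
      show "(?r has_vector_derivative U (F s (y + z)) - U (F s y) - ?D s (flow_diff s y z)) (at s)" for s
        by (intro has_vector_derivative_diff has_vector_derivative_flow_lift flow_diff_has_derivative)
      fix s assume s: "0 \<le> s" "s \<le> t"
      let ?d = "F s (y + z) - F s y"
      have split: "U (F s (y + z)) - U (F s y) - ?D s (flow_diff s y z) =
          (U (F s (y + z)) - U (F s y) - ?D s ?d) + ?D s (?r s)"
        by (simp add: linear_diff[OF linear_Lie[OF torus_C1_u]])
      have 1: "norm (U (F s (y + z)) - U (F s y) - ?D s (flow_diff s y z)) \<le>
          K * (norm ?d)\<^sup>2 + L * norm (?r s)"
        unfolding split
        by (rule norm_triangle_mono[OF K(2)[of "F s (y + z)" "F s y"] L(2)])
      have 2: "K * (norm ?d)\<^sup>2 \<le> c * (norm z)\<^sup>2"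
      proof -
        have "norm ?d \<le> exp (M * \<bar>s\<bar>) * norm z" using M(2)[of s "y + z" y] by simp
        also have "\<dots> \<le> exp (M * t) * norm z" using s M by (intro mult_right_mono) auto
        finally have "(norm ?d)\<^sup>2 \<le> (exp (M * t) * norm z)\<^sup>2" by (intro power_mono) auto
        then show ?thesis using K(1) by (simp add: c_def power_mult_distrib)
      qed
      show "norm (U (F s (y + z)) - U (F s y) - ?D s (flow_diff s y z)) \<le> L * norm (?r s) + c * (norm z)\<^sup>2"
        using 1 2 by linarith
    qed (use assms L c in auto)
    also have "\<dots> = (C * (norm z)\<^sup>2)\<^sup>2"
      using assms by (simp add: flow_lift flow_diff_0 C_def power_mult_distrib algebra_simps)
    finally show ?thesis
      by (rule power2_le_imp_le) (use c assms in \<open>auto simp: C_def\<close>)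
  qed
  show ?thesis
    unfolding has_derivative_at
  proof
    show "bounded_linear (flow_diff t y)"
      using linear_flow_diff linear_conv_bounded_linear by blast
    show "(\<lambda>z. norm (F t (y + z) - F t y - flow_diff t y z) / norm z) \<midarrow>0\<rightarrow> 0"
    proof (rule Lim_null_comparison)
      have "norm (norm (F t (y + z) - F t y - flow_diff t y z) / norm z) \<le> C * norm z" for z
        using bound[of z] by (cases "z = 0") (auto simp: divide_simps power2_eq_square mult_ac)
      then show "\<forall>\<^sub>F z in at 0. norm (norm (F t (y + z) - F t y - flow_diff t y z) / norm z) \<le> C * norm z"
        by (intro always_eventually allI)
      show "((\<lambda>z::real^2. C * norm z) \<longlongrightarrow> 0) (at 0)"
        by (intro tendsto_mult_right_zero tendsto_norm_zero tendsto_ident_at)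
    qed
  qed
qed

end

section \<open>Exponential averages along a flow\<close>

definition exp_law :: "real \<Rightarrow> real measure" where
  "exp_law r = density lborel (\<lambda>s. ennreal (exponential_density r s))"

lemma sets_exp_law [simp, measurable_cong]: "sets (exp_law r) = sets borel"
  by (simp add: exp_law_def)

lemma space_exp_law [simp]: "space (exp_law r) = UNIV"
  by (simp add: exp_law_def)

lemma prob_space_exp_law: "r > 0 \<Longrightarrow> prob_space (exp_law r)"
  unfolding exp_law_def by (rule prob_space_exponential_density)

lemma AE_exp_law_nonneg: "r > 0 \<Longrightarrow> AE t in exp_law r. 0 \<le> t"
  unfolding exp_law_def by (subst AE_density) (auto simp: exponential_density_def)

lemma integrable_exp_law_abs:
  assumes "r > 0" shows "integrable (exp_law r) (\<lambda>t. \<bar>t\<bar>)"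
proof -
  have "integrable lborel (\<lambda>t. exponential_density r t *\<^sub>R \<bar>t\<bar>)"
  proof (rule integrableI_bounded)
    have "(\<integral>\<^sup>+ t. ennreal (norm (exponential_density r t *\<^sub>R \<bar>t\<bar>)) \<partial>lborel) =
        (\<integral>\<^sup>+ t. ennreal (exponential_density r t * t ^ 1) \<partial>lborel)"
      using assms by (intro nn_integral_cong) (auto simp: exponential_density_def abs_mult)
    also have "\<dots> < \<infinity>"
      unfolding nn_integral_erlang_ith_moment[OF assms] by simp
    finally show "(\<integral>\<^sup>+ t. ennreal (norm (exponential_density r t *\<^sub>R \<bar>t\<bar>)) \<partial>lborel) < \<infinity>" .
  qed simp
  then show ?thesis
    unfolding exp_law_def using assms exponential_density_nonneg
    by (subst integrable_density) auto
qed

lemma integrable_exp_law_linear: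
  assumes "r > 0" shows "integrable (exp_law r) (\<lambda>t. C * (1 + \<bar>t\<bar>))"
proof -
  interpret prob_space "exp_law r" by (rule prob_space_exp_law[OF assms])
  show ?thesis using integrable_exp_law_abs[OF assms] by simp
qed

lemma integrable_exp_law:
  fixes f :: "real \<Rightarrow> 'b::{banach, second_countable_topology}"
  assumes "r > 0" "f \<in> borel_measurable borel" "\<And>t. norm (f t) \<le> C * (1 + \<bar>t\<bar>)"
  shows "integrable (exp_law r) f"
  by (rule Bochner_Integration.integrable_bound[OF integrable_exp_law_linear[OF assms(1), of C]])
    (use assms(2) order_trans[OF assms(3) abs_ge_self] in \<open>auto simp del: abs_mult\<close>)

text \<open>Integration by parts against \<open>r exp (- r t) dt\<close>.  Linear growth is allowed, since the derivative of the flow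
  grows linearly.\<close>

lemma exp_law_parts:
  fixes A A' :: "real \<Rightarrow> real"
  assumes r: "r > 0" and A: "\<And>t. (A has_real_derivative A' t) (at t)"
    and cont: "continuous_on UNIV A'"
    and bound: "\<And>t. \<bar>A t\<bar> \<le> C * (1 + \<bar>t\<bar>)" "\<And>t. \<bar>A' t\<bar> \<le> C * (1 + \<bar>t\<bar>)"
  shows "(\<integral>t. A t - A' t / r \<partial>exp_law r) = A 0"
proof -
  have contA: "continuous_on UNIV A"
    using A DERIV_isCont by (intro continuous_at_imp_continuous_on) blast
  have [measurable]: "A \<in> borel_measurable borel" "A' \<in> borel_measurable borel"
    using contA cont by (auto intro: borel_measurable_continuous_onI)
  define f where "f t = r * exp (- t * r) * (A t - A' t / r)" for t
  define G where "G t = - (exp (- t * r) * A t)" for t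
  have G: "DERIV G t :> f t" for t
    unfolding G_def f_def using r
    by (auto intro!: derivative_eq_intros A simp: field_simps)
  have contf: "continuous_on UNIV f"
    unfolding f_def by (intro continuous_intros contA cont) (use r in auto)
  have "integrable (exp_law r) (\<lambda>t. A t - A' t / r)"
  proof (rule Bochner_Integration.integrable_diff)
    show "integrable (exp_law r) A" by (rule integrable_exp_law[OF r, of _ C]) (use bound in auto)
    have "integrable (exp_law r) A'" by (rule integrable_exp_law[OF r, of _ C]) (use bound in auto)
    then show "integrable (exp_law r) (\<lambda>t. A' t / r)" by simp
  qed
  then have int: "integrable lborel (\<lambda>t. exponential_density r t * (A t - A' t / r))"
    unfolding exp_law_def using r exponential_density_nonneg by (subst (asm) integrable_density) auto
  have fA: "exponential_density r t * (A t - A' t / r) = indicator {0..} t * f t" for t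
    by (auto simp: exponential_density_def f_def)
  have lim1: "(\<lambda>n. \<integral>t. f t * indicator {0..real n} t \<partial>lborel) \<longlonglongrightarrow> (\<integral>t. indicator {0..} t * f t \<partial>lborel)"
  proof (rule integral_dominated_convergence[where w = "\<lambda>t. norm (indicator {0..} t * f t)"])
    have [measurable]: "f \<in> borel_measurable borel" by (rule borel_measurable_continuous_onI[OF contf])
    show "(\<lambda>t. f t * indicator {0..real n} t) \<in> borel_measurable lborel" for n by measurable
    show "(\<lambda>t. indicator {0..} t * f t) \<in> borel_measurable lborel" by measurable
    show "integrable lborel (\<lambda>t. norm (indicator {0..} t * f t))"
      using int unfolding fA by (rule integrable_norm)
    show "AE t in lborel. norm (f t * indicator {0..real n} t) \<le> norm (indicator {0..} t * f t)" for n
      by (auto simp: indicator_def)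
    show "AE t in lborel. (\<lambda>n. f t * indicator {0..real n} t) \<longlonglongrightarrow> indicator {0..} t * f t"
    proof (rule always_eventually, rule allI)
      fix t
      obtain n0 where n0: "t \<le> real n0" using real_arch_simple by blast
      have "\<forall>\<^sub>F n in sequentially. indicator {0..} t * f t = f t * indicator {0..real n} t"
        using eventually_ge_at_top[of n0]
      proof eventually_elim
        case (elim n)
        then have "t \<le> real n" using n0 of_nat_mono by (metis order_trans)
        then show ?case by (auto simp: indicator_def)
      qed
      then show "(\<lambda>n. f t * indicator {0..real n} t) \<longlonglongrightarrow> indicator {0..} t * f t"
        by (rule Lim_transform_eventually[OF tendsto_const])
    qed
  qed
  have "(\<integral>t. f t * indicator {0..real n} t \<partial>lborel) = G (real n) - G 0" for n
    using contf by (intro integral_FTC_Icc_real G) (auto simp: continuous_on_eq_continuous_at)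
  then have lim2: "(\<lambda>n. G (real n) - G 0) \<longlonglongrightarrow> (\<integral>t. indicator {0..} t * f t \<partial>lborel)"
    using lim1 by simp
  \<comment> \<open>The boundary term at infinity vanishes, since \<open>A\<close> grows at most linearly.\<close>
  have lim3: "(\<lambda>n. G (real n)) \<longlonglongrightarrow> 0"
  proof (rule Lim_null_comparison)
    show "\<forall>\<^sub>F n in sequentially. norm (G (real n)) \<le>
        C * ((real n * r) ^ 0 / exp (real n * r) + (1 / r) * ((real n * r) ^ 1 / exp (real n * r)))"
    proof (rule always_eventually, rule allI)
      fix n
      have "norm (G (real n)) = exp (- (real n * r)) * \<bar>A (real n)\<bar>"
        by (simp add: G_def abs_mult)
      also have "\<dots> \<le> exp (- (real n * r)) * (C * (1 + real n))"
        using bound(1)[of "real n"] by (intro mult_left_mono) auto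
      also have "\<dots> = C * ((real n * r) ^ 0 / exp (real n * r) + (1 / r) * ((real n * r) ^ 1 / exp (real n * r)))"
        using r by (simp add: exp_minus field_simps)
      finally show "norm (G (real n)) \<le> C * ((real n * r) ^ 0 / exp (real n * r) + (1 / r) * ((real n * r) ^ 1 / exp (real n * r)))" .
    qed
    have x: "filterlim (\<lambda>n. real n * r) at_top sequentially"
      using r by (intro filterlim_at_top_mult_tendsto_pos[OF tendsto_const _ filterlim_real_sequentially]) auto
    have "(\<lambda>n. C * ((real n * r) ^ 0 / exp (real n * r) + (1 / r) * ((real n * r) ^ 1 / exp (real n * r))))
        \<longlonglongrightarrow> C * (0 + (1 / r) * 0)"
      by (intro tendsto_intros filterlim_compose[OF tendsto_power_div_exp_0 x])
    then show "(\<lambda>n. C * ((real n * r) ^ 0 / exp (real n * r) + (1 / r) * ((real n * r) ^ 1 / exp (real n * r))))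
        \<longlonglongrightarrow> 0" by simp
  qed
  have "(\<integral>t. indicator {0..} t * f t \<partial>lborel) = 0 - G 0"
    by (rule LIMSEQ_unique[OF lim2 tendsto_diff[OF lim3 tendsto_const]])
  moreover have "(\<integral>t. A t - A' t / r \<partial>exp_law r) = (\<integral>t. indicator {0..} t * f t \<partial>lborel)"
    unfolding exp_law_def using r exponential_density_nonneg
    by (subst integral_density) (auto simp: fA)
  ultimately show ?thesis by (simp add: G_def)
qed

lemma continuous_on_integral_dominated:
  fixes f :: "'a::metric_space \<Rightarrow> 'c \<Rightarrow> real"
  assumes "\<And>t. continuous_on UNIV (\<lambda>x. f x t)" "\<And>x. f x \<in> borel_measurable M"
    and "\<And>x t. \<bar>f x t\<bar> \<le> b t" "integrable M b"
  shows "continuous_on UNIV (\<lambda>x. \<integral>t. f x t \<partial>M)"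
  unfolding continuous_on_sequentially
proof (intro allI ballI impI, elim conjE)
  fix X :: "nat \<Rightarrow> 'a" and a assume X: "X \<longlonglongrightarrow> a"
  have "(\<lambda>n. \<integral>t. f (X n) t \<partial>M) \<longlonglongrightarrow> (\<integral>t. f a t \<partial>M)"
  proof (rule integral_dominated_convergence[where w = b])
    show "AE t in M. (\<lambda>n. f (X n) t) \<longlonglongrightarrow> f a t"
      using continuous_on_tendsto_compose[OF assms(1) X] by simp
  qed (use assms in auto)
  then show "((\<lambda>x. \<integral>t. f x t \<partial>M) \<circ> X) \<longlonglongrightarrow> (\<integral>t. f a t \<partial>M)" by (simp add: o_def)
qed

text \<open>The set \<open>T\<close> only has to carry the measure: the derivative of the flow is available for nonnegative times,
  where the exponential law lives.\<close>

lemma has_derivative_integral: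
  fixes f :: "'a::euclidean_space \<Rightarrow> 'c \<Rightarrow> real"
  assumes T: "AE t in M. t \<in> T"
    and der: "\<And>x t. t \<in> T \<Longrightarrow> ((\<lambda>x. f x t) has_derivative D x t) (at x)"
    and bound: "\<And>x t z. t \<in> T \<Longrightarrow> \<bar>D x t z\<bar> \<le> b t * norm z" and b: "integrable M b"
    and f: "\<And>x. integrable M (f x)" and D: "\<And>x z. (\<lambda>t. D x t z) \<in> borel_measurable M"
  shows "((\<lambda>x. \<integral>t. f x t \<partial>M) has_derivative (\<lambda>z. \<integral>t. D x t z \<partial>M)) (at x)"
proof -
  have Dint: "integrable M (\<lambda>t. D x t z)" for x z
  proof (rule Bochner_Integration.integrable_bound)
    show "integrable M (\<lambda>t. b t * norm z)" using b by simp
    show "AE t in M. norm (D x t z) \<le> norm (b t * norm z)"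
      using T
    proof eventually_elim
      case (elim t)
      then show ?case using order_trans[OF bound[OF elim, of x z] abs_ge_self] by simp
    qed
  qed (rule D)
  have lip: "\<bar>f y t - f x t\<bar> \<le> b t * norm (y - x)" if t: "t \<in> T" for x y t
  proof -
    have "norm (f y t - f x t) \<le> b t * norm (y - x)"
    proof (rule differentiable_bound[of UNIV "\<lambda>x. f x t" "\<lambda>x. D x t"])
      show "onorm (D z t) \<le> b t" for z
        by (rule onorm_le) (use bound[OF t] in simp)
    qed (use der[OF t] in auto)
    then show ?thesis by simp
  qed
  show ?thesis
    unfolding has_derivative_at
  proof
    show "bounded_linear (\<lambda>z. \<integral>t. D x t z \<partial>M)"
    proof (rule bounded_linear_intro[where K = "\<integral>t. b t \<partial>M"])
      show "(\<integral>t. D x t (y + z) \<partial>M) = (\<integral>t. D x t y \<partial>M) + (\<integral>t. D x t z \<partial>M)" for y z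
      proof -
        have "(\<integral>t. D x t (y + z) \<partial>M) = (\<integral>t. D x t y + D x t z \<partial>M)"
          by (rule integral_cong_AE)
            (use T D in \<open>auto elim!: eventually_mono intro!: linear_add has_derivative_linear[OF der]\<close>)
        then show ?thesis using Dint by simp
      qed
      show "(\<integral>t. D x t (c *\<^sub>R z) \<partial>M) = c *\<^sub>R (\<integral>t. D x t z \<partial>M)" for c z
      proof -
        have "(\<integral>t. D x t (c *\<^sub>R z) \<partial>M) = (\<integral>t. c *\<^sub>R D x t z \<partial>M)"
        proof (rule integral_cong_AE)
          show "AE t in M. D x t (c *\<^sub>R z) = c *\<^sub>R D x t z"
            using T
          proof eventually_elim
            case (elim t)
            then show ?case by (rule linear_scale[OF has_derivative_linear[OF der]])
          qed
        qed (use D in auto)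
        then show ?thesis by simp
      qed
      show "norm (\<integral>t. D x t z \<partial>M) \<le> norm z * (\<integral>t. b t \<partial>M)" for z
      proof -
        have "norm (\<integral>t. D x t z \<partial>M) \<le> (\<integral>t. norm (D x t z) \<partial>M)"
          by (rule integral_norm_bound)
        also have "\<dots> \<le> (\<integral>t. b t * norm z \<partial>M)"
        proof (rule integral_mono_AE)
          show "AE t in M. norm (D x t z) \<le> b t * norm z"
            using T by eventually_elim (simp add: bound)
        qed (use b Dint in auto)
        finally have "norm (\<integral>t. D x t z \<partial>M) \<le> (\<integral>t. b t * norm z \<partial>M)" .
        then show ?thesis by (simp add: mult.commute)
      qed
    qed
    show "(\<lambda>h. norm ((\<integral>t. f (x + h) t \<partial>M) - (\<integral>t. f x t \<partial>M) - (\<integral>t. D x t h \<partial>M)) / norm h) \<midarrow>0\<rightarrow> 0"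
      unfolding tendsto_at_iff_sequentially
    proof (intro allI impI)
      fix X :: "nat \<Rightarrow> 'a" assume X: "\<forall>i. X i \<in> UNIV - {0}" "X \<longlonglongrightarrow> 0"
      define q where "q n t = (f (x + X n) t - f x t - D x t (X n)) / norm (X n)" for n t
      have "(\<lambda>n. \<integral>t. q n t \<partial>M) \<longlonglongrightarrow> (\<integral>t. 0 \<partial>M)"
      proof (rule integral_dominated_convergence[where w = "\<lambda>t. 2 * b t"])
        show "AE t in M. (\<lambda>n. q n t) \<longlonglongrightarrow> 0"
          using T
        proof eventually_elim
          case (elim t)
          have "(\<lambda>h. norm (f (x + h) t - f x t - D x t h) / norm h) \<midarrow>0\<rightarrow> 0"
            using der[OF elim, of x] by (simp add: has_derivative_at)
          then have "(\<lambda>n. norm (f (x + X n) t - f x t - D x t (X n)) / norm (X n)) \<longlonglongrightarrow> 0"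
            using X by (auto simp: tendsto_at_iff_sequentially o_def)
          then show ?case
            by (subst tendsto_norm_zero_iff[symmetric]) (simp add: q_def)
        qed
        show "AE t in M. norm (q n t) \<le> 2 * b t" for n
          using T
        proof eventually_elim
          case (elim t)
          have "\<bar>f (x + X n) t - f x t - D x t (X n)\<bar> \<le> 2 * b t * norm (X n)"
            using lip[OF elim, of "x + X n" x] bound[OF elim, of x "X n"] by simp
          then show ?case using X(1) by (simp add: q_def field_simps)
        qed
        show "(\<lambda>t. q n t) \<in> borel_measurable M" for n
          unfolding q_def using f D by (auto intro!: borel_measurable_diff borel_measurable_divide)
      qed (use b in auto)
      moreover have "(\<integral>t. q n t \<partial>M) = ((\<integral>t. f (x + X n) t \<partial>M) - (\<integral>t. f x t \<partial>M) - (\<integral>t. D x t (X n) \<partial>M)) / norm (X n)" for n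
        unfolding q_def using f Dint by simp
      ultimately have "(\<lambda>n. ((\<integral>t. f (x + X n) t \<partial>M) - (\<integral>t. f x t \<partial>M) - (\<integral>t. D x t (X n) \<partial>M)) / norm (X n)) \<longlonglongrightarrow> 0"
        by simp
      from tendsto_norm[OF this]
      show "((\<lambda>h. norm ((\<integral>t. f (x + h) t \<partial>M) - (\<integral>t. f x t \<partial>M) - (\<integral>t. D x t h \<partial>M)) / norm h) \<circ> X) \<longlonglongrightarrow> 0"
        by (simp add: o_def)
    qed
  qed
qed

locale switching_pair = transversal_pair +
  fixes r :: real
  assumes r: "r > 0"
begin

text \<open>Up to the factor \<open>r\<close> this is the resolvent of the generator: \<open>average \<phi> = r (r - u)\<^sup>-\<^sup>1 \<phi>\<close>, where \<open>u\<close> acts as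
  a derivation.  Its adjoint for the invariant measure \<open>h dx\<close> is \<open>push\<close> below.\<close>

definition average :: "(torus \<Rightarrow> real) \<Rightarrow> torus \<Rightarrow> real" where
  "average \<phi> x = (\<integral>t. \<phi> (flow u t x) \<partial>exp_law r)"

definition push :: "(torus \<Rightarrow> real) \<Rightarrow> torus \<Rightarrow> real" where
  "push p x = (\<integral>t. p (flow u (- t) x) \<partial>exp_law r)"

lemma continuous_along_flow:
  "continuous_on UNIV \<phi> \<Longrightarrow> continuous_on A (\<lambda>t. \<phi> (flow u t x))"
  by (rule continuous_on_compose2[OF _ continuous_flow_time]) auto

lemma continuous_after_flow:
  "continuous_on UNIV \<phi> \<Longrightarrow> continuous_on UNIV (\<lambda>x. \<phi> (flow u t x))"
  by (rule continuous_on_compose2[OF _ continuous_flow]) auto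

lemma measurable_along_flow:
  assumes "continuous_on UNIV \<phi>" shows "(\<lambda>t. \<phi> (flow u t x)) \<in> borel_measurable borel"
  by (rule borel_measurable_continuous_onI[OF continuous_along_flow[OF assms]])

lemma integrable_along_flow:
  fixes \<phi> :: "torus \<Rightarrow> real"
  assumes "continuous_on UNIV \<phi>"
  shows "integrable (exp_law r) (\<lambda>t. \<phi> (flow u t x))"
proof -
  obtain B where B: "B > 0" "\<And>x. norm (\<phi> x) \<le> B" using bounded_continuous_torus[OF assms] by metis
  have "norm (\<phi> (flow u t x)) \<le> B * (1 + \<bar>t\<bar>)" for t
  proof -
    have "B * 1 \<le> B * (1 + \<bar>t\<bar>)" using B(1) by (intro mult_left_mono) auto
    then show ?thesis using order_trans[OF B(2)[of "flow u t x"]] by simp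
  qed
  then show ?thesis
    using measurable_along_flow[OF assms] by (intro integrable_exp_law[OF r, of _ B]) auto
qed

lemma continuous_average:
  assumes "continuous_on UNIV \<phi>" shows "continuous_on UNIV (average \<phi>)"
proof -
  obtain B where B: "B > 0" "\<And>x. norm (\<phi> x) \<le> B" using bounded_continuous_torus[OF assms] by metis
  interpret N: prob_space "exp_law r" by (rule prob_space_exp_law[OF r])
  show ?thesis
    unfolding continuous_on_torus_iff average_def
  proof (rule continuous_on_integral_dominated[where b = "\<lambda>_. B"])
    show "continuous_on UNIV (\<lambda>y. \<phi> (flow u t (torus_proj y)))" for t
      using continuous_after_flow[OF assms, of t] by (simp add: continuous_on_torus_iff)
  qed (use B measurable_along_flow[OF assms] in auto)
qed

text \<open>Integration by parts in time, applied to \<open>\<phi>\<close> along one orbit.\<close>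

lemma average_generator:
  assumes "torus_C1 \<phi>"
  shows "average (Lie u \<phi>) x = r * (average \<phi> x - \<phi> x)"
proof -
  have cont: "continuous_on UNIV \<phi>" "continuous_on UNIV (Lie u \<phi>)"
    using assms by (auto intro: torus_C1_continuous continuous_Lie continuous_u)
  obtain B where B: "\<And>x. norm (\<phi> x) \<le> B" using bounded_continuous_torus[OF cont(1)] by metis
  obtain B' where B': "\<And>x. norm (Lie u \<phi> x) \<le> B'" using bounded_continuous_torus[OF cont(2)] by metis
  have B0: "0 \<le> max B B'" using order_trans[OF norm_ge_zero B] by (simp add: le_max_iff_disj)
  have le: "y \<le> max B B' * (1 + \<bar>t\<bar>)" if "y \<le> B \<or> y \<le> B'" for y t
  proof -
    have "y \<le> max B B' * 1" using that by auto
    also have "\<dots> \<le> max B B' * (1 + \<bar>t\<bar>)" using B0 by (intro mult_left_mono) auto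
    finally show ?thesis .
  qed
  have "(\<integral>t. \<phi> (flow u t x) - Lie u \<phi> (flow u t x) / r \<partial>exp_law r) = \<phi> (flow u 0 x)"
    by (rule exp_law_parts[where C = "max B B'", OF r flow_has_real_derivative[OF assms] continuous_along_flow[OF cont(2)]])
      (use B B' in \<open>auto intro!: le\<close>)
  then have "average \<phi> x - average (Lie u \<phi>) x / r = \<phi> x"
    using integrable_along_flow[OF cont(1), of x] integrable_along_flow[OF cont(2), of x]
    by (simp add: average_def)
  then show ?thesis using r by (simp add: field_simps)
qed

lemma continuous_shear: "continuous_on UNIV (shear t)"
proof -
  have c: "continuous_on UNIV (\<lambda>y. integral {a..b} (\<lambda>s. - g (torus_proj (F s y))))" for a b
  proof -
    have "continuous_on (UNIV \<times> cbox a b) (\<lambda>(y, s). - g (torus_proj (F s y)))"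
      unfolding split_beta
      by (intro continuous_on_minus continuous_on_compose2[OF torus_smooth_continuous[OF g_smooth]]
          continuous_on_compose2[OF continuous_on_proj[of UNIV]] continuous_flow_lift_compose continuous_intros) auto
    from integral_continuous_on_param[OF this] show ?thesis by simp
  qed
  show ?thesis
    unfolding continuous_on_torus_iff shear_def antiderivative_def flow_proj
    by (intro continuous_on_diff c)
qed

text \<open>This linear bound replaces the exponential growth that a general flow would have; it makes the
  exponential averages differentiable for every rate \<open>r\<close>.\<close>

lemma shear_bound:
  obtains G where "G > 0" "\<And>t x. \<bar>shear t x\<bar> \<le> G * \<bar>t\<bar>"
proof -
  obtain G where G: "G > 0" "\<And>x. norm (g x) \<le> G"
    using bounded_continuous_torus[OF torus_smooth_continuous[OF g_smooth]] by metis
  have "\<bar>shear t x\<bar> \<le> G * \<bar>t\<bar>" for t x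
  proof -
    have "norm (shear t x - shear 0 x) \<le> G * norm (t - 0)"
      by (rule field_differentiable_bound[of UNIV "\<lambda>t. shear t x" "\<lambda>t. - g (flow u t x)"])
        (use G(2) shear_has_derivative in \<open>auto simp: has_real_derivative_iff_has_vector_derivative\<close>)
    then show ?thesis by simp
  qed
  then show ?thesis using that G(1) by blast
qed

lemma det2_bound: "\<bar>det2 a b\<bar> \<le> 2 * (norm a * norm b)"
proof -
  have "\<bar>a $ i * b $ j\<bar> \<le> norm a * norm b" for i j
    unfolding abs_mult by (intro mult_mono component_le_norm_cart) auto
  from this[of 1 2] this[of 2 1] show ?thesis by (simp add: det2_def)
qed

lemma flow_diff_bound:
  obtains C where "C > 0" "\<And>t y z. norm (flow_diff t y z) \<le> C * (1 + \<bar>t\<bar>) * norm z"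
proof -
  obtain G where G: "G > 0" "\<And>t x. \<bar>shear t x\<bar> \<le> G * \<bar>t\<bar>" using shear_bound by metis
  obtain H where H: "H > 0" "\<And>x. norm (h x) \<le> H"
    using bounded_continuous_torus[OF torus_smooth_continuous[OF h_smooth]] by metis
  obtain B1 where B1: "B1 > 0" "\<And>x. norm (u x) \<le> B1"
    using bounded_continuous_torus[OF continuous_u] by metis
  obtain B2 where B2: "B2 > 0" "\<And>x. norm (w x) \<le> B2"
    using bounded_continuous_torus[OF torus_smooth_continuous[OF w_smooth]] by metis
  define E where "E = 2 * H * (B1 + B2)"
  have E: "E > 0" using H B1 B2 by (simp add: E_def)
  have coef: "\<bar>h x * det2 z (w x)\<bar> \<le> E * norm z" "\<bar>h x * det2 (u x) z\<bar> \<le> E * norm z" for x z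
  proof -
    have "\<bar>h x * det2 z (w x)\<bar> \<le> H * (2 * (norm z * (B1 + B2)))"
      unfolding abs_mult
    proof (rule mult_mono)
      have "\<bar>det2 z (w x)\<bar> \<le> 2 * (norm z * norm (w x))" by (rule det2_bound)
      also have "\<dots> \<le> 2 * (norm z * (B1 + B2))"
        using B2(2)[of x] B1(1) by (intro mult_left_mono) auto
      finally show "\<bar>det2 z (w x)\<bar> \<le> 2 * (norm z * (B1 + B2))" .
    qed (use H in auto)
    then show "\<bar>h x * det2 z (w x)\<bar> \<le> E * norm z" by (simp add: E_def mult_ac)
    have "\<bar>h x * det2 (u x) z\<bar> \<le> H * (2 * ((B1 + B2) * norm z))"
      unfolding abs_mult
    proof (rule mult_mono)
      have "\<bar>det2 (u x) z\<bar> \<le> 2 * (norm (u x) * norm z)" by (rule det2_bound)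
      also have "\<dots> \<le> 2 * ((B1 + B2) * norm z)"
        using B1(2)[of x] B2(1) by (intro mult_left_mono mult_right_mono) auto
      finally show "\<bar>det2 (u x) z\<bar> \<le> 2 * ((B1 + B2) * norm z)" .
    qed (use H in auto)
    then show "\<bar>h x * det2 (u x) z\<bar> \<le> E * norm z" by (simp add: E_def mult_ac)
  qed
  define C where "C = E * (B1 + B2 + G * B1)"
  have C: "C > 0" unfolding C_def using E B1 B2 G by (intro mult_pos_pos add_pos_pos)
  have "norm (flow_diff t y z) \<le> C * (1 + \<bar>t\<bar>) * norm z" for t y z
  proof -
    define x where "x = torus_proj y"
    define x' where "x' = flow u t x"
    have "norm (flow_diff t y z) \<le> norm ((h x * det2 z (w x)) *\<^sub>R u x')
        + norm ((h x * det2 (u x) z) *\<^sub>R (w x' + shear t x *\<^sub>R u x'))"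
      unfolding flow_diff_def Let_def x_def x'_def by (rule norm_triangle_ineq)
    also have "\<dots> \<le> E * norm z * B1 + E * norm z * (B2 + (G * \<bar>t\<bar>) * B1)"
    proof (rule add_mono)
      show "norm ((h x * det2 z (w x)) *\<^sub>R u x') \<le> E * norm z * B1"
        unfolding norm_scaleR using coef B1 E by (intro mult_mono) auto
      have "norm (w x' + shear t x *\<^sub>R u x') \<le> B2 + (G * \<bar>t\<bar>) * B1"
        by (rule norm_triangle_mono[OF B2(2)]) (use G B1 in \<open>auto intro!: mult_mono\<close>)
      then show "norm ((h x * det2 (u x) z) *\<^sub>R (w x' + shear t x *\<^sub>R u x')) \<le> E * norm z * (B2 + (G * \<bar>t\<bar>) * B1)"
        unfolding norm_scaleR using coef E by (intro mult_mono) auto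
    qed
    also have "\<dots> = E * norm z * (B1 + B2 + (G * B1) * \<bar>t\<bar>)"
      by (simp add: algebra_simps)
    also have "\<dots> \<le> E * norm z * ((B1 + B2 + G * B1) * (1 + \<bar>t\<bar>))"
      using B1 B2 G E by (intro mult_left_mono) (auto simp: algebra_simps)
    finally show ?thesis by (simp add: C_def mult_ac)
  qed
  then show ?thesis using that C by blast
qed

end

section \<open>Averages of differentiable functions\<close>

context switching_pair
begin

lemma
  assumes \<phi>: "torus_C1 \<phi>"
  shows torus_C1_average: "torus_C1 (average \<phi>)"
    and Lie_average: "Lie Z (average \<phi>) (torus_proj y) = (\<integral>t. frechet_derivative
      (\<lambda>y. \<phi> (torus_proj y)) (at (F t y)) (flow_diff t y (Z (torus_proj y))) \<partial>exp_law r)"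
proof -
  let ?f = "\<lambda>y t. \<phi> (torus_proj (F t y))"
  let ?D = "\<lambda>y t z. frechet_derivative (\<lambda>y. \<phi> (torus_proj y)) (at (F t y)) (flow_diff t y z)"
  have C1: "C_k (Suc 0) (\<lambda>y. \<phi> (torus_proj y))" using \<phi> by (simp add: torus_C1_def)
  obtain L where L: "L > 0" "\<And>y v. norm (frechet_derivative (\<lambda>y. \<phi> (torus_proj y)) (at y) v) \<le> L * norm v"
    using periodic_lipschitz[OF periodic_lift C1] by metis
  obtain C where C: "C > 0" "\<And>t y z. norm (flow_diff t y z) \<le> C * (1 + \<bar>t\<bar>) * norm z"
    using flow_diff_bound by metis
  have bound: "\<bar>?D y t z\<bar> \<le> L * C * (1 + \<bar>t\<bar>) * norm z" for y t z
  proof -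
    have "\<bar>?D y t z\<bar> \<le> L * norm (flow_diff t y z)"
      using L(2)[of "F t y" "flow_diff t y z"] by simp
    also have "\<dots> \<le> L * (C * (1 + \<bar>t\<bar>) * norm z)"
      using L(1) C(2) by (intro mult_left_mono) auto
    finally show ?thesis by (simp add: mult_ac)
  qed
  have contF: "continuous_on UNIV (\<lambda>t. F t y)" for y
    by (intro continuous_flow_lift_compose continuous_intros)
  have contt: "continuous_on UNIV (\<lambda>t. flow_diff t y z)" for y z
    using flow_diff_has_derivative has_vector_derivative_continuous
    by (intro continuous_at_imp_continuous_on ballI) blast
  have meas: "(\<lambda>t. ?D y t z) \<in> borel_measurable borel" for y z
    by (rule borel_measurable_continuous_onI[OF continuous_directional_derivative[OF C1 contF contt]])
  have contFy: "continuous_on UNIV (\<lambda>y. F t y)" for t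
    by (intro continuous_flow_lift_compose continuous_intros)
  have lift: "continuous_on UNIV (\<lambda>y. f (torus_proj y))" if "continuous_on UNIV f"
    for f :: "torus \<Rightarrow> 'b::topological_space"
    using that by (simp add: continuous_on_torus_iff)
  have conty: "continuous_on UNIV (\<lambda>y. flow_diff t y z)" for t z
  proof -
    have 1: "continuous_on UNIV (\<lambda>y. u (flow u t (torus_proj y)))"
      "continuous_on UNIV (\<lambda>y. w (flow u t (torus_proj y)))"
      by (intro lift continuous_on_compose2[OF continuous_u continuous_flow]
          continuous_on_compose2[OF torus_smooth_continuous[OF w_smooth] continuous_flow] subset_UNIV)+
    show ?thesis
      unfolding flow_diff_def Let_def det2_def
      by (intro continuous_on_add continuous_on_scaleR continuous_on_mult continuous_on_diff
          lift[OF torus_smooth_continuous[OF h_smooth]] lift[OF continuous_shear] 1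
          lift[OF torus_smooth_continuous[OF torus_smooth_nth[OF w_smooth]]]
          lift[OF torus_smooth_continuous[OF torus_smooth_nth[OF smooth]]] continuous_on_const)
  qed
  have b: "integrable (exp_law r) (\<lambda>t. L * C * (1 + \<bar>t\<bar>))"
    by (rule integrable_exp_law_linear[OF r])
  have der: "((\<lambda>y. \<integral>t. ?f y t \<partial>exp_law r) has_derivative (\<lambda>z. \<integral>t. ?D y t z \<partial>exp_law r)) (at y)" for y
  proof (rule has_derivative_integral[where T = "{0..}" and b = "\<lambda>t. L * C * (1 + \<bar>t\<bar>)"])
    show "AE t in exp_law r. t \<in> {0..}" using AE_exp_law_nonneg[OF r] by simp
    show "((\<lambda>y. ?f y t) has_derivative ?D y t) (at y)" if "t \<in> {0..}" for y t
      using has_derivative_compose[OF flow_lift_has_derivative torus_C1_derivative[OF \<phi>]] that by simp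
    show "integrable (exp_law r) (?f y)" for y
      using integrable_along_flow[OF torus_C1_continuous[OF \<phi>], of "torus_proj y"]
      by (simp add: flow_proj)
    show "(\<lambda>t. ?D y t z) \<in> borel_measurable (exp_law r)" for y z
      using meas by simp
    show "\<bar>?D y t z\<bar> \<le> L * C * (1 + \<bar>t\<bar>) * norm z" for y t z by (rule bound)
  qed (rule b)
  have lift_av: "(\<lambda>y. average \<phi> (torus_proj y)) = (\<lambda>y. \<integral>t. ?f y t \<partial>exp_law r)"
    by (simp add: average_def flow_proj fun_eq_iff)
  have der': "((\<lambda>y. average \<phi> (torus_proj y)) has_derivative (\<lambda>z. \<integral>t. ?D y t z \<partial>exp_law r)) (at y)" for y
    unfolding lift_av by (rule der)
  show C1av: "torus_C1 (average \<phi>)"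
    unfolding torus_C1_def
  proof (rule C_k_SucI[OF der'])
    fix z
    have "continuous_on UNIV (\<lambda>y. \<integral>t. ?D y t z \<partial>exp_law r)"
    proof (rule continuous_on_integral_dominated[where b = "\<lambda>t. L * C * (1 + \<bar>t\<bar>) * norm z"])
      show "continuous_on UNIV (\<lambda>y. ?D y t z)" for t
        by (rule continuous_directional_derivative[OF C1 contFy conty])
      show "integrable (exp_law r) (\<lambda>t. L * C * (1 + \<bar>t\<bar>) * norm z)"
        using b by simp
    qed (use bound meas in auto)
    then show "C_k 0 (\<lambda>y. \<integral>t. ?D y t z \<partial>exp_law r)" by simp
  qed
  show "Lie Z (average \<phi>) (torus_proj y) = (\<integral>t. ?D y t (Z (torus_proj y)) \<partial>exp_law r)"
    by (rule Lie_eqI[OF C1av der'])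
qed

lemma flow_diff_u: "flow_diff t y (u (torus_proj y)) = u (flow u t (torus_proj y))"
  using det2_u_w[of "torus_proj y"] h_pos[of "torus_proj y"]
  by (simp add: flow_diff_def Let_def) (simp add: det2_def)

lemma flow_diff_w:
  "flow_diff t y (w (torus_proj y)) =
    w (flow u t (torus_proj y)) + shear t (torus_proj y) *\<^sub>R u (flow u t (torus_proj y))"
  using det2_u_w[of "torus_proj y"] h_pos[of "torus_proj y"]
  by (simp add: flow_diff_def Let_def) (simp add: det2_def)

lemma Lie_u_average:
  assumes "torus_C1 \<phi>" shows "Lie u (average \<phi>) x = r * (average \<phi> x - \<phi> x)"
proof (cases x rule: torus_cases)
  case (1 y)
  have "Lie u (average \<phi>) x = average (Lie u \<phi>) x"
    unfolding 1 Lie_average[OF assms] average_def flow_diff_u flow_proj Lie_proj[OF assms] ..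
  then show ?thesis using average_generator[OF assms] by simp
qed

text \<open>Differentiating the average along \<open>w\<close> produces the shear term; integration by parts in time
  removes the derivative along the flow from it.\<close>

lemma average_Lie_w:
  assumes \<phi>: "torus_C1 \<phi>"
  shows "average (Lie w \<phi>) x = Lie w (average \<phi>) x - average (\<lambda>x. g x * (\<phi> x - average \<phi> x)) x"
proof -
  let ?\<psi> = "average \<phi>"
  have \<psi>: "torus_C1 ?\<psi>" by (rule torus_C1_average[OF \<phi>])
  have contw: "continuous_on UNIV w" by (rule torus_smooth_continuous[OF w_smooth])
  have contg: "continuous_on UNIV g" by (rule torus_smooth_continuous[OF g_smooth])
  have cont: "continuous_on UNIV \<phi>" "continuous_on UNIV ?\<psi>" "continuous_on UNIV (Lie u \<phi>)"
    "continuous_on UNIV (Lie w \<phi>)" "continuous_on UNIV (Lie u ?\<psi>)"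
    by (simp_all add: torus_C1_continuous[OF \<phi>] torus_C1_continuous[OF \<psi>] continuous_Lie[OF \<phi>]
        continuous_Lie[OF \<psi>] continuous_u contw)
  let ?G = "\<lambda>x. g x * (\<phi> x - ?\<psi> x)"
  have contG: "continuous_on UNIV ?G" by (intro continuous_intros cont contg)
  let ?a = "\<lambda>t. \<phi> (flow u t x)" and ?b = "\<lambda>t. ?\<psi> (flow u t x)" and ?c = "\<lambda>t. shear t x"
  let ?a' = "\<lambda>t. Lie u \<phi> (flow u t x)" and ?\<gamma> = "\<lambda>t. g (flow u t x)"
  \<comment> \<open>Since \<open>b' = r (b - a)\<close>, the combination \<open>A - A' / r\<close> is \<open>(c a' + \<gamma> (b - a)) / r\<close>: the derivative \<open>a'\<close> is
    traded for \<open>a\<close> and \<open>b\<close>.\<close>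
  let ?A = "\<lambda>t. ?c t * (?b t - ?a t)"
  let ?A' = "\<lambda>t. - ?\<gamma> t * (?b t - ?a t) + (r * (?b t - ?a t) - ?a' t) * ?c t"
  have dc: "DERIV ?c t :> - ?\<gamma> t" for t
    using shear_has_derivative by (simp add: has_real_derivative_iff_has_vector_derivative)
  have db: "DERIV ?b t :> r * (?b t - ?a t)" for t
    using flow_has_real_derivative[OF \<psi>, of x t] by (simp add: Lie_u_average[OF \<phi>])
  have dA: "DERIV ?A t :> ?A' t" for t
    by (rule DERIV_mult[OF dc DERIV_diff[OF db flow_has_real_derivative[OF \<phi>]]])
  obtain G where G: "G > 0" "\<And>t x. \<bar>shear t x\<bar> \<le> G * \<bar>t\<bar>" using shear_bound by metis
  obtain B1 where B1: "B1 > 0" "\<And>x. norm (?\<psi> x - \<phi> x) \<le> B1"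
    using bounded_continuous_torus[OF continuous_on_diff[OF cont(2,1)]] by metis
  obtain B2 where B2: "B2 > 0" "\<And>x. norm (Lie u \<phi> x) \<le> B2"
    using bounded_continuous_torus[OF cont(3)] by metis
  obtain B3 where B3: "B3 > 0" "\<And>x. norm (g x) \<le> B3"
    using bounded_continuous_torus[OF contg] by metis
  define K where "K = G * B1 + B3 * B1 + (r * B1 + B2) * G"
  have pos: "0 \<le> G * B1" "0 \<le> B3 * B1" "0 \<le> (r * B1 + B2) * G" "0 \<le> r * B1"
    using G B1 B2 B3 r by auto
  have K0: "K \<ge> 0" using pos by (simp add: K_def)
  have bA: "\<bar>?A t\<bar> \<le> K * (1 + \<bar>t\<bar>)" for t
  proof -
    have "\<bar>?A t\<bar> \<le> (G * \<bar>t\<bar>) * B1"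
      unfolding abs_mult using G B1(2)[of "flow u t x"] B1(1) by (intro mult_mono) auto
    also have "\<dots> \<le> K * \<bar>t\<bar>"
    proof -
      have "(G * B1) * \<bar>t\<bar> \<le> K * \<bar>t\<bar>" using pos by (intro mult_right_mono) (auto simp: K_def)
      then show ?thesis by (simp add: mult_ac)
    qed
    also have "\<dots> \<le> K * (1 + \<bar>t\<bar>)" using K0 by (intro mult_left_mono) auto
    finally show ?thesis .
  qed
  have bA': "\<bar>?A' t\<bar> \<le> K * (1 + \<bar>t\<bar>)" for t
  proof -
    have 1: "\<bar>- ?\<gamma> t * (?b t - ?a t)\<bar> \<le> B3 * B1"
      unfolding abs_mult abs_minus using B3(2)[of "flow u t x"] B1(2)[of "flow u t x"] B3(1) by (intro mult_mono) auto
    have "\<bar>r * (?b t - ?a t) - ?a' t\<bar> \<le> r * B1 + B2"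
    proof -
      have "\<bar>r * (?b t - ?a t)\<bar> \<le> r * B1"
        unfolding abs_mult using r B1(2)[of "flow u t x"] by simp
      then show ?thesis using B2(2)[of "flow u t x"] by simp
    qed
    then have 2: "\<bar>(r * (?b t - ?a t) - ?a' t) * ?c t\<bar> \<le> (r * B1 + B2) * (G * \<bar>t\<bar>)"
      unfolding abs_mult using G B2(1) pos by (intro mult_mono) auto
    have "\<bar>?A' t\<bar> \<le> B3 * B1 + ((r * B1 + B2) * G) * \<bar>t\<bar>"
      using 1 2 by (simp add: mult.assoc)
    also have "\<dots> \<le> K * 1 + K * \<bar>t\<bar>"
      using pos by (intro add_mono mult_right_mono) (auto simp: K_def)
    finally show ?thesis by (simp add: algebra_simps)
  qed
  have cc: "continuous_on UNIV ?c"
    using dc DERIV_isCont by (intro continuous_at_imp_continuous_on) blast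
  have contA': "continuous_on UNIV ?A'"
    by (intro continuous_intros continuous_along_flow contg cont cc)
  have "(\<integral>t. ?A t - ?A' t / r \<partial>exp_law r) = ?A 0"
    by (rule exp_law_parts[OF r dA contA' bA bA'])
  also have "(\<lambda>t. ?A t - ?A' t / r) = (\<lambda>t. (?c t * ?a' t - ?G (flow u t x)) / r)"
    using r by (auto simp: fun_eq_iff field_simps)
  finally have zero: "(\<integral>t. (?c t * ?a' t - ?G (flow u t x)) / r \<partial>exp_law r) = 0" by simp
  have i1: "integrable (exp_law r) (\<lambda>t. ?c t * ?a' t)"
  proof (rule integrable_exp_law[OF r, of _ "G * B2"])
    show "(\<lambda>t. ?c t * ?a' t) \<in> borel_measurable borel"
      by (intro borel_measurable_continuous_onI continuous_intros cc continuous_along_flow cont)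
    show "norm (?c t * ?a' t) \<le> G * B2 * (1 + \<bar>t\<bar>)" for t
    proof -
      have "norm (?c t * ?a' t) \<le> (G * \<bar>t\<bar>) * B2"
        unfolding norm_mult using G B2 by (intro mult_mono) auto
      also have "\<dots> = (G * B2) * \<bar>t\<bar>" by simp
      also have "\<dots> \<le> G * B2 * (1 + \<bar>t\<bar>)" using G B2 by (intro mult_left_mono) auto
      finally show ?thesis .
    qed
  qed
  have shear_term: "(\<integral>t. ?c t * ?a' t \<partial>exp_law r) = average ?G x"
    using zero r i1 integrable_along_flow[OF contG, of x] by (simp add: average_def)
  have "Lie w ?\<psi> x = (\<integral>t. Lie w \<phi> (flow u t x) + ?c t * ?a' t \<partial>exp_law r)"
  proof (cases x rule: torus_cases)
    case (1 y)
    have "frechet_derivative (\<lambda>y. \<phi> (torus_proj y)) (at (F t y)) (flow_diff t y (w (torus_proj y))) =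
        Lie w \<phi> (flow u t x) + ?c t * ?a' t" for t
      unfolding flow_diff_w 1 flow_proj Lie_proj[OF \<phi>]
      by (simp add: linear_add[OF linear_Lie[OF \<phi>]] linear_scale[OF linear_Lie[OF \<phi>]])
    then show ?thesis unfolding 1 Lie_average[OF \<phi>] by simp
  qed
  also have "\<dots> = average (Lie w \<phi>) x + average ?G x"
    using i1 integrable_along_flow[OF cont(4), of x] shear_term by (simp add: average_def)
  finally show ?thesis by simp
qed

section \<open>Duality of the two averages\<close>

lemma flow_invariant_integrable:
  fixes f :: "torus \<Rightarrow> real"
  assumes "f \<in> borel_measurable borel" "integrable torus_lebesgue (\<lambda>x. f x * h x)"
  shows "integrable torus_lebesgue (\<lambda>x. f (flow u t x) * h x)"
proof -
  have [measurable]: "h \<in> borel_measurable borel" "f \<in> borel_measurable borel"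
    using assms by (auto intro: borel_measurable_continuous_torus torus_smooth_continuous h_smooth)
  let ?M = "density torus_lebesgue (\<lambda>x. ennreal (h x))"
  have dens: "integrable torus_lebesgue (\<lambda>x. k x * h x) \<longleftrightarrow> integrable ?M k" if "k \<in> borel_measurable borel" for k :: "torus \<Rightarrow> real"
    using that less_imp_le[OF h_pos] by (subst integrable_density) (auto simp: mult.commute)
  have "integrable (distr ?M borel (flow u t)) f"
    using assms invariant dens[of f] by (simp add: flow_invariant_def)
  then have "integrable ?M (\<lambda>x. f (flow u t x))"
    by (subst (asm) integrable_distr_eq) auto
  then show ?thesis using dens[of "\<lambda>x. f (flow u t x)"] by simp
qed

lemma
  assumes p: "integrable torus_lebesgue p" and \<phi>: "continuous_on UNIV \<phi>"
  shows integrable_push: "integrable torus_lebesgue (push p)"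
    and push_average: "(\<integral>x. h x * push p x * \<phi> x \<partial>torus_lebesgue) = (\<integral>x. h x * p x * average \<phi> x \<partial>torus_lebesgue)"
proof -
  interpret N: prob_space "exp_law r" by (rule prob_space_exp_law[OF r])
  interpret NM: pair_sigma_finite "exp_law r" torus_lebesgue ..
  have conth: "continuous_on UNIV h" by (rule torus_smooth_continuous[OF h_smooth])
  have [measurable]: "h \<in> borel_measurable borel" "\<phi> \<in> borel_measurable borel" "p \<in> borel_measurable borel"
    using borel_measurable_continuous_torus conth \<phi> borel_measurable_integrable[OF p] by auto
  obtain B where B: "B > 0" "\<And>x. norm (\<phi> x) \<le> B" using bounded_continuous_torus[OF \<phi>] by metis
  have ph: "integrable torus_lebesgue (\<lambda>x. p x * h x)" by (rule integrable_mult_continuous[OF p conth])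
  have eq: "(\<integral>x. h x * p (flow u (- t) x) * \<eta> x \<partial>torus_lebesgue) = (\<integral>x. h x * p x * \<eta> (flow u t x) \<partial>torus_lebesgue)"
    if [measurable]: "\<eta> \<in> borel_measurable borel" for \<eta> t
    using flow_invariant_integral[OF invariant _ less_imp_le[OF h_pos], of "\<lambda>x. p x * \<eta> (flow u t x)" "- t"]
    by (simp add: mult_ac)
  have main: "integrable (exp_law r \<Otimes>\<^sub>M torus_lebesgue) (\<lambda>(t, x). h x * p (flow u (- t) x) * \<eta> x)"
    if [measurable]: "\<eta> \<in> borel_measurable borel" and \<eta>: "\<And>x. \<bar>\<eta> x\<bar> \<le> B" for \<eta>
  proof (rule NM.Fubini_integrable)
    show "(\<lambda>(t, x). h x * p (flow u (- t) x) * \<eta> x) \<in> borel_measurable (exp_law r \<Otimes>\<^sub>M torus_lebesgue)"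
      by measurable
    have i: "integrable torus_lebesgue (\<lambda>x. h x * p (flow u (- t) x) * \<eta> x)" for t
    proof (rule Bochner_Integration.integrable_bound)
      show "integrable torus_lebesgue (\<lambda>x. B * norm (p (flow u (- t) x) * h x))"
        using flow_invariant_integrable[OF _ ph] by simp
      show "AE x in torus_lebesgue. norm (h x * p (flow u (- t) x) * \<eta> x) \<le> norm (B * norm (p (flow u (- t) x) * h x))"
      proof (rule always_eventually, rule allI)
        fix x
        have "\<bar>h x * p (flow u (- t) x)\<bar> * \<bar>\<eta> x\<bar> \<le> \<bar>h x * p (flow u (- t) x)\<bar> * B"
          by (intro mult_left_mono \<eta>) simp
        then show "norm (h x * p (flow u (- t) x) * \<eta> x) \<le> norm (B * norm (p (flow u (- t) x) * h x))"
          using B(1) by (simp add: abs_mult mult_ac)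
      qed
    qed simp
    then show "AE t in exp_law r. integrable torus_lebesgue (\<lambda>x. case (t, x) of (t, x) \<Rightarrow> h x * p (flow u (- t) x) * \<eta> x)"
      by simp
    let ?I = "\<lambda>t. \<integral>x. norm (case (t, x) of (t, x) \<Rightarrow> h x * p (flow u (- t) x) * \<eta> x) \<partial>torus_lebesgue"
    show "integrable (exp_law r) ?I"
    proof (rule N.integrable_const_bound[where B = "B * (\<integral>x. norm (p x * h x) \<partial>torus_lebesgue)"])
      have "norm (?I t) \<le> B * (\<integral>x. norm (p x * h x) \<partial>torus_lebesgue)" for t
      proof -
        have "norm (?I t) = ?I t" by (simp add: integral_nonneg_AE)
        also have "\<dots> \<le> (\<integral>x. B * \<bar>p (flow u (- t) x) * h x\<bar> \<partial>torus_lebesgue)"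
        proof (rule integral_mono)
          show "integrable torus_lebesgue (\<lambda>x. norm (case (t, x) of (t, x) \<Rightarrow> h x * p (flow u (- t) x) * \<eta> x))"
            using i[of t] by simp
          show "integrable torus_lebesgue (\<lambda>x. B * \<bar>p (flow u (- t) x) * h x\<bar>)"
            using flow_invariant_integrable[OF _ ph] by simp
          fix x
          have "\<bar>h x * p (flow u (- t) x)\<bar> * \<bar>\<eta> x\<bar> \<le> \<bar>h x * p (flow u (- t) x)\<bar> * B"
            by (intro mult_left_mono \<eta>) simp
          then show "norm (case (t, x) of (t, x) \<Rightarrow> h x * p (flow u (- t) x) * \<eta> x) \<le> B * \<bar>p (flow u (- t) x) * h x\<bar>"
            by (simp add: abs_mult mult_ac)
        qed
        also have "\<dots> = B * (\<integral>x. \<bar>p (flow u (- t) x)\<bar> * h x \<partial>torus_lebesgue)"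
          using less_imp_le[OF h_pos] by (simp add: abs_mult)
        also have "(\<integral>x. \<bar>p (flow u (- t) x)\<bar> * h x \<partial>torus_lebesgue) = (\<integral>x. \<bar>p x\<bar> * h x \<partial>torus_lebesgue)"
          by (rule flow_invariant_integral[OF invariant _ less_imp_le[OF h_pos]]) auto
        also have "B * \<dots> = B * (\<integral>x. norm (p x * h x) \<partial>torus_lebesgue)"
          using less_imp_le[OF h_pos] by (simp add: abs_mult)
        finally show ?thesis .
      qed
      then show "AE t in exp_law r. norm (?I t) \<le> B * (\<integral>x. norm (p x * h x) \<partial>torus_lebesgue)" by simp
      show "?I \<in> borel_measurable (exp_law r)" by measurable
    qed
  qed
  have push_h: "(\<integral>t. h x * p (flow u (- t) x) * \<eta> x \<partial>exp_law r) = h x * push p x * \<eta> x" for x \<eta>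
    by (simp add: push_def)
  \<comment> \<open>The constant \<open>min 1 B\<close> is an admissible test function, whereas 1 may exceed the bound \<open>B\<close>.\<close>
  have "integrable torus_lebesgue (\<lambda>x. \<integral>t. h x * p (flow u (- t) x) * min 1 B \<partial>exp_law r)"
    using NM.integrable_snd[OF main[of "\<lambda>_. min 1 B"]] B(1) by simp
  then have push_B: "integrable torus_lebesgue (\<lambda>x. h x * push p x * min 1 B)"
    by (simp only: push_h[of _ "\<lambda>_. min 1 B"])
  have "integrable torus_lebesgue (\<lambda>x. (h x * push p x * min 1 B) * (inverse (h x) * inverse (min 1 B)))"
    by (rule integrable_mult_continuous[OF push_B])
      (use conth less_imp_neq[OF h_pos] B(1) in \<open>auto intro!: continuous_intros simp: min_def\<close>)
  moreover have "(h x * push p x * min 1 B) * (inverse (h x) * inverse (min 1 B)) = push p x" for x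
  proof -
    have "h x \<noteq> 0" "min 1 B \<noteq> 0" using h_pos[of x] B(1) by (auto simp: min_def)
    then show ?thesis by (simp add: field_simps)
  qed
  ultimately show "integrable torus_lebesgue (push p)" by simp
  have i2: "integrable (exp_law r \<Otimes>\<^sub>M torus_lebesgue) (\<lambda>(t, x). h x * p x * \<phi> (flow u t x))"
  proof (rule Bochner_Integration.integrable_bound)
    have "integrable (exp_law r \<Otimes>\<^sub>M torus_lebesgue) (\<lambda>(t, x). p x * h x)"
    proof (rule NM.Fubini_integrable)
      show "(\<lambda>(t, x). p x * h x) \<in> borel_measurable (exp_law r \<Otimes>\<^sub>M torus_lebesgue)" by measurable
    qed (use ph in simp_all)
    then show "integrable (exp_law r \<Otimes>\<^sub>M torus_lebesgue) (\<lambda>q. B * norm (p (snd q) * h (snd q)))"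
      by (simp add: case_prod_beta')
    show "(\<lambda>(t, x). h x * p x * \<phi> (flow u t x)) \<in> borel_measurable (exp_law r \<Otimes>\<^sub>M torus_lebesgue)" by measurable
    have "\<bar>h x * p x\<bar> * \<bar>\<phi> (flow u t x)\<bar> \<le> \<bar>h x * p x\<bar> * B" for t x
      using B(2)[of "flow u t x"] by (intro mult_left_mono) auto
    then show "AE q in exp_law r \<Otimes>\<^sub>M torus_lebesgue. norm (case q of (t, x) \<Rightarrow> h x * p x * \<phi> (flow u t x)) \<le>
        norm (B * norm (p (snd q) * h (snd q)))"
      using B(1) by (auto simp: case_prod_beta' abs_mult mult_ac)
  qed
  have "(\<integral>x. h x * push p x * \<phi> x \<partial>torus_lebesgue) =
      (\<integral>x. \<integral>t. h x * p (flow u (- t) x) * \<phi> x \<partial>exp_law r \<partial>torus_lebesgue)"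
    by (simp add: push_def)
  also have "\<dots> = (\<integral>t. \<integral>x. h x * p (flow u (- t) x) * \<phi> x \<partial>torus_lebesgue \<partial>exp_law r)"
    by (rule NM.Fubini_integral[OF main]) (use B in auto)
  also have "\<dots> = (\<integral>t. \<integral>x. h x * p x * \<phi> (flow u t x) \<partial>torus_lebesgue \<partial>exp_law r)"
    by (simp add: eq)
  also have "\<dots> = (\<integral>x. \<integral>t. h x * p x * \<phi> (flow u t x) \<partial>exp_law r \<partial>torus_lebesgue)"
    by (rule NM.Fubini_integral[OF i2, symmetric])
  also have "\<dots> = (\<integral>x. h x * p x * average \<phi> x \<partial>torus_lebesgue)"
    by (simp add: average_def)
  finally show "(\<integral>x. h x * push p x * \<phi> x \<partial>torus_lebesgue) = (\<integral>x. h x * p x * average \<phi> x \<partial>torus_lebesgue)" .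
qed

end

section \<open>Weak divergences and Sobolev classes\<close>

text \<open>The distribution \<open>div (p Z)\<close> is the function \<open>q\<close>.  Divergences are used in place of derivatives \<open>Z p\<close>
  because a smooth factor \<open>a\<close> passes freely between field and function: \<open>div (p (a Z)) = div ((a p) Z)\<close>.\<close>

definition weak_div :: "vector_field \<Rightarrow> (torus \<Rightarrow> real) \<Rightarrow> (torus \<Rightarrow> real) \<Rightarrow> bool" where
  "weak_div Z p q \<longleftrightarrow> integrable torus_lebesgue p \<and> integrable torus_lebesgue q \<and>
    (\<forall>\<phi>. torus_C1 \<phi> \<longrightarrow>
      (\<integral>x. p x * Lie Z \<phi> x \<partial>torus_lebesgue) = - (\<integral>x. q x * \<phi> x \<partial>torus_lebesgue))"

lemma integrable_mult_C1:
  fixes p \<phi> :: "torus \<Rightarrow> real"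
  shows "integrable torus_lebesgue p \<Longrightarrow> torus_C1 \<phi> \<Longrightarrow> integrable torus_lebesgue (\<lambda>x. p x * \<phi> x)"
  by (rule integrable_mult_continuous[OF _ torus_C1_continuous])

lemma integrable_mult_Lie:
  fixes p \<phi> :: "torus \<Rightarrow> real"
  shows "integrable torus_lebesgue p \<Longrightarrow> torus_C1 \<phi> \<Longrightarrow> continuous_on UNIV Z \<Longrightarrow>
    integrable torus_lebesgue (\<lambda>x. p x * Lie Z \<phi> x)"
  by (rule integrable_mult_continuous[OF _ continuous_Lie])

lemma weak_div_add:
  assumes "weak_div Z p q" "weak_div Z p' q'" "continuous_on UNIV Z"
  shows "weak_div Z (\<lambda>x. p x + p' x) (\<lambda>x. q x + q' x)"
  using assms by (auto simp: weak_div_def distrib_right integrable_mult_C1 integrable_mult_Lie)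

lemma weak_div_mult:
  assumes "weak_div Z p q" "torus_C1 a" "continuous_on UNIV Z"
  shows "weak_div Z (\<lambda>x. a x * p x) (\<lambda>x. a x * q x + Lie Z a x * p x)"
proof -
  have p: "integrable torus_lebesgue p" and q: "integrable torus_lebesgue q"
    using assms(1) by (auto simp: weak_div_def)
  have ap: "integrable torus_lebesgue (\<lambda>x. a x * p x)" "integrable torus_lebesgue (\<lambda>x. a x * q x)"
    "integrable torus_lebesgue (\<lambda>x. Lie Z a x * p x)"
    using integrable_mult_C1[OF p assms(2)] integrable_mult_C1[OF q assms(2)]
      integrable_mult_Lie[OF p assms(2,3)] by (simp_all add: mult.commute)
  have "(\<integral>x. a x * p x * Lie Z \<phi> x \<partial>torus_lebesgue) =
      - (\<integral>x. (a x * q x + Lie Z a x * p x) * \<phi> x \<partial>torus_lebesgue)" if \<phi>: "torus_C1 \<phi>" for \<phi>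
  proof -
    have C: "torus_C1 (\<lambda>x. a x * \<phi> x)" by (rule torus_C1_mult[OF assms(2) \<phi>])
    have eq1: "a x * p x * Lie Z \<phi> x = p x * Lie Z (\<lambda>x. a x * \<phi> x) x - (Lie Z a x * p x) * \<phi> x" for x
      by (simp only: Lie_mult[OF assms(2) \<phi>]) (simp add: algebra_simps)
    have eq2: "(a x * q x + Lie Z a x * p x) * \<phi> x = q x * (a x * \<phi> x) + (Lie Z a x * p x) * \<phi> x" for x
      by (simp add: algebra_simps)
    have "(\<integral>x. p x * Lie Z (\<lambda>x. a x * \<phi> x) x \<partial>torus_lebesgue) = - (\<integral>x. q x * (a x * \<phi> x) \<partial>torus_lebesgue)"
      using assms(1) C by (auto simp: weak_div_def)
    then show ?thesis
      unfolding eq1 eq2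
      using integrable_mult_Lie[OF p C assms(3)] integrable_mult_C1[OF ap(3) \<phi>] integrable_mult_C1[OF q C]
      by simp
  qed
  then show ?thesis using ap by (simp add: weak_div_def)
qed

lemma weak_div_field_scale:
  assumes "weak_div (\<lambda>x. a x *\<^sub>R Z x) p q" "continuous_on UNIV a"
  shows "weak_div Z (\<lambda>x. a x * p x) q"
proof -
  have "integrable torus_lebesgue (\<lambda>x. a x * p x)"
    using integrable_mult_continuous[of p a] assms by (simp add: weak_div_def mult.commute)
  moreover
  have "a x * p x * Lie Z \<phi> x = p x * Lie (\<lambda>x. a x *\<^sub>R Z x) \<phi> x" if "torus_C1 \<phi>" for x \<phi>
    by (simp add: Lie_field_scale[OF that])
  then have "(\<integral>x. a x * p x * Lie Z \<phi> x \<partial>torus_lebesgue) =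
      (\<integral>x. p x * Lie (\<lambda>x. a x *\<^sub>R Z x) \<phi> x \<partial>torus_lebesgue)" if "torus_C1 \<phi>" for \<phi>
    using that by (simp only:)
  ultimately show ?thesis using assms(1) by (auto simp: weak_div_def)
qed

lemma weak_div_field_unscale:
  assumes "weak_div Z (\<lambda>x. a x * p x) q" "integrable torus_lebesgue p"
  shows "weak_div (\<lambda>x. a x *\<^sub>R Z x) p q"
proof -
  have "p x * Lie (\<lambda>x. a x *\<^sub>R Z x) \<phi> x = a x * p x * Lie Z \<phi> x" if "torus_C1 \<phi>" for x \<phi>
    by (simp add: Lie_field_scale[OF that])
  then have "(\<integral>x. p x * Lie (\<lambda>x. a x *\<^sub>R Z x) \<phi> x \<partial>torus_lebesgue) =
      (\<integral>x. a x * p x * Lie Z \<phi> x \<partial>torus_lebesgue)" if "torus_C1 \<phi>" for \<phi>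
    using that by (simp only:)
  then show ?thesis using assms by (auto simp: weak_div_def)
qed

lemma weak_div_field_add:
  assumes "weak_div Z p q" "weak_div W p q'" "continuous_on UNIV Z" "continuous_on UNIV W"
  shows "weak_div (\<lambda>x. Z x + W x) p (\<lambda>x. q x + q' x)"
  using assms
  by (auto simp: weak_div_def distrib_right distrib_left integrable_mult_C1 integrable_mult_Lie Lie_field_add)

lemma weak_div_cong_AE:
  assumes "weak_div Z p q" "AE x in torus_lebesgue. p x = p' x" "p' \<in> borel_measurable borel"
    "continuous_on UNIV Z"
  shows "weak_div Z p' q"
proof -
  have [measurable]: "p \<in> borel_measurable borel"
    using assms(1) borel_measurable_integrable by (auto simp: weak_div_def)
  note [measurable] = assms(3)
  have p': "integrable torus_lebesgue p'"
    using assms(1,2) integrable_cong_AE[of p torus_lebesgue p'] by (simp add: weak_div_def)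
  have "(\<integral>x. p' x * Lie Z \<phi> x \<partial>torus_lebesgue) = (\<integral>x. p x * Lie Z \<phi> x \<partial>torus_lebesgue)"
    if "torus_C1 \<phi>" for \<phi>
  proof (rule integral_cong_AE)
    have [measurable]: "Lie Z \<phi> \<in> borel_measurable borel"
      by (rule borel_measurable_continuous_torus[OF continuous_Lie[OF that assms(4)]])
    show "(\<lambda>x. p' x * Lie Z \<phi> x) \<in> borel_measurable torus_lebesgue"
      "(\<lambda>x. p x * Lie Z \<phi> x) \<in> borel_measurable torus_lebesgue" by measurable
    show "AE x in torus_lebesgue. p' x * Lie Z \<phi> x = p x * Lie Z \<phi> x"
      using assms(2) by eventually_elim simp
  qed
  then show ?thesis using assms(1) p' by (simp add: weak_div_def)
qed

text \<open>For a transversal pair \<open>u, v\<close> these are the functions with integrable weak derivatives up to order \<open>k\<close>.\<close>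

primrec sobolev :: "vector_field \<Rightarrow> vector_field \<Rightarrow> nat \<Rightarrow> (torus \<Rightarrow> real) set" where
  "sobolev u v 0 = {p. integrable torus_lebesgue p}"
| "sobolev u v (Suc k) = {p. (\<exists>q\<in>sobolev u v k. weak_div u p q) \<and> (\<exists>q\<in>sobolev u v k. weak_div v p q)}"

lemma sobolev_integrable: "p \<in> sobolev u v k \<Longrightarrow> integrable torus_lebesgue p"
  by (cases k) (auto simp: weak_div_def)

lemma sobolev_swap: "sobolev v u k = sobolev u v k"
  by (induction k) auto

lemma sobolev_Suc_subset: "p \<in> sobolev u v (Suc k) \<Longrightarrow> p \<in> sobolev u v k"
proof (induction k arbitrary: p)
  case 0
  then show ?case by (auto simp: weak_div_def)
next
  case (Suc k)
  from Suc.prems obtain q q' where "q \<in> sobolev u v (Suc k)" "weak_div u p q"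
      "q' \<in> sobolev u v (Suc k)" "weak_div v p q'"
    unfolding sobolev.simps(2)[of u v "Suc k"] by blast
  then show ?case using Suc.IH unfolding sobolev.simps(2)[of u v k] by blast
qed

lemma sobolev_add:
  assumes "continuous_on UNIV u" "continuous_on UNIV v"
  shows "p \<in> sobolev u v k \<Longrightarrow> q \<in> sobolev u v k \<Longrightarrow> (\<lambda>x. p x + q x) \<in> sobolev u v k"
proof (induction k arbitrary: p q)
  case (Suc k)
  from Suc.prems obtain p0 p1 q0 q1 where
    "p0 \<in> sobolev u v k" "weak_div u p p0" "p1 \<in> sobolev u v k" "weak_div v p p1"
    "q0 \<in> sobolev u v k" "weak_div u q q0" "q1 \<in> sobolev u v k" "weak_div v q q1"
    by auto
  then have "(\<lambda>x. p0 x + q0 x) \<in> sobolev u v k" "weak_div u (\<lambda>x. p x + q x) (\<lambda>x. p0 x + q0 x)"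
    "(\<lambda>x. p1 x + q1 x) \<in> sobolev u v k" "weak_div v (\<lambda>x. p x + q x) (\<lambda>x. p1 x + q1 x)"
    by (simp_all add: Suc.IH weak_div_add assms)
  then show ?case unfolding sobolev.simps(2) by blast
qed simp

lemma sobolev_mult:
  assumes "torus_smooth u" "torus_smooth v"
  shows "p \<in> sobolev u v k \<Longrightarrow> torus_smooth a \<Longrightarrow> (\<lambda>x. a x * p x) \<in> sobolev u v k"
proof (induction k arbitrary: p a)
  case 0
  then show ?case
    using integrable_mult_continuous[of p a] torus_smooth_continuous[of a] by (simp add: mult.commute)
next
  case (Suc k)
  note c = torus_smooth_continuous[OF assms(1)] torus_smooth_continuous[OF assms(2)]
  obtain p0 p1 where p: "p0 \<in> sobolev u v k" "weak_div u p p0" "p1 \<in> sobolev u v k" "weak_div v p p1"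
    using Suc.prems(1) by auto
  have "p \<in> sobolev u v k" using Suc.prems(1) sobolev_Suc_subset by blast
  then have "(\<lambda>x. a x * p0 x + Lie u a x * p x) \<in> sobolev u v k"
    "(\<lambda>x. a x * p1 x + Lie v a x * p x) \<in> sobolev u v k"
    using p Suc.IH Suc.prems(2) torus_smooth_Lie assms by (auto intro!: sobolev_add c)
  moreover have "weak_div u (\<lambda>x. a x * p x) (\<lambda>x. a x * p0 x + Lie u a x * p x)"
    "weak_div v (\<lambda>x. a x * p x) (\<lambda>x. a x * p1 x + Lie v a x * p x)"
    using p Suc.prems(2) by (auto intro!: weak_div_mult c torus_C1_smooth)
  ultimately show ?case unfolding sobolev.simps(2) by blast
qed

lemma sobolev_diff:
  assumes "torus_smooth u" "torus_smooth v" "p \<in> sobolev u v k" "q \<in> sobolev u v k"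
  shows "(\<lambda>x. p x - q x) \<in> sobolev u v k"
  using sobolev_add[OF torus_smooth_continuous[OF assms(1)] torus_smooth_continuous[OF assms(2)] assms(3)
      sobolev_mult[OF assms(1,2,4) torus_smooth_const[of "-1"]]] by simp

lemma sobolev_cong_AE:
  assumes "p \<in> sobolev u v k" "AE x in torus_lebesgue. p x = p' x" "p' \<in> borel_measurable borel"
    "continuous_on UNIV u" "continuous_on UNIV v"
  shows "p' \<in> sobolev u v k"
proof (cases k)
  case 0
  have "p \<in> borel_measurable borel"
    using sobolev_integrable[OF assms(1)] borel_measurable_integrable by auto
  then show ?thesis
    using 0 assms integrable_cong_AE[of p torus_lebesgue p'] by simp
next
  case (Suc j)
  then obtain q0 q1 where "q0 \<in> sobolev u v j" "weak_div u p q0" "q1 \<in> sobolev u v j" "weak_div v p q1"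
    using assms(1) by auto
  then have "q0 \<in> sobolev u v j" "weak_div u p' q0" "q1 \<in> sobolev u v j" "weak_div v p' q1"
    using weak_div_cong_AE[OF _ assms(2,3)] assms(4,5) by auto
  then show ?thesis unfolding Suc sobolev.simps(2) by blast
qed

section \<open>Averages along a flow preserve the Sobolev classes\<close>

context switching_pair
begin

lemma continuous_v: "continuous_on UNIV v" and continuous_w: "continuous_on UNIV w"
  and continuous_h: "continuous_on UNIV h"
  by (auto intro: torus_smooth_continuous v_smooth w_smooth h_smooth)

text \<open>The dual of \<open>average_generator\<close>: along \<open>u\<close>, differentiation costs nothing.\<close>

lemma weak_div_push_u:
  assumes "integrable torus_lebesgue p"
  shows "weak_div u (\<lambda>x. h x * push p x) (\<lambda>x. r * (h x * p x) - r * (h x * push p x))"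
proof -
  note ip = integrable_push[OF assms torus_C1_continuous[OF torus_C1_const[of 0]]]
  have hp: "integrable torus_lebesgue (\<lambda>x. h x * p x)" "integrable torus_lebesgue (\<lambda>x. h x * push p x)"
    using integrable_mult_continuous[OF assms continuous_h] integrable_mult_continuous[OF ip continuous_h]
    by (simp_all add: mult.commute)
  have "(\<integral>x. h x * push p x * Lie u \<phi> x \<partial>torus_lebesgue) =
     - (\<integral>x. (r * (h x * p x) - r * (h x * push p x)) * \<phi> x \<partial>torus_lebesgue)" if \<phi>: "torus_C1 \<phi>" for \<phi>
  proof -
    have av: "torus_C1 (average \<phi>)" by (rule torus_C1_average[OF \<phi>])
    have "(\<integral>x. h x * push p x * Lie u \<phi> x \<partial>torus_lebesgue) = (\<integral>x. h x * p x * average (Lie u \<phi>) x \<partial>torus_lebesgue)"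
      by (rule push_average[OF assms continuous_Lie[OF \<phi> continuous_u]])
    also have "\<dots> = (\<integral>x. r * (h x * p x * average \<phi> x) - r * (h x * p x * \<phi> x) \<partial>torus_lebesgue)"
      by (simp add: average_generator[OF \<phi>] algebra_simps)
    also have "\<dots> = r * (\<integral>x. h x * p x * average \<phi> x \<partial>torus_lebesgue) - r * (\<integral>x. h x * p x * \<phi> x \<partial>torus_lebesgue)"
      using integrable_mult_C1[OF hp(1) \<phi>] integrable_mult_C1[OF hp(1) av] by simp
    also have "(\<integral>x. h x * p x * average \<phi> x \<partial>torus_lebesgue) = (\<integral>x. h x * push p x * \<phi> x \<partial>torus_lebesgue)"
      by (rule push_average[OF assms torus_C1_continuous[OF \<phi>], symmetric])
    also have "r * (\<integral>x. h x * push p x * \<phi> x \<partial>torus_lebesgue) - r * (\<integral>x. h x * p x * \<phi> x \<partial>torus_lebesgue)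
        = - (\<integral>x. r * (h x * p x * \<phi> x) - r * (h x * push p x * \<phi> x) \<partial>torus_lebesgue)"
      using integrable_mult_C1[OF hp(1) \<phi>] integrable_mult_C1[OF hp(2) \<phi>] by simp
    finally show ?thesis by (simp add: algebra_simps)
  qed
  then show ?thesis using hp by (simp add: weak_div_def)
qed

text \<open>The dual of \<open>average_Lie_w\<close>.  The right-hand side contains no derivative of \<open>push p\<close>, and the derivative \<open>q\<close>
  of \<open>p\<close> enters only through another average.\<close>

lemma weak_div_push_w:
  assumes w: "weak_div w (\<lambda>x. h x * p x) (\<lambda>x. h x * q x)" and p: "integrable torus_lebesgue p"
    and q: "integrable torus_lebesgue q"
  shows "weak_div w (\<lambda>x. h x * push p x)
    (\<lambda>x. h x * push (\<lambda>x. q x - g x * push p x) x + h x * (g x * push p x))"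
proof -
  note c0 = torus_C1_continuous[OF torus_C1_const[of 0]]
  note ip = integrable_push[OF p c0]
  have contg: "continuous_on UNIV g" by (rule torus_smooth_continuous[OF g_smooth])
  have gp: "integrable torus_lebesgue (\<lambda>x. g x * push p x)"
    using integrable_mult_continuous[OF ip contg] by (simp add: mult.commute)
  let ?s = "\<lambda>x. q x - g x * push p x"
  have s: "integrable torus_lebesgue ?s" using q gp by simp
  note ips = integrable_push[OF s c0]
  have h: "integrable torus_lebesgue (\<lambda>x. h x * f x)" if "integrable torus_lebesgue f" for f
    using integrable_mult_continuous[OF that continuous_h] by (simp add: mult.commute)
  have "(\<integral>x. h x * push p x * Lie w \<phi> x \<partial>torus_lebesgue) =
     - (\<integral>x. (h x * push ?s x + h x * (g x * push p x)) * \<phi> x \<partial>torus_lebesgue)" if \<phi>: "torus_C1 \<phi>" for \<phi>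
  proof -
    let ?\<psi> = "average \<phi>"
    have \<psi>: "torus_C1 ?\<psi>" by (rule torus_C1_average[OF \<phi>])
    let ?G = "\<lambda>x. g x * (\<phi> x - ?\<psi> x)"
    have contG: "continuous_on UNIV ?G"
      by (intro continuous_intros contg torus_C1_continuous \<phi> \<psi>)
    have "(\<integral>x. h x * push p x * Lie w \<phi> x \<partial>torus_lebesgue) = (\<integral>x. h x * p x * average (Lie w \<phi>) x \<partial>torus_lebesgue)"
      by (rule push_average[OF p continuous_Lie[OF \<phi> continuous_w]])
    also have "\<dots> = (\<integral>x. h x * p x * Lie w ?\<psi> x - h x * p x * average ?G x \<partial>torus_lebesgue)"
      by (simp add: average_Lie_w[OF \<phi>] algebra_simps)
    also have "\<dots> = (\<integral>x. h x * p x * Lie w ?\<psi> x \<partial>torus_lebesgue) - (\<integral>x. h x * p x * average ?G x \<partial>torus_lebesgue)"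
      using integrable_mult_Lie[OF h[OF p] \<psi> continuous_w]
        integrable_mult_continuous[OF h[OF p] continuous_average[OF contG]] by simp
    also have "(\<integral>x. h x * p x * Lie w ?\<psi> x \<partial>torus_lebesgue) = - (\<integral>x. h x * q x * ?\<psi> x \<partial>torus_lebesgue)"
      using w \<psi> by (simp add: weak_div_def)
    also have "(\<integral>x. h x * p x * average ?G x \<partial>torus_lebesgue) = (\<integral>x. h x * push p x * ?G x \<partial>torus_lebesgue)"
      by (rule push_average[OF p contG, symmetric])
    also have "(\<integral>x. h x * push p x * ?G x \<partial>torus_lebesgue) =
        (\<integral>x. h x * (g x * push p x) * \<phi> x - h x * (g x * push p x) * ?\<psi> x \<partial>torus_lebesgue)"
      by (simp add: algebra_simps)
    also have "\<dots> = (\<integral>x. h x * (g x * push p x) * \<phi> x \<partial>torus_lebesgue) - (\<integral>x. h x * (g x * push p x) * ?\<psi> x \<partial>torus_lebesgue)"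
      using integrable_mult_C1[OF h[OF gp] \<phi>] integrable_mult_C1[OF h[OF gp] \<psi>] by simp
    finally have 1: "(\<integral>x. h x * push p x * Lie w \<phi> x \<partial>torus_lebesgue) =
        - (\<integral>x. h x * q x * ?\<psi> x \<partial>torus_lebesgue) - ((\<integral>x. h x * (g x * push p x) * \<phi> x \<partial>torus_lebesgue)
        - (\<integral>x. h x * (g x * push p x) * ?\<psi> x \<partial>torus_lebesgue))" .
    have "(\<integral>x. h x * push ?s x * \<phi> x \<partial>torus_lebesgue) = (\<integral>x. h x * ?s x * ?\<psi> x \<partial>torus_lebesgue)"
      by (rule push_average[OF s torus_C1_continuous[OF \<phi>]])
    also have "\<dots> = (\<integral>x. h x * q x * ?\<psi> x - h x * (g x * push p x) * ?\<psi> x \<partial>torus_lebesgue)"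
      by (simp add: algebra_simps)
    also have "\<dots> = (\<integral>x. h x * q x * ?\<psi> x \<partial>torus_lebesgue) - (\<integral>x. h x * (g x * push p x) * ?\<psi> x \<partial>torus_lebesgue)"
      using integrable_mult_C1[OF h[OF q] \<psi>] integrable_mult_C1[OF h[OF gp] \<psi>] by simp
    finally have 2: "(\<integral>x. h x * push ?s x * \<phi> x \<partial>torus_lebesgue) =
        (\<integral>x. h x * q x * ?\<psi> x \<partial>torus_lebesgue) - (\<integral>x. h x * (g x * push p x) * ?\<psi> x \<partial>torus_lebesgue)" .
    have "(\<integral>x. (h x * push ?s x + h x * (g x * push p x)) * \<phi> x \<partial>torus_lebesgue) =
        (\<integral>x. h x * push ?s x * \<phi> x \<partial>torus_lebesgue) + (\<integral>x. h x * (g x * push p x) * \<phi> x \<partial>torus_lebesgue)"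
      unfolding distrib_right
      using integrable_mult_C1[OF h[OF ips] \<phi>] integrable_mult_C1[OF h[OF gp] \<phi>] by simp
    with 1 2 show ?thesis by simp
  qed
  then show ?thesis using h[OF ip] h[OF ips] h[OF gp] by (simp add: weak_div_def)
qed

text \<open>The product rule for \<open>p = (1 / a) (a p)\<close>.\<close>

lemma sobolev_cancel:
  assumes Z: "torus_smooth Z" and d: "weak_div Z (\<lambda>x. a x * p x) q" "q \<in> sobolev u v k"
    and p: "p \<in> sobolev u v k" and a: "torus_smooth a" "\<And>x. a x \<noteq> 0"
  obtains q' where "weak_div Z p q'" "q' \<in> sobolev u v k"
proof -
  let ?b = "\<lambda>x. inverse (a x)"
  have b: "torus_smooth ?b" by (rule torus_smooth_inverse[OF a])
  have "weak_div Z (\<lambda>x. ?b x * (a x * p x)) (\<lambda>x. ?b x * q x + Lie Z ?b x * (a x * p x))"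
    by (rule weak_div_mult[OF d(1) torus_C1_smooth[OF b] torus_smooth_continuous[OF Z]])
  moreover have "(\<lambda>x. ?b x * (a x * p x)) = p" using a(2) by (simp add: fun_eq_iff)
  moreover have "(\<lambda>x. ?b x * q x + Lie Z ?b x * (a x * p x)) \<in> sobolev u v k"
    by (intro sobolev_add continuous_u continuous_v sobolev_mult smooth v_smooth d p b torus_smooth_Lie Z a)
  ultimately show ?thesis using that by simp
qed

text \<open>One more derivative along \<open>v\<close> alone makes the average gain a full order: its derivative along
  \<open>u\<close> costs nothing.  The hypothesis \<open>IH\<close> is \<open>push_sobolev\<close> at order \<open>k\<close>, whose induction step is this
  lemma.\<close>

lemma push_gain:
  assumes IH: "\<And>p. p \<in> sobolev u v k \<Longrightarrow> push p \<in> sobolev u v k"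
    and p: "p \<in> sobolev u v k" and q: "weak_div v p q" "q \<in> sobolev u v k"
  shows "push p \<in> sobolev u v (Suc k)"
proof -
  note mult = sobolev_mult[OF smooth v_smooth]
  let ?\<kappa> = "\<lambda>x. inverse (h x * det2 (u x) (v x))"
  have h0: "h x \<noteq> 0" for x using h_pos[of x] by simp
  have nz: "h x * det2 (u x) (v x) \<noteq> 0" for x using h0 transversal by simp
  have \<kappa>: "torus_smooth ?\<kappa>"
    by (intro torus_smooth_inverse torus_smooth_mult h_smooth smooth_det2 nz)
  have w_eq: "w = (\<lambda>x. ?\<kappa> x *\<^sub>R v x)" by (simp add: w_def fun_eq_iff)
  let ?a = "\<lambda>x. ?\<kappa> x * h x"
  have a: "torus_smooth ?a" by (intro torus_smooth_mult \<kappa> h_smooth)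
  have a0: "?a x \<noteq> 0" for x using nz[of x] h0[of x] by simp
  have ih: "torus_smooth (\<lambda>x. inverse (h x))" by (intro torus_smooth_inverse h_smooth h0)
  have pp: "push p \<in> sobolev u v k" by (rule IH[OF p])
  have hp: "(\<lambda>x. h x * p x) \<in> sobolev u v k" "(\<lambda>x. h x * push p x) \<in> sobolev u v k"
    by (intro mult p pp h_smooth)+
  have "(\<lambda>x. r * (h x * p x) - r * (h x * push p x)) \<in> sobolev u v k"
    by (intro sobolev_diff smooth v_smooth mult[OF _ torus_smooth_const] hp)
  from sobolev_cancel[OF smooth weak_div_push_u[OF sobolev_integrable[OF p]] this pp h_smooth h0]
  obtain q0 where q0: "weak_div u (push p) q0" "q0 \<in> sobolev u v k" .
  let ?Y = "\<lambda>x. ?a x * q x + Lie v ?a x * p x"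
  have Y: "?Y \<in> sobolev u v k"
    by (intro sobolev_add continuous_u continuous_v mult q p a torus_smooth_Lie v_smooth)
  have "weak_div v (\<lambda>x. ?a x * p x) ?Y"
    by (rule weak_div_mult[OF q(1) torus_C1_smooth[OF a] continuous_v])
  then have "weak_div v (\<lambda>x. ?\<kappa> x * (h x * p x)) ?Y" by (simp only: mult.assoc)
  then have "weak_div w (\<lambda>x. h x * p x) ?Y"
    unfolding w_eq by (rule weak_div_field_unscale[OF _ sobolev_integrable[OF hp(1)]])
  moreover have "?Y = (\<lambda>x. h x * (inverse (h x) * ?Y x))"
    using h0 by (simp add: fun_eq_iff mult.assoc[symmetric])
  ultimately have "weak_div w (\<lambda>x. h x * p x) (\<lambda>x. h x * (inverse (h x) * ?Y x))"
    by (simp only:)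
  note W = weak_div_push_w[OF this sobolev_integrable[OF p] sobolev_integrable[OF mult[OF Y ih]]]
  let ?S = "\<lambda>x. h x * push (\<lambda>x. inverse (h x) * ?Y x - g x * push p x) x + h x * (g x * push p x)"
  have S: "?S \<in> sobolev u v k"
    by (intro sobolev_add continuous_u continuous_v mult IH sobolev_diff smooth v_smooth Y ih pp
        h_smooth g_smooth)
  have "weak_div v (\<lambda>x. ?\<kappa> x * (h x * push p x)) ?S"
    using W unfolding w_eq by (rule weak_div_field_scale) (rule torus_smooth_continuous[OF \<kappa>])
  then have "weak_div v (\<lambda>x. ?a x * push p x) ?S" by (simp only: mult.assoc)
  from sobolev_cancel[OF v_smooth this S pp a a0]
  obtain q1 where "weak_div v (push p) q1" "q1 \<in> sobolev u v k" .
  with q0 show ?thesis unfolding sobolev.simps(2) by blast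
qed

lemma push_sobolev: "p \<in> sobolev u v k \<Longrightarrow> push p \<in> sobolev u v k"
proof (induction k arbitrary: p)
  case 0
  then show ?case
    using integrable_push[OF _ torus_C1_continuous[OF torus_C1_const[of 0]]] by simp
next
  case (Suc k)
  from Suc.prems obtain q where "weak_div v p q" "q \<in> sobolev u v k" by auto
  with push_gain[OF Suc.IH sobolev_Suc_subset[OF Suc.prems]] show ?case by blast
qed

end

section \<open>Trigonometric polynomials\<close>

lemma C_k_cos_affine:
  "C_k n (\<lambda>y::real^2. c * cos (2 * pi * (of_int a * y $ 1 + of_int b * y $ 2) + \<theta>))"
proof (induction n arbitrary: c \<theta>)
  case 0
  show ?case by (simp add: continuous_intros)
next
  case (Suc n)
  show ?case
  proof (rule C_k_SucI)
    show "((\<lambda>y::real^2. c * cos (2 * pi * (of_int a * y $ 1 + of_int b * y $ 2) + \<theta>)) has_derivative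
      (\<lambda>v. (c * (2 * pi * (of_int a * v $ 1 + of_int b * v $ 2))) *
        cos (2 * pi * (of_int a * y $ 1 + of_int b * y $ 2) + (\<theta> + pi / 2)))) (at y)" for y
    proof -
      have "cos (2 * pi * (of_int a * y $ 1 + of_int b * y $ 2) + (\<theta> + pi / 2)) =
          - sin (2 * pi * (of_int a * y $ 1 + of_int b * y $ 2) + \<theta>)"
        using minus_sin_cos_eq[of "2 * pi * (of_int a * y $ 1 + of_int b * y $ 2) + \<theta>"]
        by (simp add: add.assoc)
      then show ?thesis
        by (auto intro!: derivative_eq_intros bounded_linear.has_derivative[OF bounded_linear_vec_nth]
            simp: algebra_simps)
    qed
  qed (rule Suc)
qed

lemma wave_smooth: "torus_smooth (wave a b \<theta>)"
  using C_k_cos_affine[of _ 1 a b \<theta>] by (simp add: torus_smooth_def C_infinity_def wave_proj)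

lemma Lie_wave: "Lie (\<lambda>_. axis i 1) (wave a b \<theta>) x =
   2 * pi * of_int (if i = 1 then a else b) * wave a b (\<theta> + pi / 2) x"
proof (cases x rule: torus_cases)
  case (1 y)
  have "((\<lambda>y. wave a b \<theta> (torus_proj y)) has_derivative
      (\<lambda>v. (2 * pi * (of_int a * v $ 1 + of_int b * v $ 2)) *
        - sin (2 * pi * (of_int a * y $ 1 + of_int b * y $ 2) + \<theta>))) (at y)"
    unfolding wave_proj
    by (auto intro!: derivative_eq_intros bounded_linear.has_derivative[OF bounded_linear_vec_nth]
        simp: algebra_simps)
  note D = Lie_eqI[OF torus_C1_smooth[OF wave_smooth] this]
  have s: "- sin (2 * pi * (of_int a * y $ 1 + of_int b * y $ 2) + \<theta>) = wave a b (\<theta> + pi / 2) x"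
    using minus_sin_cos_eq[of "2 * pi * (of_int a * y $ 1 + of_int b * y $ 2) + \<theta>"]
    by (simp add: 1 wave_proj add.assoc)
  have "of_int a * (axis i 1 :: real^2) $ 1 + of_int b * (axis i 1 :: real^2) $ 2 = real_of_int (if i = 1 then a else b)"
    using exhaust_2[of i] by (auto simp: axis_def)
  then show ?thesis unfolding 1 D s[unfolded 1] by simp
qed

lemma wave_mult: "wave a b \<theta> x * wave a' b' \<theta>' x =
    (1/2) * wave (a - a') (b - b') (\<theta> - \<theta>') x + (1/2) * wave (a + a') (b + b') (\<theta> + \<theta>') x"
  unfolding wave_def cos_times_cos by (simp add: algebra_simps add_divide_distrib)

lemma wave_minus: "wave (- a) (- b) (- \<theta>) x = wave a b \<theta> x"
proof -
  have "2 * pi * (of_int (- a) * y + of_int (- b) * z) + - \<theta> = - (2 * pi * (of_int a * y + of_int b * z) + \<theta>)" for y z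
    by (simp add: algebra_simps)
  then show ?thesis unfolding wave_def by (simp only: cos_minus)
qed

lemma wave_bound: "\<bar>wave a b \<theta> x\<bar> \<le> 1"
  by (simp add: wave_def)

lemma wave_measurable [measurable]: "wave a b \<theta> \<in> borel_measurable borel"
  by (rule borel_measurable_continuous_torus[OF continuous_wave])

lemma integral_wave: "(\<integral>x. wave a b \<theta> x \<partial>torus_lebesgue) = (if a = 0 \<and> b = 0 then cos \<theta> else 0)"
proof -
  have "of_int (if i = (1::2) then a else b) * (\<integral>x. wave a b \<theta> x \<partial>torus_lebesgue) = 0" for i
    using integral_partial_derivative_0[OF torus_C1_smooth[OF wave_smooth[of a b "\<theta> - pi / 2"]], of i]
    by (simp add: Lie_wave split: if_splits)
  from this[of 1] this[of 2] have "a = 0 \<and> b = 0 \<or> (\<integral>x. wave a b \<theta> x \<partial>torus_lebesgue) = 0" by auto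
  moreover have "(\<integral>x. wave 0 0 \<theta> x \<partial>torus_lebesgue) = cos \<theta>"
    by (simp add: wave_def torus.prob_space[simplified])
  ultimately show ?thesis by auto
qed

inductive_set trig_poly :: "(torus \<Rightarrow> real) set" where
  wave: "wave a b \<theta> \<in> trig_poly"
| add: "f \<in> trig_poly \<Longrightarrow> f' \<in> trig_poly \<Longrightarrow> (\<lambda>x. f x + f' x) \<in> trig_poly"
| scale: "f \<in> trig_poly \<Longrightarrow> (\<lambda>x. c * f x) \<in> trig_poly"

lemma trig_poly_mult_wave: "f \<in> trig_poly \<Longrightarrow> (\<lambda>x. f x * wave a b \<theta> x) \<in> trig_poly"
proof (induction rule: trig_poly.induct)
  case (wave a' b' \<theta>')
  show ?case unfolding wave_mult by (intro trig_poly.intros)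
next
  case (add f f')
  then show ?case unfolding distrib_right by (intro trig_poly.add)
next
  case (scale f c)
  then show ?case unfolding mult.assoc by (intro trig_poly.scale)
qed

lemma trig_poly_mult: "f' \<in> trig_poly \<Longrightarrow> f \<in> trig_poly \<Longrightarrow> (\<lambda>x. f x * f' x) \<in> trig_poly"
proof (induction rule: trig_poly.induct)
  case (wave a b \<theta>)
  then show ?case by (rule trig_poly_mult_wave)
next
  case (add f1 f2)
  then show ?case unfolding distrib_left by (intro trig_poly.add)
next
  case (scale f1 c)
  then show ?case unfolding mult.left_commute[of _ c] by (intro trig_poly.scale)
qed

lemma trig_poly_continuous: "f \<in> trig_poly \<Longrightarrow> continuous_on UNIV f"
  by (induction rule: trig_poly.induct) (auto intro!: continuous_intros continuous_wave)

interpretation trig: function_ring_on trig_poly UNIV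
proof
  have "wave 0 0 0 x = 1" for x by (simp add: wave_def)
  then show "(\<lambda>_. c) \<in> trig_poly" for c
    using trig_poly.scale[OF trig_poly.wave[of 0 0 0], of c] by simp
  show "\<exists>f\<in>trig_poly. f x \<noteq> f y" if "x \<noteq> y" for x y
    using waves_separate[OF that] trig_poly.wave by blast
qed (auto intro: compact_torus trig_poly_continuous trig_poly.add trig_poly_mult)

section \<open>An integrable function is determined by its Fourier coefficients\<close>

context
  fixes p :: "torus \<Rightarrow> real"
  assumes p: "integrable torus_lebesgue p"
    and coeffs: "\<And>a b \<theta>. (\<integral>x. p x * wave a b \<theta> x \<partial>torus_lebesgue) = 0"
begin

lemma zero_coefficients_trig: "f \<in> trig_poly \<Longrightarrow> (\<integral>x. p x * f x \<partial>torus_lebesgue) = 0"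
proof (induction rule: trig_poly.induct)
  case (wave a b \<theta>)
  show ?case by (rule coeffs)
next
  case (add f f')
  then show ?case
    using integrable_mult_continuous[OF p trig_poly_continuous] by (simp add: distrib_left)
next
  case (scale f c)
  then show ?case by (simp add: mult.left_commute[of _ c])
qed

text \<open>Stone-Weierstrass: trigonometric polynomials are uniformly dense.\<close>

lemma zero_coefficients_continuous:
  assumes f: "continuous_on UNIV f" shows "(\<integral>x. p x * f x \<partial>torus_lebesgue) = 0"
proof -
  have "\<bar>\<integral>x. p x * f x \<partial>torus_lebesgue\<bar> \<le> e * (\<integral>x. \<bar>p x\<bar> \<partial>torus_lebesgue)" if "e > 0" for e
  proof -
    obtain f' where f': "f' \<in> trig_poly" "\<And>x. \<bar>f x - f' x\<bar> < e"
      using trig.Stone_Weierstrass_basic[OF f \<open>e > 0\<close>] by auto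
    note i = integrable_mult_continuous[OF p f] integrable_mult_continuous[OF p trig_poly_continuous[OF f'(1)]]
    have "(\<integral>x. p x * f x \<partial>torus_lebesgue) = (\<integral>x. p x * f x - p x * f' x \<partial>torus_lebesgue)"
      using zero_coefficients_trig[OF f'(1)] i by simp
    also have "\<bar>\<dots>\<bar> \<le> (\<integral>x. \<bar>p x * f x - p x * f' x\<bar> \<partial>torus_lebesgue)"
      by (rule integral_abs_bound)
    also have "\<dots> \<le> (\<integral>x. e * \<bar>p x\<bar> \<partial>torus_lebesgue)"
    proof (rule integral_mono)
      fix x
      have "\<bar>p x * f x - p x * f' x\<bar> = \<bar>f x - f' x\<bar> * \<bar>p x\<bar>"
        unfolding right_diff_distrib[symmetric] abs_mult by (rule mult.commute)
      also have "\<dots> \<le> e * \<bar>p x\<bar>" using f'(2)[of x] by (intro mult_right_mono) auto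
      finally show "\<bar>p x * f x - p x * f' x\<bar> \<le> e * \<bar>p x\<bar>" .
    qed (use p i in auto)
    finally show ?thesis by simp
  qed
  note e = this
  let ?I = "\<bar>\<integral>x. p x * f x \<partial>torus_lebesgue\<bar>"
  have "?I \<le> 0"
  proof (rule field_le_epsilon)
    fix e :: real assume "e > 0"
    define d where "d = (\<integral>x. \<bar>p x\<bar> \<partial>torus_lebesgue) + 1"
    have "0 \<le> (\<integral>x. \<bar>p x\<bar> \<partial>torus_lebesgue)" by (rule integral_nonneg_AE) simp
    then have d: "d > 0" unfolding d_def by linarith
    have "?I \<le> e / d * (\<integral>x. \<bar>p x\<bar> \<partial>torus_lebesgue)" using e[of "e / d"] d \<open>e > 0\<close> by simp
    also have "\<dots> \<le> e / d * d" using d \<open>e > 0\<close> by (intro mult_left_mono) (auto simp: d_def)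
    finally show "?I \<le> 0 + e" using d by simp
  qed
  then show ?thesis by simp
qed

text \<open>The indicator of a closed set is the limit of continuous functions of the distance to the set, measured
  upstairs in the plane.\<close>

lemma zero_coefficients_closed:
  assumes C: "closed C" shows "(\<integral>x. p x * indicator C x \<partial>torus_lebesgue) = 0"
proof (cases "C = {}")
  case False
  let ?S = "torus_proj -` C"
  have S: "closed ?S" "?S \<noteq> {}"
  proof -
    have "open (torus_proj -` (- C))" using C by (simp add: open_Compl flip: open_torus_def)
    then show "closed ?S" by (simp add: closed_def vimage_Compl)
    show "?S \<noteq> {}" using False by (metis ex_in_conv proj_rep vimage_eq)
  qed
  define d where "d x = infdist (rep_torus x) ?S" for x
  have le: "infdist (y + k) ?S \<le> infdist y ?S" if k: "k \<in> lattice" for y k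
  proof -
    have "infdist (y + k) ?S \<le> dist y s" if "s \<in> ?S" for s
      using infdist_le[of "s + k" ?S "y + k"] that k by (simp add: dist_norm)
    then show ?thesis
      using S(2) unfolding infdist_notempty[OF S(2), of y] by (intro cINF_greatest) auto
  qed
  have "periodic (\<lambda>y. infdist y ?S)"
    unfolding periodic_def
  proof (intro allI ballI antisym)
    fix y k :: "real^2" assume k: "k \<in> lattice"
    show "infdist (y + k) ?S \<le> infdist y ?S" by (rule le[OF k])
    have "- k \<in> lattice" using k by (simp add: lattice_def)
    from le[OF this, of "y + k"] show "infdist y ?S \<le> infdist (y + k) ?S" by simp
  qed
  then have dproj: "d (torus_proj y) = infdist y ?S" for y
    unfolding d_def by (rule periodic_rep)
  have contd: "continuous_on UNIV d"
    unfolding continuous_on_torus_iff dproj by (intro continuous_intros)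
  have dC: "d x = 0 \<longleftrightarrow> x \<in> C" for x
    using in_closed_iff_infdist_zero[OF S, of "rep_torus x"] by (simp add: d_def)
  have d0: "0 \<le> d x" for x by (simp add: d_def infdist_nonneg)
  \<comment> \<open>Equal to 1 on the closed set, and eventually 0 at every point outside of it.\<close>
  define f where "f n x = max 0 (1 - real n * d x)" for n x
  have contf: "continuous_on UNIV (f n)" for n
    unfolding f_def by (intro continuous_intros contd)
  have [measurable]: "p \<in> borel_measurable borel" using borel_measurable_integrable[OF p] by simp
  have [measurable]: "f n \<in> borel_measurable borel" for n by (rule borel_measurable_continuous_torus[OF contf])
  have [measurable]: "C \<in> sets borel" using C by (rule borel_closed)
  have "(\<lambda>n. \<integral>x. p x * f n x \<partial>torus_lebesgue) \<longlonglongrightarrow> (\<integral>x. p x * indicator C x \<partial>torus_lebesgue)"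
  proof (rule integral_dominated_convergence[where w = "\<lambda>x. \<bar>p x\<bar>"])
    show "AE x in torus_lebesgue. (\<lambda>n. p x * f n x) \<longlonglongrightarrow> p x * indicator C x"
    proof (intro always_eventually allI tendsto_mult tendsto_const)
      fix x
      show "(\<lambda>n. f n x) \<longlonglongrightarrow> indicator C x"
      proof (cases "x \<in> C")
        case True
        then have "f n x = indicator C x" for n using dC[of x] by (simp add: f_def)
        then show ?thesis by simp
      next
        case False
        then have "d x > 0" using dC[of x] d0[of x] by simp
        then obtain n0 where "1 / d x \<le> real n0" using real_arch_simple by blast
        then have n0: "1 \<le> real n0 * d x" using \<open>d x > 0\<close> by (simp add: field_simps)
        have "\<forall>\<^sub>F n in sequentially. indicator C x = f n x"
          using eventually_ge_at_top[of n0]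
        proof eventually_elim
          case (elim n)
          have "real n0 * d x \<le> real n * d x" using elim d0 by (intro mult_right_mono) auto
          then show ?case using n0 False by (simp add: f_def)
        qed
        then show ?thesis by (rule Lim_transform_eventually[OF tendsto_const])
      qed
    qed
    show "AE x in torus_lebesgue. norm (p x * f n x) \<le> \<bar>p x\<bar>" for n
    proof (intro always_eventually allI)
      fix x
      have "\<bar>f n x\<bar> \<le> 1" using d0[of x] by (simp add: f_def)
      then show "norm (p x * f n x) \<le> \<bar>p x\<bar>"
        using mult_left_mono[of "\<bar>f n x\<bar>" 1 "\<bar>p x\<bar>"] by (simp add: abs_mult)
    qed
  qed (use p in simp_all)
  then have "(\<lambda>n. 0) \<longlonglongrightarrow> (\<integral>x. p x * indicator C x \<partial>torus_lebesgue)"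
    by (simp only: zero_coefficients_continuous[OF contf])
  then show ?thesis by (rule LIMSEQ_unique[OF _ tendsto_const])
qed simp

text \<open>The positive and the negative part of \<open>p\<close> are densities of two finite measures that agree on closed sets.\<close>

lemma zero_coefficients_AE: "AE x in torus_lebesgue. p x = 0"
proof -
  have [measurable]: "p \<in> borel_measurable borel" using borel_measurable_integrable[OF p] by simp
  let ?P = "\<lambda>x. ennreal (max 0 (p x))" and ?N = "\<lambda>x. ennreal (max 0 (- p x))"
  have dens: "emeasure (density torus_lebesgue (\<lambda>x. ennreal (max 0 (f x)))) C =
      ennreal (\<integral>x. max 0 (f x) * indicator C x \<partial>torus_lebesgue)"
    if C: "C \<in> sets borel" and f: "integrable torus_lebesgue f" for C f
  proof -
    have [measurable]: "f \<in> borel_measurable borel" using borel_measurable_integrable[OF f] by simp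
    note [measurable] = C
    have "emeasure (density torus_lebesgue (\<lambda>x. ennreal (max 0 (f x)))) C =
        (\<integral>\<^sup>+x. ennreal (max 0 (f x)) * indicator C x \<partial>torus_lebesgue)"
      by (rule emeasure_density) auto
    also have "\<dots> = (\<integral>\<^sup>+x. ennreal (max 0 (f x) * indicator C x) \<partial>torus_lebesgue)"
      by (intro nn_integral_cong) (auto simp: indicator_def)
    also have "\<dots> = ennreal (\<integral>x. max 0 (f x) * indicator C x \<partial>torus_lebesgue)"
    proof (rule nn_integral_eq_integral)
      show "integrable torus_lebesgue (\<lambda>x. max 0 (f x) * indicator C x)"
        by (rule Bochner_Integration.integrable_bound[OF f]) (auto simp: indicator_def)
    qed auto
    finally show ?thesis .
  qed
  have int: "integrable torus_lebesgue (\<lambda>x. max 0 (p x) * indicator C x)"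
    "integrable torus_lebesgue (\<lambda>x. max 0 (- p x) * indicator C x)" if [measurable]: "C \<in> sets borel" for C
    by (rule Bochner_Integration.integrable_bound[OF p]; auto simp: indicator_def)+
  have "density torus_lebesgue ?P = density torus_lebesgue ?N"
  proof (rule measure_eqI_generator_eq[where E = "Collect closed" and \<Omega> = UNIV and A = "\<lambda>_. UNIV"])
    show "Int_stable (Collect (closed :: torus set \<Rightarrow> bool))" by (auto simp: Int_stable_def)
    show "sets (density torus_lebesgue ?P) = sigma_sets UNIV (Collect closed)"
      "sets (density torus_lebesgue ?N) = sigma_sets UNIV (Collect closed)"
      by (simp_all add: borel_eq_closed)
    show "emeasure (density torus_lebesgue ?P) UNIV \<noteq> \<infinity>"
      using dens[OF _ p, of UNIV] by simp
    fix C :: "torus set" assume "C \<in> Collect closed"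
    then have C: "closed C" "C \<in> sets borel" by auto
    have "(\<integral>x. max 0 (p x) * indicator C x \<partial>torus_lebesgue) - (\<integral>x. max 0 (- p x) * indicator C x \<partial>torus_lebesgue)
       = (\<integral>x. max 0 (p x) * indicator C x - max 0 (- p x) * indicator C x \<partial>torus_lebesgue)"
      using int[OF C(2)] by simp
    also have "\<dots> = (\<integral>x. p x * indicator C x \<partial>torus_lebesgue)"
      by (intro Bochner_Integration.integral_cong) (auto simp: max_def indicator_def)
    also have "\<dots> = 0" by (rule zero_coefficients_closed[OF C(1)])
    finally show "emeasure (density torus_lebesgue ?P) C = emeasure (density torus_lebesgue ?N) C"
      using dens[OF C(2) p] dens[OF C(2) integrable_minus[OF p]] by simp
  qed auto
  then have "AE x in torus_lebesgue. ?P x = ?N x"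
    by (subst (asm) torus.density_unique_iff) auto
  then show ?thesis
    by eventually_elim (auto simp: max_def split: if_splits)
qed

end

section \<open>Fourier series with rapidly decreasing coefficients\<close>

text \<open>A listing of all frequencies, so that Fourier series become ordinary series.\<close>

definition freq :: "nat \<Rightarrow> int \<times> int" where
  "freq k = map_prod int_decode int_decode (prod_decode k)"

lemma bij_freq: "bij freq"
proof -
  have "bij (map_prod int_decode int_decode)"
    by (rule o_bij[of "map_prod int_encode int_encode"]) (simp_all add: fun_eq_iff)
  then have "bij (map_prod int_decode int_decode \<circ> prod_decode)"
    by (rule bij_comp[OF bij_prod_decode])
  moreover have "freq = map_prod int_decode int_decode \<circ> prod_decode"
    by (simp add: fun_eq_iff freq_def)
  ultimately show ?thesis by (simp only:)
qed

definition rapid :: "(nat \<Rightarrow> real) \<Rightarrow> bool" where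
  "rapid \<alpha> \<longleftrightarrow> (\<forall>i j. \<exists>C. \<forall>k.
     \<bar>real_of_int (fst (freq k))\<bar> ^ i * \<bar>real_of_int (snd (freq k))\<bar> ^ j * \<bar>\<alpha> k\<bar> \<le> C)"

text \<open>The code of an integer \<open>a\<close> is at most about \<open>2 \<bar>a\<bar>\<close>; this turns decay in the frequency into decay in the
  code.\<close>

lemma int_decode_square: "(1 + real m)\<^sup>2 \<le> 8 * (1 + (real_of_int (int_decode m))\<^sup>2)"
proof (cases "even m")
  case True
  then obtain j where j: "m = 2 * j" by (elim evenE)
  have d: "int_decode (2 * j) = int j" by (simp add: int_decode_def sum_decode_def)
  have "0 \<le> (2 * real j - 1)\<^sup>2" by simp
  then show ?thesis unfolding j d by (simp add: power2_eq_square algebra_simps)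
next
  case False
  then obtain j where j: "m = 2 * j + 1" by (elim oddE)
  have d: "int_decode (2 * j + 1) = - int j - 1" by (simp add: int_decode_def sum_decode_def)
  show ?thesis unfolding j d by (simp add: power2_eq_square algebra_simps)
qed

text \<open>Comparison with a product of two convergent series over the codes of the two components of the
  frequency.\<close>

lemma rapid_summable:
  assumes "rapid \<alpha>" shows "summable (\<lambda>k. \<bar>\<alpha> k\<bar>)"
proof -
  let ?a = "\<lambda>k. real_of_int (fst (freq k))" and ?b = "\<lambda>k. real_of_int (snd (freq k))"
  define G where "G m = 8 * inverse ((1 + real m)\<^sup>2)" for m :: nat
  have "summable (\<lambda>n. inverse ((real (Suc n)) ^ 2))"
    by (subst summable_Suc_iff) (rule inverse_power_summable, simp)
  then have Gs: "summable G" unfolding G_def by (intro summable_mult) (simp add: add.commute)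
  have G0: "0 \<le> G m" for m by (simp add: G_def)
  define S where "S = suminf G"
  have S: "sum G {..m} \<le> S" for m
    unfolding S_def by (intro sum_le_suminf Gs) (auto simp: G0)
  have S0: "0 \<le> S" using S[of 0] G0[of 0] by simp
  obtain C where C: "\<And>i j k. i \<le> 2 \<Longrightarrow> j \<le> 2 \<Longrightarrow> \<bar>?a k\<bar> ^ i * \<bar>?b k\<bar> ^ j * \<bar>\<alpha> k\<bar> \<le> C"
  proof -
    from assms obtain c where c: "\<And>i j k. \<bar>?a k\<bar> ^ i * \<bar>?b k\<bar> ^ j * \<bar>\<alpha> k\<bar> \<le> c i j"
      unfolding rapid_def by metis
    have c0: "0 \<le> c i j" for i j by (rule order_trans[OF _ c[of 0 i j]]) simp
    have "c i j \<le> (\<Sum>i\<le>2. \<Sum>j\<le>2. c i j)" if "i \<le> 2" "j \<le> 2" for i j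
    proof -
      have "c i j \<le> (\<Sum>j\<le>2. c i j)" using that c0 by (intro member_le_sum) auto
      also have "\<dots> \<le> (\<Sum>i\<le>2. \<Sum>j\<le>2. c i j)"
        using that c0 by (intro member_le_sum[of i _ "\<lambda>i. \<Sum>j\<le>2. c i j"]) (auto intro: sum_nonneg)
      finally show ?thesis .
    qed
    then show ?thesis using that c order_trans by blast
  qed
  have C0: "0 \<le> C" by (rule order_trans[OF _ C[of 0 0 0]]) simp_all
  have term_le: "\<bar>\<alpha> k\<bar> \<le> 4 * C * (G (fst (prod_decode k)) * G (snd (prod_decode k)))" for k
  proof -
    define m n where "m = fst (prod_decode k)" and "n = snd (prod_decode k)"
    have ab: "?a k = of_int (int_decode m)" "?b k = of_int (int_decode n)"
      by (simp_all add: freq_def m_def n_def)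
    have "(1 + real m)\<^sup>2 * (1 + real n)\<^sup>2 * \<bar>\<alpha> k\<bar> \<le> (8 * (1 + (?a k)\<^sup>2)) * (8 * (1 + (?b k)\<^sup>2)) * \<bar>\<alpha> k\<bar>"
      unfolding ab by (intro mult_mono int_decode_square) auto
    also have "\<dots> = 64 * (\<bar>?a k\<bar> ^ 0 * \<bar>?b k\<bar> ^ 0 * \<bar>\<alpha> k\<bar> + \<bar>?a k\<bar> ^ 2 * \<bar>?b k\<bar> ^ 0 * \<bar>\<alpha> k\<bar>
        + \<bar>?a k\<bar> ^ 0 * \<bar>?b k\<bar> ^ 2 * \<bar>\<alpha> k\<bar> + \<bar>?a k\<bar> ^ 2 * \<bar>?b k\<bar> ^ 2 * \<bar>\<alpha> k\<bar>)"
      by (simp add: algebra_simps)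
    also have "\<dots> \<le> 64 * (C + C + C + C)"
      by (intro mult_left_mono add_mono C) auto
    finally have "(1 + real m)\<^sup>2 * (1 + real n)\<^sup>2 * \<bar>\<alpha> k\<bar> \<le> 256 * C" by simp
    then have "\<bar>\<alpha> k\<bar> \<le> 256 * C / ((1 + real m)\<^sup>2 * (1 + real n)\<^sup>2)"
      by (simp add: pos_le_divide_eq mult.commute)
    then show ?thesis by (simp add: G_def m_def n_def field_simps)
  qed
  show ?thesis
  proof (rule bounded_imp_summable)
    fix n
    have "(\<Sum>k\<le>n. \<bar>\<alpha> k\<bar>) \<le> (\<Sum>k\<le>n. 4 * C * (G (fst (prod_decode k)) * G (snd (prod_decode k))))"
      by (intro sum_mono term_le)
    also have "\<dots> = 4 * C * (\<Sum>q\<in>prod_decode ` {..n}. G (fst q) * G (snd q))"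
      by (subst sum.reindex) (auto simp: sum_distrib_left inj_prod_decode)
    also have "\<dots> \<le> 4 * C * (\<Sum>q\<in>{..n} \<times> {..n}. G (fst q) * G (snd q))"
    proof (intro mult_left_mono sum_mono2)
      show "prod_decode ` {..n} \<subseteq> {..n} \<times> {..n}"
      proof
        fix q assume "q \<in> prod_decode ` {..n}"
        then obtain k where k: "k \<le> n" "q = prod_decode k" by auto
        then have "prod_encode (fst q, snd q) = k" by simp
        then show "q \<in> {..n} \<times> {..n}"
          using k le_prod_encode_1[of "fst q" "snd q"] le_prod_encode_2[of "snd q" "fst q"]
          by (auto simp: mem_Times_iff)
      qed
    qed (use C0 G0 in auto)
    also have "(\<Sum>q\<in>{..n} \<times> {..n}. G (fst q) * G (snd q)) = sum G {..n} * sum G {..n}"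
      by (simp add: sum_product sum.cartesian_product case_prod_beta')
    also have "4 * C * (sum G {..n} * sum G {..n}) \<le> 4 * C * (S * S)"
      using C0 G0 S S0 by (intro mult_left_mono mult_mono) (auto intro: sum_nonneg)
    finally show "(\<Sum>k\<le>n. \<bar>\<alpha> k\<bar>) \<le> 4 * C * (S * S)" .
  qed simp
qed

lemma rapid_times_freq:
  assumes "rapid \<alpha>"
  shows "rapid (\<lambda>k. real_of_int (fst (freq k)) * \<alpha> k)" "rapid (\<lambda>k. real_of_int (snd (freq k)) * \<alpha> k)"
proof -
  show "rapid (\<lambda>k. real_of_int (fst (freq k)) * \<alpha> k)"
    unfolding rapid_def
  proof (intro allI)
    fix i j
    obtain C where C: "\<And>k. \<bar>real_of_int (fst (freq k))\<bar> ^ Suc i * \<bar>real_of_int (snd (freq k))\<bar> ^ j * \<bar>\<alpha> k\<bar> \<le> C"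
      using assms unfolding rapid_def by blast
    show "\<exists>C. \<forall>k. \<bar>real_of_int (fst (freq k))\<bar> ^ i * \<bar>real_of_int (snd (freq k))\<bar> ^ j
        * \<bar>real_of_int (fst (freq k)) * \<alpha> k\<bar> \<le> C"
      using C by (intro exI[of _ C]) (simp add: abs_mult mult_ac)
  qed
  show "rapid (\<lambda>k. real_of_int (snd (freq k)) * \<alpha> k)"
    unfolding rapid_def
  proof (intro allI)
    fix i j
    obtain C where C: "\<And>k. \<bar>real_of_int (fst (freq k))\<bar> ^ i * \<bar>real_of_int (snd (freq k))\<bar> ^ Suc j * \<bar>\<alpha> k\<bar> \<le> C"
      using assms unfolding rapid_def by blast
    show "\<exists>C. \<forall>k. \<bar>real_of_int (fst (freq k))\<bar> ^ i * \<bar>real_of_int (snd (freq k))\<bar> ^ j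
        * \<bar>real_of_int (snd (freq k)) * \<alpha> k\<bar> \<le> C"
      using C by (intro exI[of _ C]) (simp add: abs_mult mult_ac)
  qed
qed

lemma rapid_linear_combination:
  assumes "rapid \<alpha>" "rapid \<beta>"
  shows "rapid (\<lambda>k. c * \<alpha> k + d * \<beta> k)"
  unfolding rapid_def
proof (intro allI)
  fix i j
  let ?p = "\<lambda>k. \<bar>real_of_int (fst (freq k))\<bar> ^ i * \<bar>real_of_int (snd (freq k))\<bar> ^ j"
  obtain C where C: "\<And>k. ?p k * \<bar>\<alpha> k\<bar> \<le> C" using assms(1) unfolding rapid_def by blast
  obtain D where D: "\<And>k. ?p k * \<bar>\<beta> k\<bar> \<le> D" using assms(2) unfolding rapid_def by blast
  have "?p k * \<bar>c * \<alpha> k + d * \<beta> k\<bar> \<le> \<bar>c\<bar> * C + \<bar>d\<bar> * D" for k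
  proof -
    have "?p k * \<bar>c * \<alpha> k + d * \<beta> k\<bar> \<le> ?p k * (\<bar>c\<bar> * \<bar>\<alpha> k\<bar> + \<bar>d\<bar> * \<bar>\<beta> k\<bar>)"
      by (intro mult_left_mono) (auto simp: abs_mult[symmetric] abs_triangle_ineq)
    also have "\<dots> = \<bar>c\<bar> * (?p k * \<bar>\<alpha> k\<bar>) + \<bar>d\<bar> * (?p k * \<bar>\<beta> k\<bar>)"
      by (simp add: algebra_simps)
    also have "\<dots> \<le> \<bar>c\<bar> * C + \<bar>d\<bar> * D"
      by (intro add_mono mult_left_mono C D) auto
    finally show ?thesis .
  qed
  then show "\<exists>C. \<forall>k. ?p k * \<bar>c * \<alpha> k + d * \<beta> k\<bar> \<le> C" by blast
qed

definition angle :: "nat \<Rightarrow> real^2 \<Rightarrow> real" where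
  "angle k y = 2 * pi * (of_int (fst (freq k)) * y $ 1 + of_int (snd (freq k)) * y $ 2)"

definition series :: "(nat \<Rightarrow> real) \<Rightarrow> (nat \<Rightarrow> real) \<Rightarrow> real^2 \<Rightarrow> real" where
  "series \<alpha> \<theta> y = (\<Sum>k. \<alpha> k * cos (angle k y + \<theta> k))"

lemma series_summable:
  assumes "rapid \<alpha>" shows "summable (\<lambda>k. \<alpha> k * cos (angle k y + \<theta> k))"
  by (rule summable_comparison_test'[OF rapid_summable[OF assms], of 0])
    (simp add: abs_mult mult_left_le)

lemma rapid_angle:
  assumes "rapid \<alpha>" shows "rapid (\<lambda>k. angle k v * \<alpha> k)"
proof -
  have "(\<lambda>k. angle k v * \<alpha> k) = (\<lambda>k. (2 * pi * v $ 1) * (real_of_int (fst (freq k)) * \<alpha> k)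
      + (2 * pi * v $ 2) * (real_of_int (snd (freq k)) * \<alpha> k))"
    by (simp add: angle_def fun_eq_iff algebra_simps)
  then show ?thesis
    using rapid_linear_combination[OF rapid_times_freq[OF assms], of "2 * pi * v $ 1" "2 * pi * v $ 2"]
    by (simp only:)
qed

text \<open>Derivatives of such series are series of the same kind, so one differentiation suffices.\<close>

lemma series_has_derivative:
  assumes "rapid \<alpha>"
  shows "(series \<alpha> \<theta> has_derivative (\<lambda>v. series (\<lambda>k. angle k v * \<alpha> k) (\<lambda>k. \<theta> k + pi / 2) y)) (at y)"
proof -
  note rv = rapid_angle[OF assms]
  let ?\<beta> = "\<lambda>k. 2 * pi * (\<bar>real_of_int (fst (freq k)) * \<alpha> k\<bar> + \<bar>real_of_int (snd (freq k)) * \<alpha> k\<bar>)"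
  have \<beta>: "summable ?\<beta>"
    by (intro summable_mult summable_add rapid_summable rapid_times_freq assms)
  let ?f' = "\<lambda>k y v. (angle k v * \<alpha> k) * cos (angle k y + (\<theta> k + pi / 2))"
  have f': "\<bar>?f' k y v\<bar> \<le> ?\<beta> k * norm v" for k y v
  proof -
    have 1: "\<bar>?f' k y v\<bar> \<le> \<bar>angle k v\<bar> * \<bar>\<alpha> k\<bar>"
      by (simp add: abs_mult mult_left_le)
    have "\<bar>angle k v\<bar> \<le> 2 * pi * ((\<bar>real_of_int (fst (freq k))\<bar> + \<bar>real_of_int (snd (freq k))\<bar>) * norm v)"
    proof -
      have "\<bar>of_int (fst (freq k)) * v $ 1 + of_int (snd (freq k)) * v $ 2\<bar> \<le>
          \<bar>real_of_int (fst (freq k))\<bar> * \<bar>v $ 1\<bar> + \<bar>real_of_int (snd (freq k))\<bar> * \<bar>v $ 2\<bar>"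
        by (simp add: abs_mult[symmetric] abs_triangle_ineq)
      also have "\<dots> \<le> \<bar>real_of_int (fst (freq k))\<bar> * norm v + \<bar>real_of_int (snd (freq k))\<bar> * norm v"
        by (intro add_mono mult_left_mono component_le_norm_cart) auto
      finally show ?thesis by (simp add: angle_def abs_mult distrib_right)
    qed
    then have 2: "\<bar>angle k v\<bar> * \<bar>\<alpha> k\<bar> \<le>
        2 * pi * ((\<bar>real_of_int (fst (freq k))\<bar> + \<bar>real_of_int (snd (freq k))\<bar>) * norm v) * \<bar>\<alpha> k\<bar>"
      by (rule mult_right_mono) simp
    have 3: "2 * pi * ((\<bar>real_of_int (fst (freq k))\<bar> + \<bar>real_of_int (snd (freq k))\<bar>) * norm v) * \<bar>\<alpha> k\<bar>
        = ?\<beta> k * norm v" by (simp add: abs_mult algebra_simps)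
    show ?thesis using order_trans[OF 1 2] unfolding 3 .
  qed
  have "\<exists>g. \<forall>x\<in>UNIV. (\<lambda>k. \<alpha> k * cos (angle k x + \<theta> k)) sums g x \<and>
      (g has_derivative (\<lambda>v. series (\<lambda>k. angle k v * \<alpha> k) (\<lambda>k. \<theta> k + pi / 2) x)) (at x within UNIV)"
  proof (rule has_derivative_series[where f' = ?f'])
    show "((\<lambda>x. \<alpha> k * cos (angle k x + \<theta> k)) has_derivative ?f' k x) (at x within UNIV)" for k x
    proof -
      have "cos (angle k x + (\<theta> k + pi / 2)) = - sin (angle k x + \<theta> k)"
        using minus_sin_cos_eq[of "angle k x + \<theta> k"] by (simp add: add.assoc)
      moreover have "(angle k has_derivative angle k) (at x)"
        unfolding angle_def[abs_def]
        by (auto intro!: derivative_eq_intros bounded_linear.has_derivative[OF bounded_linear_vec_nth])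
      ultimately show ?thesis
        by (auto intro!: derivative_eq_intros)
    qed
    fix e :: real assume "e > 0"
    obtain N where N: "\<And>n. n \<ge> N \<Longrightarrow> norm (\<Sum>k. ?\<beta> (k + n)) < e"
      using suminf_exist_split[OF \<open>e > 0\<close> \<beta>] by blast
    show "\<forall>\<^sub>F n in sequentially. \<forall>x\<in>UNIV. \<forall>v. norm (sum (\<lambda>k. ?f' k x v) {..<n} -
        series (\<lambda>k. angle k v * \<alpha> k) (\<lambda>k. \<theta> k + pi / 2) x) \<le> e * norm v"
      using eventually_ge_at_top[of N]
    proof eventually_elim
      case (elim n)
      show ?case
      proof (intro ballI allI)
        fix x v :: "real^2"
        have s: "summable (\<lambda>k. ?f' k x v)" by (rule series_summable[OF rv])
        have b: "summable (\<lambda>k. ?\<beta> (k + n) * norm v)"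
          by (intro summable_mult2 summable_ignore_initial_segment \<beta>)
        have "norm (sum (\<lambda>k. ?f' k x v) {..<n} - series (\<lambda>k. angle k v * \<alpha> k) (\<lambda>k. \<theta> k + pi / 2) x)
            = norm (\<Sum>k. ?f' (k + n) x v)"
          using suminf_minus_initial_segment[OF s, of n] by (simp add: series_def norm_minus_commute)
        also have "\<dots> \<le> (\<Sum>k. ?\<beta> (k + n) * norm v)"
          by (rule norm_suminf_le[OF _ b]) (use f' in simp)
        also have "\<dots> = (\<Sum>k. ?\<beta> (k + n)) * norm v"
          by (rule suminf_mult2[OF summable_ignore_initial_segment[OF \<beta>], symmetric])
        also have "\<dots> \<le> e * norm v"
          using N[OF elim] by (intro mult_right_mono) auto
        finally show "norm (sum (\<lambda>k. ?f' k x v) {..<n} -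
          series (\<lambda>k. angle k v * \<alpha> k) (\<lambda>k. \<theta> k + pi / 2) x) \<le> e * norm v" .
      qed
    qed
  next
    show "(\<lambda>k. \<alpha> k * cos (angle k 0 + \<theta> k)) sums series \<alpha> \<theta> 0"
      unfolding series_def by (rule summable_sums[OF series_summable[OF assms]])
  qed auto
  then obtain g where g: "\<And>x. (\<lambda>k. \<alpha> k * cos (angle k x + \<theta> k)) sums g x"
    "\<And>x. (g has_derivative (\<lambda>v. series (\<lambda>k. angle k v * \<alpha> k) (\<lambda>k. \<theta> k + pi / 2) x)) (at x)"
    by auto
  have "g = series \<alpha> \<theta>"
    using sums_unique[OF g(1)] by (simp add: fun_eq_iff series_def)
  then show ?thesis using g(2) by simp
qed

lemma C_k_series: "rapid \<alpha> \<Longrightarrow> C_k n (series \<alpha> \<theta>)"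
proof (induction n arbitrary: \<alpha> \<theta>)
  case 0
  then show ?case
    using series_has_derivative has_derivative_continuous
    by (simp add: continuous_on_eq_continuous_at) blast
next
  case (Suc n)
  show ?case
    by (rule C_k_SucI[OF series_has_derivative[OF Suc.prems]]) (intro Suc.IH rapid_angle Suc.prems)
qed

text \<open>Polar coordinates merge the cosine and the sine coefficient of a frequency into one shifted cosine.\<close>

lemma amplitude_phase:
  obtains \<alpha> \<theta> :: real where "\<alpha> * cos \<theta> = A" "- (\<alpha> * sin \<theta>) = S" "\<bar>\<alpha>\<bar> \<le> \<bar>A\<bar> + \<bar>S\<bar>"
proof -
  obtain \<alpha> \<theta> where AS: "A = \<alpha> * cos \<theta>" "- S = \<alpha> * sin \<theta>"
    using polar_Ex[of A "- S"] by (elim exE conjE)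
  have A: "\<alpha> * cos \<theta> = A" and S: "- (\<alpha> * sin \<theta>) = S"
    by (simp_all add: AS(1) flip: AS(2))
  have "A\<^sup>2 + S\<^sup>2 = \<alpha>\<^sup>2 * ((cos \<theta>)\<^sup>2 + (sin \<theta>)\<^sup>2)"
    unfolding A[symmetric] S[symmetric] by (simp only: power2_minus power_mult_distrib distrib_left)
  then have "\<bar>\<alpha>\<bar>\<^sup>2 = \<bar>A\<bar>\<^sup>2 + \<bar>S\<bar>\<^sup>2" by simp
  also have "\<dots> \<le> (\<bar>A\<bar> + \<bar>S\<bar>)\<^sup>2" by (simp add: power2_sum)
  finally have "\<bar>\<alpha>\<bar> \<le> \<bar>A\<bar> + \<bar>S\<bar>" by (rule power2_le_imp_le) simp
  from that[OF A S this] show ?thesis .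
qed

lemma amplitude_phase_functions:
  fixes A S :: "'a \<Rightarrow> 'b \<Rightarrow> real"
  shows "\<exists>\<alpha> \<theta>. (\<forall>a b. \<alpha> a b * cos (\<theta> a b) = A a b) \<and> (\<forall>a b. - (\<alpha> a b * sin (\<theta> a b)) = S a b) \<and>
    (\<forall>a b. \<bar>\<alpha> a b\<bar> \<le> \<bar>A a b\<bar> + \<bar>S a b\<bar>)"
proof -
  have "\<exists>\<alpha> \<theta>. \<alpha> * cos \<theta> = A a b \<and> - (\<alpha> * sin \<theta>) = S a b \<and> \<bar>\<alpha>\<bar> \<le> \<bar>A a b\<bar> + \<bar>S a b\<bar>" for a b
    by (rule amplitude_phase[of "A a b" "S a b"]) blast
  then show ?thesis by metis
qed

text \<open>Each frequency and its negative contribute half of a coefficient of the sum \<open>f\<close>, which therefore has the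
  same Fourier coefficients as \<open>p\<close>.\<close>

lemma smooth_representative_from_decay:
  assumes p: "integrable torus_lebesgue p"
    and decay: "\<And>i j. \<exists>C. \<forall>a b \<theta>. \<bar>real_of_int a\<bar> ^ i * \<bar>real_of_int b\<bar> ^ j *
      \<bar>\<integral>x. p x * wave a b \<theta> x \<partial>torus_lebesgue\<bar> \<le> C"
  shows "\<exists>f. torus_smooth f \<and> (AE x in torus_lebesgue. p x = f x)"
proof -
  let ?I = "\<lambda>a b \<theta>. \<integral>x. p x * wave a b \<theta> x \<partial>torus_lebesgue"
  obtain \<alpha>' \<theta>' where pol': "\<forall>a b. \<alpha>' a b * cos (\<theta>' a b) = ?I a b 0"
    "\<forall>a b. - (\<alpha>' a b * sin (\<theta>' a b)) = ?I a b (- (pi / 2))"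
    "\<forall>a b. \<bar>\<alpha>' a b\<bar> \<le> \<bar>?I a b 0\<bar> + \<bar>?I a b (- (pi / 2))\<bar>"
    using amplitude_phase_functions[of "\<lambda>a b. ?I a b 0" "\<lambda>a b. ?I a b (- (pi / 2))"]
    by (elim exE conjE)
  note pol = pol'(1)[rule_format] pol'(2)[rule_format] pol'(3)[rule_format]
  define \<alpha> where "\<alpha> k = \<alpha>' (fst (freq k)) (snd (freq k))" for k
  define \<theta> where "\<theta> k = \<theta>' (fst (freq k)) (snd (freq k))" for k
  have phase: "\<alpha>' a b * cos (\<theta>' a b - \<eta>) = ?I a b \<eta>" for a b \<eta>
  proof -
    have w: "wave a b \<eta> x = cos \<eta> * wave a b 0 x - sin \<eta> * wave a b (- (pi / 2)) x" for x
      by (simp add: wave_def cos_add cos_diff mult.commute)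
    have i: "integrable torus_lebesgue (\<lambda>x. p x * wave a b \<theta> x)" for \<theta>
      by (rule integrable_mult_continuous[OF p continuous_wave])
    have "?I a b \<eta> = (\<integral>x. cos \<eta> * (p x * wave a b 0 x) - sin \<eta> * (p x * wave a b (- (pi / 2)) x) \<partial>torus_lebesgue)"
      by (simp only: w) (simp add: algebra_simps)
    also have "\<dots> = cos \<eta> * ?I a b 0 - sin \<eta> * ?I a b (- (pi / 2))"
      using i by simp
    also have "\<dots> = \<alpha>' a b * cos (\<theta>' a b - \<eta>)"
      by (simp add: pol(1)[symmetric] pol(2)[symmetric] cos_diff algebra_simps)
    finally show ?thesis by simp
  qed
  have rapid: "rapid \<alpha>"
    unfolding rapid_def
  proof (intro allI)
    fix i j
    obtain C where C: "\<And>a b \<theta>. \<bar>real_of_int a\<bar> ^ i * \<bar>real_of_int b\<bar> ^ j * \<bar>?I a b \<theta>\<bar> \<le> C"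
      using decay by blast
    have "\<bar>real_of_int a\<bar> ^ i * \<bar>real_of_int b\<bar> ^ j * \<bar>\<alpha>' a b\<bar> \<le> C + C" for a b
    proof -
      have "\<bar>real_of_int a\<bar> ^ i * \<bar>real_of_int b\<bar> ^ j * \<bar>\<alpha>' a b\<bar> \<le>
        \<bar>real_of_int a\<bar> ^ i * \<bar>real_of_int b\<bar> ^ j * (\<bar>?I a b 0\<bar> + \<bar>?I a b (- (pi / 2))\<bar>)"
        by (intro mult_left_mono pol) auto
      also have "\<dots> \<le> C + C" unfolding distrib_left by (intro add_mono C)
      finally show ?thesis .
    qed
    then show "\<exists>C. \<forall>k. \<bar>real_of_int (fst (freq k))\<bar> ^ i * \<bar>real_of_int (snd (freq k))\<bar> ^ j * \<bar>\<alpha> k\<bar> \<le> C"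
      unfolding \<alpha>_def by blast
  qed
  let ?w = "\<lambda>k. wave (fst (freq k)) (snd (freq k)) (\<theta> k)"
  define f where "f x = (\<Sum>k. \<alpha> k * ?w k x)" for x
  have f_proj: "f (torus_proj y) = series \<alpha> \<theta> y" for y
    by (simp add: f_def series_def wave_proj angle_def)
  have f: "torus_smooth f"
    unfolding torus_smooth_def C_infinity_def f_proj
    using C_k_series[OF rapid] by (simp add: eta_contract_eq)
  have contf: "continuous_on UNIV f" by (rule torus_smooth_continuous[OF f])
  have fI: "(\<integral>x. f x * wave c d \<eta> x \<partial>torus_lebesgue) = ?I c d \<eta>" for c d \<eta>
  proof -
    let ?t = "\<lambda>k x. (\<alpha> k * ?w k x) * wave c d \<eta> x"
    have tb: "norm (?t k x) \<le> \<bar>\<alpha> k\<bar>" for k x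
    proof -
      have "\<bar>?w k x\<bar> * \<bar>wave c d \<eta> x\<bar> \<le> 1 * 1" by (intro mult_mono wave_bound) auto
      then have "\<bar>\<alpha> k\<bar> * (\<bar>?w k x\<bar> * \<bar>wave c d \<eta> x\<bar>) \<le> \<bar>\<alpha> k\<bar> * 1" by (intro mult_left_mono) auto
      then show ?thesis by (simp add: abs_mult mult.assoc)
    qed
    have ti: "integrable torus_lebesgue (?t k)" for k
      by (rule integrable_bounded_torus[of _ "\<bar>\<alpha> k\<bar>"]) (use tb in auto)
    have ts: "summable (\<lambda>k. norm (?t k x))" for x
      by (rule summable_comparison_test'[OF rapid_summable[OF rapid], of 0]) (use tb in simp)
    have tI: "summable (\<lambda>k. \<integral>x. norm (?t k x) \<partial>torus_lebesgue)"
    proof (rule summable_comparison_test'[OF rapid_summable[OF rapid], of 0])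
      show "norm (\<integral>x. norm (?t k x) \<partial>torus_lebesgue) \<le> \<bar>\<alpha> k\<bar>" for k
      proof -
        have "(\<integral>x. norm (?t k x) \<partial>torus_lebesgue) \<le> (\<integral>x. \<bar>\<alpha> k\<bar> \<partial>torus_lebesgue)"
          using ti[of k] tb by (intro integral_mono) auto
        then show ?thesis by (simp add: integral_nonneg_AE torus.prob_space[simplified])
      qed
    qed
    have sums1: "(\<lambda>k. \<integral>x. ?t k x \<partial>torus_lebesgue) sums (\<integral>x. (\<Sum>k. ?t k x) \<partial>torus_lebesgue)"
      by (rule sums_integral[OF ti _ tI]) (use ts in simp)
    \<comment> \<open>Orthogonality of the waves: only the frequencies \<open>(c, d)\<close> and \<open>(- c, - d)\<close> contribute.\<close>
    have val: "(\<integral>x. ?t k x \<partial>torus_lebesgue) =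
        (if freq k = (c, d) then ?I c d \<eta> / 2 else 0) + (if freq k = (- c, - d) then ?I c d \<eta> / 2 else 0)" for k
    proof -
      obtain a b where ab: "freq k = (a, b)" by (cases "freq k")
      have iw: "integrable torus_lebesgue (\<lambda>x. z * wave a b \<theta> x)" for a b z \<theta>
        using integrable_continuous_torus[OF continuous_wave] by simp
      have "(\<integral>x. ?t k x \<partial>torus_lebesgue) = (\<integral>x. (\<alpha> k / 2) * wave (a - c) (b - d) (\<theta> k - \<eta>) x
          + (\<alpha> k / 2) * wave (a + c) (b + d) (\<theta> k + \<eta>) x \<partial>torus_lebesgue)"
        unfolding ab fst_conv snd_conv mult.assoc[of "\<alpha> k"] wave_mult by (simp add: distrib_left)
      also have "\<dots> = (\<alpha> k / 2) * (\<integral>x. wave (a - c) (b - d) (\<theta> k - \<eta>) x \<partial>torus_lebesgue)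
          + (\<alpha> k / 2) * (\<integral>x. wave (a + c) (b + d) (\<theta> k + \<eta>) x \<partial>torus_lebesgue)"
        using iw by simp
      also have "(\<alpha> k / 2) * (\<integral>x. wave (a - c) (b - d) (\<theta> k - \<eta>) x \<partial>torus_lebesgue) =
          (if freq k = (c, d) then ?I c d \<eta> / 2 else 0)"
        using phase[of c d \<eta>] by (auto simp: integral_wave ab \<alpha>_def \<theta>_def)
      also have "(\<alpha> k / 2) * (\<integral>x. wave (a + c) (b + d) (\<theta> k + \<eta>) x \<partial>torus_lebesgue) =
          (if freq k = (- c, - d) then ?I c d \<eta> / 2 else 0)"
      proof -
        have "?I (- c) (- d) (- \<eta>) = ?I c d \<eta>" by (simp add: wave_minus)
        then show ?thesis
          using phase[of "- c" "- d" "- \<eta>"] by (auto simp: integral_wave ab \<alpha>_def \<theta>_def add_eq_0_iff)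
      qed
      finally show ?thesis .
    qed
    have single: "(\<lambda>k. if freq k = q then z else 0) sums z" for q and z :: real
    proof -
      obtain k0 where k0: "\<And>k. freq k = q \<longleftrightarrow> k = k0"
        using bij_freq by (metis bij_pointE)
      show ?thesis unfolding k0 using sums_single[of k0 "\<lambda>_. z"] by simp
    qed
    have "(\<lambda>k. \<integral>x. ?t k x \<partial>torus_lebesgue) sums (?I c d \<eta> / 2 + ?I c d \<eta> / 2)"
      unfolding val by (intro sums_add single)
    then have "(\<integral>x. (\<Sum>k. ?t k x) \<partial>torus_lebesgue) = ?I c d \<eta>"
      using sums_unique2[OF sums1] by simp
    moreover have "(\<Sum>k. ?t k x) = f x * wave c d \<eta> x" for x
    proof -
      have "summable (\<lambda>k. \<alpha> k * ?w k x)"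
        by (rule summable_comparison_test'[OF rapid_summable[OF rapid], of 0])
          (use wave_bound in \<open>simp add: abs_mult mult_left_le\<close>)
      then show ?thesis unfolding f_def by (rule suminf_mult2[symmetric])
    qed
    ultimately show ?thesis by simp
  qed
  have "AE x in torus_lebesgue. p x - f x = 0"
  proof (rule zero_coefficients_AE)
    show "integrable torus_lebesgue (\<lambda>x. p x - f x)"
      using p integrable_continuous_torus[OF contf] by simp
    show "(\<integral>x. (p x - f x) * wave a b \<theta> x \<partial>torus_lebesgue) = 0" for a b \<theta>
      using integrable_mult_continuous[OF p continuous_wave]
        integrable_mult_continuous[OF integrable_continuous_torus[OF contf] continuous_wave]
      by (simp add: left_diff_distrib fI)
  qed
  then show ?thesis using f by (intro exI[of _ f]) simp
qed

section \<open>Functions in all Sobolev classes are smooth\<close>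

text \<open>By Cramer's rule the coordinate fields are combinations of \<open>u\<close> and \<open>v\<close> with smooth coefficients.\<close>

lemma sobolev_partial:
  assumes u: "torus_smooth u" and v: "torus_smooth v" and tr: "\<And>x. det2 (u x) (v x) \<noteq> 0"
    and p: "p \<in> sobolev u v (Suc k)"
  obtains q where "q \<in> sobolev u v k" "weak_div (\<lambda>_. axis i 1) p q"
proof -
  note cu = torus_smooth_continuous[OF u] and cv = torus_smooth_continuous[OF v]
  let ?D = "\<lambda>x. inverse (det2 (u x) (v x))"
  let ?a = "\<lambda>x. det2 (axis i 1) (v x) * ?D x" and ?b = "\<lambda>x. det2 (u x) (axis i 1) * ?D x"
  have D: "torus_smooth ?D"
    using tr unfolding det2_def
    by (intro torus_smooth_inverse torus_smooth_diff torus_smooth_mult torus_smooth_nth u v) auto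
  have a: "torus_smooth ?a" and b: "torus_smooth ?b"
    unfolding det2_def
    by (intro torus_smooth_mult torus_smooth_diff torus_smooth_nth u v torus_smooth_const
        D[unfolded det2_def])+
  from p obtain q0 q1 where q: "q0 \<in> sobolev u v k" "weak_div u p q0" "q1 \<in> sobolev u v k" "weak_div v p q1"
    by auto
  have pk: "p \<in> sobolev u v k" by (rule sobolev_Suc_subset[OF p])
  have "weak_div (\<lambda>x. ?a x *\<^sub>R u x) p (\<lambda>x. ?a x * q0 x + Lie u ?a x * p x)"
    by (rule weak_div_field_unscale[OF weak_div_mult[OF q(2) torus_C1_smooth[OF a] cu] sobolev_integrable[OF p]])
  moreover have "weak_div (\<lambda>x. ?b x *\<^sub>R v x) p (\<lambda>x. ?b x * q1 x + Lie v ?b x * p x)"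
    by (rule weak_div_field_unscale[OF weak_div_mult[OF q(4) torus_C1_smooth[OF b] cv] sobolev_integrable[OF p]])
  ultimately have "weak_div (\<lambda>x. ?a x *\<^sub>R u x + ?b x *\<^sub>R v x) p
      (\<lambda>x. (?a x * q0 x + Lie u ?a x * p x) + (?b x * q1 x + Lie v ?b x * p x))"
    by (rule weak_div_field_add) (intro torus_smooth_continuous torus_smooth_scaleR a b u v)+
  moreover have "(\<lambda>x. ?a x *\<^sub>R u x + ?b x *\<^sub>R v x) = (\<lambda>_. axis i 1)"
  proof
    fix x
    have "det2 (u x) (v x) *\<^sub>R axis i 1 = det2 (axis i 1) (v x) *\<^sub>R u x + det2 (u x) (axis i 1) *\<^sub>R v x"
      by (simp add: vec_eq_iff forall_2 det2_def algebra_simps)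
    then have "?D x *\<^sub>R (det2 (u x) (v x) *\<^sub>R axis i 1) =
        ?D x *\<^sub>R (det2 (axis i 1) (v x) *\<^sub>R u x + det2 (u x) (axis i 1) *\<^sub>R v x)" by simp
    then show "?a x *\<^sub>R u x + ?b x *\<^sub>R v x = axis i 1"
      using tr[of x] by (simp add: scaleR_add_right mult.commute)
  qed
  moreover have "(\<lambda>x. (?a x * q0 x + Lie u ?a x * p x) + (?b x * q1 x + Lie v ?b x * p x)) \<in> sobolev u v k"
    by (intro sobolev_add cu cv sobolev_mult u v q pk torus_smooth_Lie a b)
  ultimately show ?thesis using that by simp
qed

text \<open>Each weak partial derivative takes one power of a frequency off a coefficient.\<close>

lemma sobolev_decay:
  assumes u: "torus_smooth u" and v: "torus_smooth v" and tr: "\<And>x. det2 (u x) (v x) \<noteq> 0"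
  shows "p \<in> sobolev u v k \<Longrightarrow> i + j \<le> k \<Longrightarrow> \<exists>C. \<forall>a b \<theta>. \<bar>real_of_int a\<bar> ^ i * \<bar>real_of_int b\<bar> ^ j *
      \<bar>\<integral>x. p x * wave a b \<theta> x \<partial>torus_lebesgue\<bar> \<le> C"
proof (induction k arbitrary: p i j)
  case 0
  have int: "integrable torus_lebesgue p" by (rule sobolev_integrable[OF 0(1)])
  have "\<bar>\<integral>x. p x * wave a b \<theta> x \<partial>torus_lebesgue\<bar> \<le> (\<integral>x. \<bar>p x\<bar> \<partial>torus_lebesgue)" for a b \<theta>
  proof -
    have "\<bar>\<integral>x. p x * wave a b \<theta> x \<partial>torus_lebesgue\<bar> \<le> (\<integral>x. \<bar>p x * wave a b \<theta> x\<bar> \<partial>torus_lebesgue)"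
      by (rule integral_abs_bound)
    also have "\<dots> \<le> (\<integral>x. \<bar>p x\<bar> \<partial>torus_lebesgue)"
    proof (rule integral_mono)
      show "\<bar>p x * wave a b \<theta> x\<bar> \<le> \<bar>p x\<bar>" for x
        using wave_bound[of a b \<theta> x] by (simp add: abs_mult mult_left_le)
    qed (use int integrable_abs[OF integrable_mult_continuous[OF int continuous_wave]] in simp_all)
    finally show ?thesis .
  qed
  then show ?case using 0(2) by (intro exI[of _ "\<integral>x. \<bar>p x\<bar> \<partial>torus_lebesgue"]) simp
next
  case (Suc k)
  have step: "2 * pi * \<bar>real_of_int (if l = 1 then a else b)\<bar> * \<bar>\<integral>x. p x * wave a b \<theta> x \<partial>torus_lebesgue\<bar>
      = \<bar>\<integral>x. q x * wave a b (\<theta> - pi / 2) x \<partial>torus_lebesgue\<bar>"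
    if "weak_div (\<lambda>_. axis l 1) p q" for l :: 2 and q a b \<theta>
  proof -
    have "(\<integral>x. p x * Lie (\<lambda>_. axis l 1) (wave a b (\<theta> - pi / 2)) x \<partial>torus_lebesgue)
        = - (\<integral>x. q x * wave a b (\<theta> - pi / 2) x \<partial>torus_lebesgue)"
      using that torus_C1_smooth[OF wave_smooth] unfolding weak_div_def by blast
    then have "(2 * pi * of_int (if l = 1 then a else b)) * (\<integral>x. p x * wave a b \<theta> x \<partial>torus_lebesgue)
        = - (\<integral>x. q x * wave a b (\<theta> - pi / 2) x \<partial>torus_lebesgue)"
      by (simp add: Lie_wave mult.left_commute[of "p _"])
    from arg_cong[OF this, of abs] show ?thesis by (simp add: abs_mult)
  qed
  have pi1: "X \<le> 2 * pi * X" if "0 \<le> X" for X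
    using pi_ge_two that mult_right_mono[of 1 "2 * pi" X] by simp
  consider "i = 0" "j = 0" | i' where "i = Suc i'" | j' where "i = 0" "j = Suc j'"
    by (cases i; cases j) auto
  then show ?case
  proof cases
    case 1
    then show ?thesis using Suc.IH[OF sobolev_Suc_subset[OF Suc.prems(1)], of 0 0] by simp
  next
    case (2 i')
    obtain q where q: "q \<in> sobolev u v k" "weak_div (\<lambda>_. axis 1 1) p q"
      by (rule sobolev_partial[OF u v tr Suc.prems(1)])
    have "i' + j \<le> k" using 2 Suc.prems(2) by simp
    from Suc.IH[OF q(1) this] obtain C where C: "\<And>a b \<theta>. \<bar>real_of_int a\<bar> ^ i' * \<bar>real_of_int b\<bar> ^ j *
        \<bar>\<integral>x. q x * wave a b \<theta> x \<partial>torus_lebesgue\<bar> \<le> C" by blast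
    have "\<bar>real_of_int a\<bar> ^ i * \<bar>real_of_int b\<bar> ^ j * \<bar>\<integral>x. p x * wave a b \<theta> x \<partial>torus_lebesgue\<bar> \<le> C" for a b \<theta>
    proof -
      let ?X = "\<bar>real_of_int a\<bar> * \<bar>\<integral>x. p x * wave a b \<theta> x \<partial>torus_lebesgue\<bar>"
      have "?X \<le> \<bar>\<integral>x. q x * wave a b (\<theta> - pi / 2) x \<partial>torus_lebesgue\<bar>"
        using pi1[of ?X] step[OF q(2), of a b \<theta>] by (simp add: mult.assoc)
      then have "\<bar>real_of_int a\<bar> ^ i' * \<bar>real_of_int b\<bar> ^ j * ?X \<le>
          \<bar>real_of_int a\<bar> ^ i' * \<bar>real_of_int b\<bar> ^ j * \<bar>\<integral>x. q x * wave a b (\<theta> - pi / 2) x \<partial>torus_lebesgue\<bar>"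
        by (rule mult_left_mono) simp
      also have "\<dots> \<le> C" by (rule C)
      finally show ?thesis by (simp add: 2 mult_ac)
    qed
    then show ?thesis by blast
  next
    case (3 j')
    obtain q where q: "q \<in> sobolev u v k" "weak_div (\<lambda>_. axis 2 1) p q"
      by (rule sobolev_partial[OF u v tr Suc.prems(1)])
    have "0 + j' \<le> k" using 3 Suc.prems(2) by simp
    from Suc.IH[OF q(1) this] obtain C where C: "\<And>a b \<theta>. \<bar>real_of_int a\<bar> ^ 0 * \<bar>real_of_int b\<bar> ^ j' *
        \<bar>\<integral>x. q x * wave a b \<theta> x \<partial>torus_lebesgue\<bar> \<le> C" by blast
    have "\<bar>real_of_int a\<bar> ^ i * \<bar>real_of_int b\<bar> ^ j * \<bar>\<integral>x. p x * wave a b \<theta> x \<partial>torus_lebesgue\<bar> \<le> C" for a b \<theta>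
    proof -
      let ?X = "\<bar>real_of_int b\<bar> * \<bar>\<integral>x. p x * wave a b \<theta> x \<partial>torus_lebesgue\<bar>"
      have "?X \<le> \<bar>\<integral>x. q x * wave a b (\<theta> - pi / 2) x \<partial>torus_lebesgue\<bar>"
        using pi1[of ?X] step[OF q(2), of a b \<theta>] by (simp add: mult.assoc)
      then have "\<bar>real_of_int b\<bar> ^ j' * ?X \<le>
          \<bar>real_of_int b\<bar> ^ j' * \<bar>\<integral>x. q x * wave a b (\<theta> - pi / 2) x \<partial>torus_lebesgue\<bar>"
        by (rule mult_left_mono) simp
      also have "\<dots> \<le> C" using C by simp
      finally show ?thesis by (simp add: 3 mult_ac)
    qed
    then show ?thesis by blast
  qed
qed

lemma smooth_if_all_sobolev:
  assumes "torus_smooth u" "torus_smooth v" "\<And>x. det2 (u x) (v x) \<noteq> 0"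
    and p: "\<And>k. p \<in> sobolev u v k"
  shows "\<exists>f. torus_smooth f \<and> (AE x in torus_lebesgue. p x = f x)"
  using sobolev_decay[OF assms(1-3) p order_refl] sobolev_integrable[OF p]
  by (intro smooth_representative_from_decay)

section \<open>Measurability of the switching process\<close>

lemma bit_cases: "(i::bit) = 0 \<or> i = 1"
  by (metis bit_not_zero_iff)

lemma UNIV_bit: "(UNIV :: bit set) = {0, 1}"
  using bit_cases by auto

lemma other_other [simp]: "1 - (1 - i) = (i::bit)"
  by simp

lemma other_neq: "1 - i \<noteq> (i::bit)"
  using bit_cases[of i] by auto

lemma countable_bit: "countable (UNIV :: bit set)"
  by (rule countable_finite) (simp add: UNIV_bit)

lemma waiting_times_eq: "waiting_times r = (\<Pi>\<^sub>M k\<in>UNIV. exp_law r)"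
  by (simp add: waiting_times_def exp_law_def)

lemma sets_waiting_times [measurable_cong]: "sets (waiting_times r) = sets (\<Pi>\<^sub>M k\<in>UNIV. borel)"
  unfolding waiting_times_eq by (rule sets_PiM_cong) auto

lemma space_waiting_times: "space (waiting_times r) = UNIV"
  by (simp add: waiting_times_eq space_PiM)

lemma prob_space_waiting_times: "r > 0 \<Longrightarrow> prob_space (waiting_times r)"
  unfolding waiting_times_eq by (intro prob_space_PiM prob_space_exp_law)

lemma space_state_space [simp]: "space state_space = UNIV"
  by (simp add: state_space_def space_pair_measure)

locale switching_fields =
  fixes u :: "bit \<Rightarrow> vector_field" and r :: real
  assumes u_smooth: "torus_smooth (u i)" and r: "r > 0"
begin

lemma measurable_switching_flow [measurable (raw)]:
  assumes i: "i \<in> M \<rightarrow>\<^sub>M count_space UNIV" and f: "f \<in> M \<rightarrow>\<^sub>M borel" and g: "g \<in> M \<rightarrow>\<^sub>M borel"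
  shows "(\<lambda>s. flow (u (i s)) (f s) (g s)) \<in> M \<rightarrow>\<^sub>M borel"
proof (rule measurable_compose_countable'[OF _ i countable_bit])
  fix k
  interpret smooth_field "u k" by unfold_locales (rule u_smooth)
  show "(\<lambda>s. flow (u k) (f s) (g s)) \<in> M \<rightarrow>\<^sub>M borel"
    by (rule measurable_flow_compose[OF f g])
qed

lemma measurable_waiting_time [measurable]: "(\<lambda>\<tau>. \<tau> n) \<in> waiting_times r \<rightarrow>\<^sub>M borel"
  unfolding waiting_times_eq using measurable_component_singleton[of n UNIV "\<lambda>_. exp_law r"]
  by (simp cong: measurable_cong_sets)

lemma measurable_state_after_switches:
  "(\<lambda>\<omega>. state_after_switches u (fst \<omega>) (snd \<omega>) n) \<in> state_space \<Otimes>\<^sub>M waiting_times r \<rightarrow>\<^sub>M state_space"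
proof (induction n)
  case 0
  show ?case by simp
next
  case (Suc n)
  let ?M = "state_space \<Otimes>\<^sub>M waiting_times r"
  let ?s = "\<lambda>\<omega>. state_after_switches u (fst \<omega>) (snd \<omega>) n"
  have f: "(\<lambda>\<omega>. fst (?s \<omega>)) \<in> ?M \<rightarrow>\<^sub>M borel" and s: "(\<lambda>\<omega>. snd (?s \<omega>)) \<in> ?M \<rightarrow>\<^sub>M count_space UNIV"
    using measurable_compose[OF Suc.IH measurable_fst[of "borel :: torus measure" "count_space (UNIV :: bit set)", folded state_space_def]]
      measurable_compose[OF Suc.IH measurable_snd[of "borel :: torus measure" "count_space (UNIV :: bit set)", folded state_space_def]]
    by simp_all
  have t: "(\<lambda>\<omega>. snd \<omega> n) \<in> ?M \<rightarrow>\<^sub>M borel"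
    by (rule measurable_compose[OF measurable_snd measurable_waiting_time])
  have "(\<lambda>\<omega>. (flow (u (snd (?s \<omega>))) (snd \<omega> n) (fst (?s \<omega>)), 1 - snd (?s \<omega>)))
      \<in> ?M \<rightarrow>\<^sub>M borel \<Otimes>\<^sub>M count_space UNIV"
    by (intro measurable_Pair measurable_switching_flow s t f measurable_compose[OF s]) simp
  then show ?case
    by (simp add: state_space_def case_prod_beta' Let_def)
qed

lemma measurable_switch_time [measurable]: "(\<lambda>\<tau>. switch_time \<tau> n) \<in> waiting_times r \<rightarrow>\<^sub>M borel"
  unfolding switch_time_def by measurable

lemma measurable_switch_count: "(\<lambda>\<tau>. switch_count \<tau> t) \<in> waiting_times r \<rightarrow>\<^sub>M count_space UNIV"
  unfolding switch_count_def by measurable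

text \<open>Joint measurability in the starting state and the waiting times; the number of switches takes countably many
  values.\<close>

lemma measurable_switching_process:
  "(\<lambda>\<omega>. switching_process u (fst \<omega>) (snd \<omega>) t) \<in> state_space \<Otimes>\<^sub>M waiting_times r \<rightarrow>\<^sub>M state_space"
proof -
  let ?M = "state_space \<Otimes>\<^sub>M waiting_times r"
  let ?s = "\<lambda>n \<omega>. state_after_switches u (fst \<omega>) (snd \<omega>) n"
  have f: "(\<lambda>\<omega>. fst (?s n \<omega>)) \<in> ?M \<rightarrow>\<^sub>M borel" and s: "(\<lambda>\<omega>. snd (?s n \<omega>)) \<in> ?M \<rightarrow>\<^sub>M count_space UNIV" for n
    using measurable_compose[OF measurable_state_after_switches measurable_fst[of "borel :: torus measure" "count_space (UNIV :: bit set)", folded state_space_def]]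
      measurable_compose[OF measurable_state_after_switches measurable_snd[of "borel :: torus measure" "count_space (UNIV :: bit set)", folded state_space_def]]
    by simp_all
  have st: "(\<lambda>\<omega>. t - switch_time (snd \<omega>) n) \<in> ?M \<rightarrow>\<^sub>M borel" for n
    by (intro borel_measurable_diff measurable_const measurable_compose[OF measurable_snd measurable_switch_time]) simp
  have c: "(\<lambda>\<omega>. switch_count (snd \<omega>) t) \<in> ?M \<rightarrow>\<^sub>M count_space UNIV"
    by (rule measurable_compose[OF measurable_snd measurable_switch_count])
  have "(\<lambda>\<omega>. (flow (u (snd (?s n \<omega>))) (t - switch_time (snd \<omega>) n) (fst (?s n \<omega>)), snd (?s n \<omega>)))
      \<in> ?M \<rightarrow>\<^sub>M borel \<Otimes>\<^sub>M count_space UNIV" for n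
    by (intro measurable_Pair measurable_switching_flow s st f)
  from measurable_compose_countable[OF this c]
  show ?thesis
    by (simp add: switching_process_def state_space_def case_prod_beta' Let_def)
qed

lemma measurable_switching_process_path:
  "(\<lambda>\<tau>. switching_process u s \<tau> t) \<in> waiting_times r \<rightarrow>\<^sub>M state_space"
  using measurable_Pair2[OF measurable_switching_process, of s t] by simp

section \<open>The process over a short time\<close>

lemma switching_process_before_first_switch:
  assumes "t < \<tau> 0"
  shows "switching_process u (x, i) \<tau> t = (flow (u i) t x, i)"
proof -
  have "switch_count \<tau> t = 0"
    unfolding switch_count_def by (rule Least_eq_0) (use assms in \<open>simp add: switch_time_def\<close>)
  then show ?thesis by (simp add: switching_process_def switch_time_def)
qed

lemma switching_process_after_first_switch:
  assumes "\<tau> 0 \<le> t" "t < \<tau> 0 + \<tau> 1"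
  shows "switching_process u (x, i) \<tau> t = (flow (u (1 - i)) (t - \<tau> 0) (flow (u i) (\<tau> 0) x), 1 - i)"
proof -
  have "switch_count \<tau> t = 1"
    unfolding switch_count_def
  proof (rule Least_equality)
    show "t < switch_time \<tau> (Suc 1)" using assms(2) by (simp add: switch_time_def)
    fix n assume "t < switch_time \<tau> (Suc n)"
    then show "1 \<le> n" using assms(1) by (cases n) (auto simp: switch_time_def)
  qed
  then show ?thesis by (simp add: switching_process_def switch_time_def)
qed

abbreviation "W \<equiv> waiting_times r"

lemma measure_exp_law_atMost: "0 \<le> t \<Longrightarrow> emeasure (exp_law r) {..t} = ennreal (1 - exp (- r * t))"
  unfolding exp_law_def using emeasure_erlang_density[OF r, of 0 t] by (simp add: erlang_CDF_0)

lemma prob_first_switch: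
  assumes "0 \<le> t" shows "measure W {\<tau>. \<tau> 0 \<le> t} = 1 - exp (- r * t)"
proof -
  interpret product_prob_space "\<lambda>_::nat. exp_law r" UNIV
    by (rule product_prob_spaceI) (rule prob_space_exp_law[OF r])
  have "emeasure W {\<tau>. \<tau> 0 \<le> t} = ennreal (1 - exp (- r * t))"
    using emeasure_PiM_Collect_single[of 0 "{..t}"] measure_exp_law_atMost[OF assms]
    by (simp add: waiting_times_eq space_PiM)
  then show ?thesis
    using r assms by (simp add: measure_def)
qed

lemma prob_two_short_times:
  assumes "0 \<le> t" shows "measure W {\<tau>. \<tau> 0 \<le> t \<and> \<tau> 1 \<le> t} = (1 - exp (- r * t))\<^sup>2"
proof -
  interpret product_prob_space "\<lambda>_::nat. exp_law r" UNIV
    by (rule product_prob_spaceI) (rule prob_space_exp_law[OF r])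
  have "emeasure W {\<tau>. \<tau> 0 \<le> t \<and> \<tau> 1 \<le> t} = ennreal (1 - exp (- r * t)) * ennreal (1 - exp (- r * t))"
    using emeasure_PiM_Collect[of "{0, 1}" "\<lambda>_. {..t}"] measure_exp_law_atMost[OF assms]
    by (simp add: waiting_times_eq space_PiM)
  also have "\<dots> = ennreal ((1 - exp (- r * t))\<^sup>2)"
    using r assms by (simp add: ennreal_mult[symmetric] power2_eq_square)
  finally show ?thesis
    by (simp add: measure_def)
qed

lemma AE_waiting_time_nonneg: "AE \<tau> in W. 0 \<le> \<tau> 0"
proof -
  interpret product_prob_space "\<lambda>_::nat. exp_law r" UNIV
    by (rule product_prob_spaceI) (rule prob_space_exp_law[OF r])
  have "distr W (exp_law r) (\<lambda>\<tau>. \<tau> 0) = exp_law r"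
    unfolding waiting_times_eq by (rule PiM_component) simp
  then have "AE t in distr W (exp_law r) (\<lambda>\<tau>. \<tau> 0). 0 \<le> t"
    using AE_exp_law_nonneg[OF r] by (simp only:)
  then show ?thesis
    by (rule AE_distrD[rotated]) (use measurable_waiting_time in \<open>simp cong: measurable_cong_sets\<close>)
qed

text \<open>Up to an event of probability \<open>O(t^2)\<close> there is at most one switch before time \<open>t\<close>.\<close>

lemma short_time_expectation:
  fixes \<psi> :: "torus \<Rightarrow> real" and i :: bit and x :: torus and t :: real
  assumes \<psi>: "torus_C1 \<psi>" and B: "\<And>x. \<bar>\<psi> x\<bar> \<le> B" and K: "\<And>k x. \<bar>Lie (u k) \<psi> x\<bar> \<le> K" and t: "0 \<le> t"
  defines "q \<equiv> \<lambda>s \<tau>. let (x, k) = switching_process u s \<tau> t in if k = i then \<psi> x else 0"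
  shows "\<bar>(\<integral>\<tau>. q (x, i) \<tau> \<partial>W) - exp (- r * t) * \<psi> (flow (u i) t x)\<bar> \<le> B * (r * t)\<^sup>2" (is ?stay)
    and "\<bar>(\<integral>\<tau>. q (x, 1 - i) \<tau> \<partial>W) - (1 - exp (- r * t)) * \<psi> x\<bar> \<le> 2 * K * r * t\<^sup>2 + 2 * B * (r * t)\<^sup>2" (is ?switch)
proof -
  interpret W: prob_space W by (rule prob_space_waiting_times[OF r])
  have [measurable]: "\<psi> \<in> borel_measurable borel"
    by (rule borel_measurable_continuous_torus[OF torus_C1_continuous[OF \<psi>]])
  define \<epsilon> where "\<epsilon> = 1 - exp (- r * t)"
  have rt: "0 \<le> r * t" using r t by simp
  have \<epsilon>: "0 \<le> \<epsilon>" "\<epsilon> \<le> r * t"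
    using rt exp_ge_add_one_self[of "- r * t"] by (auto simp: \<epsilon>_def)
  have B0: "0 \<le> B" using order_trans[OF abs_ge_zero B] .
  have K0: "0 \<le> K" using order_trans[OF abs_ge_zero K] .
  \<comment> \<open>Up to a null set, outside of \<open>bad\<close> there is no second switch before \<open>t\<close>; outside of \<open>early\<close> there is no switch at all.\<close>
  define early where "early = {\<tau> :: nat \<Rightarrow> real. \<tau> 0 \<le> t}"
  define bad where "bad = {\<tau> :: nat \<Rightarrow> real. \<tau> 0 \<le> t \<and> \<tau> 1 \<le> t}"
  have sets: "early \<in> sets W" "bad \<in> sets W"
  proof -
    have "{\<tau> \<in> space W. \<tau> 0 \<le> t} \<in> sets W" "{\<tau> \<in> space W. \<tau> 0 \<le> t \<and> \<tau> 1 \<le> t} \<in> sets W" by measurable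
    then show "early \<in> sets W" "bad \<in> sets W" by (simp_all add: early_def bad_def space_waiting_times)
  qed
  have me: "measure W early = \<epsilon>" "measure W bad = \<epsilon>\<^sup>2"
    using prob_first_switch[OF t] prob_two_short_times[OF t] by (simp_all add: early_def bad_def \<epsilon>_def)
  have ind: "integrable W (indicator early :: _ \<Rightarrow> real)" "integrable W (indicator bad :: _ \<Rightarrow> real)"
    using sets by (auto simp: W.emeasure_eq_measure)
  have qm: "q s \<in> borel_measurable W" for s
  proof -
    have "(\<lambda>(x, k). if k = i then \<psi> x else 0) \<in> borel_measurable state_space"
      unfolding state_space_def by measurable
    from measurable_compose[OF measurable_switching_process_path this]
    show ?thesis by (simp add: q_def Let_def)
  qed
  have qB: "\<bar>q s \<tau>\<bar> \<le> B" for s \<tau>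
    using B B0 by (auto simp: q_def Let_def split: prod.split)
  have qi: "integrable W (q s)" for s
    by (rule W.integrable_const_bound[of _ B]) (use qB qm in auto)
  have e: "exp (- r * t) = 1 - \<epsilon>" by (simp add: \<epsilon>_def)
  have \<epsilon>2: "\<epsilon>\<^sup>2 \<le> (r * t)\<^sup>2" using \<epsilon> by (intro power_mono) auto
  show ?stay
  proof -
    let ?c = "\<psi> (flow (u i) t x)"
    have "AE \<tau> in W. \<bar>q (x, i) \<tau> - ?c * (1 - indicator early \<tau>)\<bar> \<le> B * indicator bad \<tau>"
      using AE_waiting_time_nonneg
    proof eventually_elim
      case (elim \<tau>)
      consider "t < \<tau> 0" | "\<tau> 0 \<le> t" "t < \<tau> 0 + \<tau> 1" | "\<tau> 0 \<le> t" "\<tau> 0 + \<tau> 1 \<le> t" by linarith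
      then show ?case
      proof cases
        case 1
        then have "\<tau> \<notin> early" "\<tau> \<notin> bad" by (auto simp: early_def bad_def)
        then show ?thesis using switching_process_before_first_switch[of t \<tau> x i, OF 1] by (simp add: q_def)
      next
        case 2
        then have "\<tau> \<in> early" by (auto simp: early_def)
        then show ?thesis
          using switching_process_after_first_switch[OF 2, of x i] B0 other_neq[of i] by (simp add: q_def)
      next
        case 3
        then have "\<tau> \<in> early" "\<tau> \<in> bad" using elim by (auto simp: early_def bad_def)
        then show ?thesis using qB by simp
      qed
    qed
    then have f1: "(\<integral>\<tau>. \<bar>q (x, i) \<tau> - ?c * (1 - indicator early \<tau>)\<bar> \<partial>W) \<le> (\<integral>\<tau>. B * indicator bad \<tau> \<partial>W)"
      using qi ind by (intro integral_mono_AE) auto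
    have f2: "\<bar>\<integral>\<tau>. q (x, i) \<tau> - ?c * (1 - indicator early \<tau>) \<partial>W\<bar> \<le>
        (\<integral>\<tau>. \<bar>q (x, i) \<tau> - ?c * (1 - indicator early \<tau>)\<bar> \<partial>W)"
      by (rule integral_abs_bound)
    have f3: "(\<integral>\<tau>. B * indicator bad \<tau> \<partial>W) = B * \<epsilon>\<^sup>2"
      using sets by (simp add: me space_waiting_times)
    have f4: "(\<integral>\<tau>. q (x, i) \<tau> - ?c * (1 - indicator early \<tau>) \<partial>W) = (\<integral>\<tau>. q (x, i) \<tau> \<partial>W) - ?c * (1 - \<epsilon>)"
      using qi ind sets by (simp add: me space_waiting_times W.prob_space[unfolded space_waiting_times])
    have f5: "B * \<epsilon>\<^sup>2 \<le> B * (r * t)\<^sup>2" using \<epsilon>2 B0 by (rule mult_left_mono)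
    show ?thesis
      unfolding e mult.commute[of "1 - \<epsilon>"] using f1[unfolded f3] f2[unfolded f4] f5 by linarith
  qed
  show ?switch
  proof -
    \<comment> \<open>Two flows over a total time of at most \<open>2 t\<close> change \<open>\<psi>\<close> by \<open>O(t)\<close>.\<close>
    have near: "\<bar>\<psi> (flow (u i) a (flow (u (1 - i)) b x)) - \<psi> x\<bar> \<le> 2 * K * t"
      if "0 \<le> a" "0 \<le> b" "a \<le> t" "b \<le> t" for a b
    proof -
      interpret i: smooth_field "u i" by unfold_locales (rule u_smooth)
      interpret j: smooth_field "u (1 - i)" by unfold_locales (rule u_smooth)
      have "\<bar>\<psi> (flow (u i) a (flow (u (1 - i)) b x)) - \<psi> (flow (u (1 - i)) b x)\<bar> \<le> K * \<bar>a\<bar>"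
        by (rule i.flow_increment_bound[OF \<psi> K])
      moreover have "\<bar>\<psi> (flow (u (1 - i)) b x) - \<psi> x\<bar> \<le> K * \<bar>b\<bar>"
        by (rule j.flow_increment_bound[OF \<psi> K])
      moreover have "K * \<bar>a\<bar> \<le> K * t" "K * \<bar>b\<bar> \<le> K * t"
        using that K0 by (auto intro!: mult_left_mono)
      ultimately show ?thesis by linarith
    qed
    have "AE \<tau> in W. \<bar>q (x, 1 - i) \<tau> - \<psi> x * indicator early \<tau>\<bar> \<le>
        2 * K * t * indicator early \<tau> + 2 * B * indicator bad \<tau>"
      using AE_waiting_time_nonneg
    proof eventually_elim
      case (elim \<tau>)
      consider "t < \<tau> 0" | "\<tau> 0 \<le> t" "t < \<tau> 0 + \<tau> 1" | "\<tau> 0 \<le> t" "\<tau> 0 + \<tau> 1 \<le> t" by linarith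
      then show ?case
      proof cases
        case 1
        then have "\<tau> \<notin> early" "\<tau> \<notin> bad" by (auto simp: early_def bad_def)
        then show ?thesis
          using switching_process_before_first_switch[of t \<tau> x "1 - i", OF 1] other_neq[of i] by (simp add: q_def)
      next
        case 2
        then have e: "\<tau> \<in> early" by (auto simp: early_def)
        have "q (x, 1 - i) \<tau> = \<psi> (flow (u i) (t - \<tau> 0) (flow (u (1 - i)) (\<tau> 0) x))"
          using switching_process_after_first_switch[OF 2, of x "1 - i"] by (simp add: q_def)
        moreover have "0 \<le> 2 * B * indicator bad \<tau>" using B0 by simp
        ultimately show ?thesis using near[of "t - \<tau> 0" "\<tau> 0"] elim 2 e by simp
      next
        case 3
        then have "\<tau> \<in> early" "\<tau> \<in> bad" using elim by (auto simp: early_def bad_def)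
        moreover have "0 \<le> 2 * K * t" using K0 t by simp
        ultimately show ?thesis using qB[of "(x, 1 - i)" \<tau>] B[of x] by simp
      qed
    qed
    then have f1: "(\<integral>\<tau>. \<bar>q (x, 1 - i) \<tau> - \<psi> x * indicator early \<tau>\<bar> \<partial>W) \<le>
        (\<integral>\<tau>. 2 * K * t * indicator early \<tau> + 2 * B * indicator bad \<tau> \<partial>W)"
      using qi ind by (intro integral_mono_AE) auto
    have f2: "\<bar>\<integral>\<tau>. q (x, 1 - i) \<tau> - \<psi> x * indicator early \<tau> \<partial>W\<bar> \<le>
        (\<integral>\<tau>. \<bar>q (x, 1 - i) \<tau> - \<psi> x * indicator early \<tau>\<bar> \<partial>W)"
      by (rule integral_abs_bound)
    have f3: "(\<integral>\<tau>. 2 * K * t * indicator early \<tau> + 2 * B * indicator bad \<tau> \<partial>W) = 2 * K * t * \<epsilon> + 2 * B * \<epsilon>\<^sup>2"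
      using ind sets by (simp add: me space_waiting_times)
    have f4: "(\<integral>\<tau>. q (x, 1 - i) \<tau> - \<psi> x * indicator early \<tau> \<partial>W) = (\<integral>\<tau>. q (x, 1 - i) \<tau> \<partial>W) - \<psi> x * \<epsilon>"
      using qi ind sets by (simp add: me space_waiting_times)
    have f5: "2 * B * \<epsilon>\<^sup>2 \<le> 2 * B * (r * t)\<^sup>2" using \<epsilon>2 B0 by (intro mult_left_mono) auto
    have f6: "2 * K * t * \<epsilon> \<le> 2 * K * t * (r * t)" using \<epsilon> K0 t by (intro mult_left_mono) auto
    have f7: "2 * K * t * (r * t) = 2 * K * r * t\<^sup>2" by (simp add: power2_eq_square)
    show ?thesis
      unfolding \<epsilon>_def[symmetric] mult.commute[of \<epsilon>]
      using f1[unfolded f3] f2[unfolded f4] f5 f6 f7 by linarith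
  qed
qed

end

section \<open>Invariance in terms of bounded functions\<close>

lemma measurable_slice:
  assumes "f \<in> state_space \<rightarrow>\<^sub>M N" shows "(\<lambda>x. f (x, j)) \<in> borel \<rightarrow>\<^sub>M N"
  by (rule measurable_Pair1[OF assms[unfolded state_space_def]]) simp

context
  fixes \<mu> :: "(torus \<times> bit) measure"
  assumes sets_\<mu>: "sets \<mu> = sets state_space"
begin

lemma space_of_state_measure: "space \<mu> = UNIV"
  using sets_eq_imp_space_eq[OF sets_\<mu>] by simp

lemma slice_sets: "UNIV \<times> {j} \<in> sets \<mu>"
  by (simp add: sets_\<mu> state_space_def)

lemma measurable_fst_state: "fst \<in> \<mu> \<rightarrow>\<^sub>M borel"
  unfolding measurable_cong_sets[OF sets_\<mu> refl] state_space_def by (rule measurable_fst)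

lemma measurable_fst_slice: "fst \<in> restrict_space \<mu> (UNIV \<times> {j}) \<rightarrow>\<^sub>M borel"
  by (rule measurable_restrict_space1[OF measurable_fst_state])

lemma nn_integral_state_split:
  assumes f: "f \<in> borel_measurable state_space"
  shows "(\<integral>\<^sup>+ s. f s \<partial>\<mu>) = (\<Sum>j\<in>{0, 1}. \<integral>\<^sup>+ x. f (x, j) \<partial>component_measure \<mu> j)"
proof -
  have fm: "f \<in> borel_measurable \<mu>"
    using f by (simp add: measurable_cong_sets[OF sets_\<mu> refl])
  have slice: "(\<integral>\<^sup>+ x. f (x, j) \<partial>component_measure \<mu> j) = (\<integral>\<^sup>+ s. f s * indicator (UNIV \<times> {j}) s \<partial>\<mu>)" for j
  proof -
    have "(\<integral>\<^sup>+ x. f (x, j) \<partial>component_measure \<mu> j) = (\<integral>\<^sup>+ s. f (fst s, j) \<partial>restrict_space \<mu> (UNIV \<times> {j}))"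
      unfolding component_measure_def by (rule nn_integral_distr[OF measurable_fst_slice]) (simp add: measurable_slice[OF f])
    also have "\<dots> = (\<integral>\<^sup>+ s. f (fst s, j) * indicator (UNIV \<times> {j}) s \<partial>\<mu>)"
      by (rule nn_integral_restrict_space) (simp add: space_of_state_measure slice_sets)
    also have "\<dots> = (\<integral>\<^sup>+ s. f s * indicator (UNIV \<times> {j}) s \<partial>\<mu>)"
      by (intro nn_integral_cong) (auto simp: indicator_def)
    finally show ?thesis .
  qed
  have "(\<integral>\<^sup>+ s. f s \<partial>\<mu>) = (\<integral>\<^sup>+ s. f s * indicator (UNIV \<times> {0}) s + f s * indicator (UNIV \<times> {1}) s \<partial>\<mu>)"
    using bit_cases by (intro nn_integral_cong) (auto simp: indicator_def)
  also have "\<dots> = (\<integral>\<^sup>+ s. f s * indicator (UNIV \<times> {0}) s \<partial>\<mu>) + (\<integral>\<^sup>+ s. f s * indicator (UNIV \<times> {1}) s \<partial>\<mu>)"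
    using fm slice_sets by (intro nn_integral_add borel_measurable_times_ennreal borel_measurable_indicator)
  finally show ?thesis by (simp add: slice)
qed

lemma integral_state_split:
  fixes f :: "torus \<times> bit \<Rightarrow> real"
  assumes f: "f \<in> borel_measurable state_space" and int: "integrable \<mu> f"
  shows "(\<integral>s. f s \<partial>\<mu>) = (\<Sum>j\<in>{0, 1}. \<integral>x. f (x, j) \<partial>component_measure \<mu> j)"
proof -
  have slice: "(\<integral>x. f (x, j) \<partial>component_measure \<mu> j) = (\<integral>s. indicator (UNIV \<times> {j}) s *\<^sub>R f s \<partial>\<mu>)" for j
  proof -
    have "(\<integral>x. f (x, j) \<partial>component_measure \<mu> j) = (\<integral>s. f (fst s, j) \<partial>restrict_space \<mu> (UNIV \<times> {j}))"
      unfolding component_measure_def by (rule integral_distr[OF measurable_fst_slice measurable_slice[OF f]])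
    also have "\<dots> = (\<integral>s. indicator (UNIV \<times> {j}) s *\<^sub>R f (fst s, j) \<partial>\<mu>)"
      by (rule integral_restrict_space) (simp add: space_of_state_measure slice_sets)
    also have "\<dots> = (\<integral>s. indicator (UNIV \<times> {j}) s *\<^sub>R f s \<partial>\<mu>)"
      by (intro Bochner_Integration.integral_cong) (auto simp: indicator_def)
    finally show ?thesis .
  qed
  have i: "integrable \<mu> (\<lambda>s. indicator (UNIV \<times> {j}) s *\<^sub>R f s)" for j
    by (rule integrable_mult_indicator[OF slice_sets int])
  have "(\<integral>s. f s \<partial>\<mu>) = (\<integral>s. indicator (UNIV \<times> {0}) s *\<^sub>R f s + indicator (UNIV \<times> {1}) s *\<^sub>R f s \<partial>\<mu>)"
    using bit_cases by (intro Bochner_Integration.integral_cong) (auto simp: indicator_def)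
  also have "\<dots> = (\<integral>s. indicator (UNIV \<times> {0}) s *\<^sub>R f s \<partial>\<mu>) + (\<integral>s. indicator (UNIV \<times> {1}) s *\<^sub>R f s \<partial>\<mu>)"
    by (rule Bochner_Integration.integral_add[OF i i])
  finally show ?thesis by (simp add: slice)
qed

end

context switching_fields
begin

text \<open>Invariance is stated on the sets \<open>E \<times> {i}\<close>.  They determine a measure, so the process started from \<open>\<mu>\<close> has
  law \<open>\<mu>\<close> at time \<open>t\<close>, and invariance can be tested with functions.\<close>

lemma invariant_measure_distr:
  assumes inv: "invariant_measure u r \<mu>" and t: "0 \<le> t"
  shows "distr (\<mu> \<Otimes>\<^sub>M W) state_space (\<lambda>\<omega>. switching_process u (fst \<omega>) (snd \<omega>) t) = \<mu>"
proof -
  interpret W: prob_space W by (rule prob_space_waiting_times[OF r])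
  have sets_\<mu>: "sets \<mu> = sets state_space" using inv by (simp add: invariant_measure_def)
  let ?G = "\<lambda>\<omega>. switching_process u (fst \<omega>) (snd \<omega>) t"
  have G: "?G \<in> \<mu> \<Otimes>\<^sub>M W \<rightarrow>\<^sub>M state_space"
    using measurable_switching_process
    by (simp add: measurable_cong_sets[OF sets_pair_measure_cong[OF sets_\<mu> refl] refl])
  let ?D = "distr (\<mu> \<Otimes>\<^sub>M W) state_space ?G"
  have slice: "emeasure ?D (E \<times> {i}) = emeasure \<mu> (E \<times> {i})" if E: "E \<in> sets borel" for E i
  proof -
    have Ei: "E \<times> {i} \<in> sets state_space" using E by (simp add: state_space_def)
    have path: "emeasure (transition_prob u r t x j) (E \<times> {i}) = emeasure W {\<tau>. switching_process u (x, j) \<tau> t \<in> E \<times> {i}}" for x j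
      unfolding transition_prob_def
      by (subst emeasure_distr[OF measurable_switching_process_path Ei]) (simp add: space_waiting_times vimage_def)
    have pre: "?G -` (E \<times> {i}) \<inter> space (state_space \<Otimes>\<^sub>M W) \<in> sets (state_space \<Otimes>\<^sub>M W)"
      by (rule measurable_sets[OF measurable_switching_process Ei])
    have sp: "space (state_space \<Otimes>\<^sub>M W) = UNIV" "space (\<mu> \<Otimes>\<^sub>M W) = UNIV"
      by (simp_all add: space_pair_measure space_waiting_times space_of_state_measure[OF sets_\<mu>])
    have meas: "(\<lambda>s. emeasure W (Pair s -` (?G -` (E \<times> {i})))) \<in> borel_measurable state_space"
      using W.measurable_emeasure_Pair[OF pre] by (simp add: sp)
    have "emeasure ?D (E \<times> {i}) = emeasure (\<mu> \<Otimes>\<^sub>M W) (?G -` (E \<times> {i}))"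
      by (subst emeasure_distr[OF G Ei]) (simp add: sp)
    also have "\<dots> = (\<integral>\<^sup>+ s. emeasure W (Pair s -` (?G -` (E \<times> {i}))) \<partial>\<mu>)"
      using measurable_sets[OF G Ei] by (intro W.emeasure_pair_measure_alt) (simp add: sp)
    also have "\<dots> = (\<Sum>j\<in>{0, 1}. \<integral>\<^sup>+ x. emeasure W (Pair (x, j) -` (?G -` (E \<times> {i}))) \<partial>component_measure \<mu> j)"
      by (rule nn_integral_state_split[OF sets_\<mu> meas])
    also have "\<dots> = (\<Sum>j\<in>{0, 1}. \<integral>\<^sup>+ x. emeasure (transition_prob u r t x j) (E \<times> {i}) \<partial>component_measure \<mu> j)"
      by (simp add: path vimage_def)
    also have "\<dots> = emeasure \<mu> (E \<times> {i})"
      using inv t E by (simp add: invariant_measure_def)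
    finally show ?thesis .
  qed
  show ?thesis
  proof (rule measure_eqI)
    show "sets ?D = sets \<mu>" by (simp add: sets_\<mu>)
    fix S assume "S \<in> sets ?D"
    then have S: "S \<in> sets state_space" by simp
    let ?S = "\<lambda>j. (\<lambda>x. (x, j)) -` S"
    have Sj: "?S j \<in> sets borel" for j
      using sets_Pair2[OF S[unfolded state_space_def], of j] .
    then have Sj': "?S j \<times> {j} \<in> sets state_space" for j by (simp add: state_space_def)
    have un: "S = (?S 0 \<times> {0}) \<union> (?S 1 \<times> {1})"
    proof (rule set_eqI)
      fix s :: "torus \<times> bit"
      show "s \<in> S \<longleftrightarrow> s \<in> (?S 0 \<times> {0}) \<union> (?S 1 \<times> {1})"
        using bit_cases[of "snd s"] by (cases s) auto
    qed
    have disj: "(?S 0 \<times> {0::bit}) \<inter> (?S 1 \<times> {1}) = {}" by auto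
    have "emeasure N S = emeasure N (?S 0 \<times> {0}) + emeasure N (?S 1 \<times> {1})" if "sets N = sets state_space" for N
      using plus_emeasure[of "?S 0 \<times> {0}" N "?S 1 \<times> {1}"] Sj' that disj un by simp
    from this[of ?D] this[of \<mu>] show "emeasure ?D S = emeasure \<mu> S"
      by (simp add: sets_\<mu> slice[OF Sj])
  qed
qed

text \<open>Test the invariance with \<open>\<psi>\<close> on component \<open>i\<close> and 0 on the other one, expand to first order in time, and
  divide by the time.  A \<open>C\<^sup>1\<close> test function makes all errors uniform in the starting point.\<close>

lemma stationary_equation:
  assumes dens: "invariant_measure u r \<mu>"
    and \<rho>: "\<And>i. \<rho> i \<in> borel_measurable borel" "\<And>i x. 0 \<le> \<rho> i x"
      "\<And>i. component_measure \<mu> i = density torus_lebesgue (\<lambda>x. ennreal (\<rho> i x))"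
  shows integrable_density: "integrable torus_lebesgue (\<rho> i)"
    and "torus_C1 \<psi> \<Longrightarrow> (\<integral>x. \<rho> i x * Lie (u i) \<psi> x \<partial>torus_lebesgue) =
      r * (\<integral>x. \<rho> i x * \<psi> x \<partial>torus_lebesgue) - r * (\<integral>x. \<rho> (1 - i) x * \<psi> x \<partial>torus_lebesgue)"
proof -
  have sets_\<mu>: "sets \<mu> = sets state_space" using dens by (simp add: invariant_measure_def)
  interpret \<mu>: prob_space \<mu> using dens by (simp add: invariant_measure_def)
  interpret W: prob_space W by (rule prob_space_waiting_times[OF r])
  interpret P: pair_prob_space \<mu> W ..
  note [measurable] = \<rho>(1)
  show int\<rho>: "integrable torus_lebesgue (\<rho> i)" for i
  proof (rule integrableI_nonneg)
    have "(\<integral>\<^sup>+ x. ennreal (\<rho> i x) \<partial>torus_lebesgue) = emeasure (component_measure \<mu> i) UNIV"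
      unfolding \<rho>(3) by (subst emeasure_density) auto
    also have "\<dots> = emeasure \<mu> (UNIV \<times> {i})" by (rule emeasure_component_measure[OF sets_\<mu>]) simp
    also have "\<dots> < \<infinity>" by (simp add: \<mu>.emeasure_eq_measure)
    finally show "(\<integral>\<^sup>+ x. ennreal (\<rho> i x) \<partial>torus_lebesgue) < \<infinity>" .
  qed (use \<rho>(2) in auto)
  have comp: "(\<integral>x. f x \<partial>component_measure \<mu> j) = (\<integral>x. \<rho> j x * f x \<partial>torus_lebesgue)"
    if "f \<in> borel_measurable borel" for f :: "torus \<Rightarrow> real" and j
    unfolding \<rho>(3) using that \<rho>(2) by (subst integral_density) auto
  assume \<psi>: "torus_C1 \<psi>"
  interpret i: smooth_field "u i" by unfold_locales (rule u_smooth)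
  have cont: "continuous_on UNIV \<psi>" "continuous_on UNIV (Lie (u k) \<psi>)" for k
    by (intro torus_C1_continuous \<psi> continuous_Lie torus_smooth_continuous u_smooth)+
  have \<psi>m [measurable]: "\<psi> \<in> borel_measurable borel" by (rule borel_measurable_continuous_torus[OF cont(1)])
  obtain B where B: "B > 0" "\<And>x. norm (\<psi> x) \<le> B" using bounded_continuous_torus[OF cont(1)] by metis
  obtain K0 where K0: "\<And>x. norm (Lie (u 0) \<psi> x) \<le> K0" using bounded_continuous_torus[OF cont(2)] by metis
  obtain K1 where K1: "\<And>x. norm (Lie (u 1) \<psi> x) \<le> K1" using bounded_continuous_torus[OF cont(2)] by metis
  define K where "K = max K0 K1"
  have K: "\<bar>Lie (u k) \<psi> x\<bar> \<le> K" for k x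
    using bit_cases[of k] K0[of x] K1[of x] by (auto simp: K_def)
  have BB: "\<bar>\<psi> x\<bar> \<le> B" for x using B(2)[of x] by simp
  define C where "C = 2 * K * r + 3 * B * r\<^sup>2"
  let ?I = "\<lambda>j f. \<integral>x. \<rho> j x * f x \<partial>torus_lebesgue"
  have int_mult: "integrable torus_lebesgue (\<lambda>x. \<rho> j x * f x)"
    if "f \<in> borel_measurable borel" "\<And>x. \<bar>f x\<bar> \<le> b" for f j b
  proof (rule Bochner_Integration.integrable_bound)
    show "integrable torus_lebesgue (\<lambda>x. b * \<rho> j x)" using int\<rho> by simp
    show "AE x in torus_lebesgue. norm (\<rho> j x * f x) \<le> norm (b * \<rho> j x)"
    proof (intro always_eventually allI)
      fix x
      have "\<rho> j x * \<bar>f x\<bar> \<le> \<rho> j x * b" using that(2) \<rho>(2) by (intro mult_left_mono) auto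
      also have "\<dots> \<le> \<bar>b * \<rho> j x\<bar>" by (simp add: mult.commute)
      finally show "norm (\<rho> j x * f x) \<le> norm (b * \<rho> j x)" using \<rho>(2)[of j x] by (simp add: abs_mult)
    qed
  qed (use that in simp)
  have mass: "(\<integral>x. \<rho> j x \<partial>torus_lebesgue) \<le> 1" for j
  proof -
    have "(\<integral>x. \<rho> j x * 1 \<partial>torus_lebesgue) = measure (component_measure \<mu> j) UNIV"
      using comp[of "\<lambda>_. 1" j] by (simp add: \<rho>(3))
    also have "\<dots> = measure \<mu> (UNIV \<times> {j})"
      unfolding measure_def by (simp add: emeasure_component_measure[OF sets_\<mu>])
    also have "\<dots> \<le> 1" by (rule \<mu>.prob_le_1)
    finally show ?thesis by simp
  qed
  \<comment> \<open>Invariance over time \<open>t\<close>, with both transition terms replaced by their short-time approximations.\<close>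
  have small: "\<bar>?I i \<psi> - exp (- r * t) * ?I i (\<lambda>x. \<psi> (flow (u i) t x)) - (1 - exp (- r * t)) * ?I (1 - i) \<psi>\<bar> \<le> 2 * C * t\<^sup>2"
    if t: "0 \<le> t" for t
  proof -
    define \<Psi> where "\<Psi> s = (case s of (x, k) \<Rightarrow> if k = i then \<psi> x else 0)" for s :: "torus \<times> bit"
    have \<Psi>m: "\<Psi> \<in> borel_measurable state_space"
      unfolding \<Psi>_def[abs_def] state_space_def by measurable
    have \<Psi>B: "\<bar>\<Psi> s\<bar> \<le> B" for s using BB B(1) by (auto simp: \<Psi>_def split: prod.split)
    let ?G = "\<lambda>\<omega>. switching_process u (fst \<omega>) (snd \<omega>) t"
    define q where "q s \<tau> = (let (x, k) = switching_process u s \<tau> t in if k = i then \<psi> x else 0)" for s \<tau>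
    have q: "q s \<tau> = \<Psi> (switching_process u s \<tau> t)" for s \<tau>
      by (simp add: q_def \<Psi>_def Let_def)
    define Q where "Q s = (\<integral>\<tau>. q s \<tau> \<partial>W)" for s
    have G\<mu>: "?G \<in> \<mu> \<Otimes>\<^sub>M W \<rightarrow>\<^sub>M state_space"
      using measurable_switching_process
      by (simp add: measurable_cong_sets[OF sets_pair_measure_cong[OF sets_\<mu> refl] refl])
    have qm: "(\<lambda>\<omega>. q (fst \<omega>) (snd \<omega>)) \<in> borel_measurable (\<mu> \<Otimes>\<^sub>M W)"
      unfolding q by (rule measurable_compose[OF G\<mu> \<Psi>m])
    have qm': "(\<lambda>(s, \<tau>). q s \<tau>) \<in> borel_measurable (state_space \<Otimes>\<^sub>M W)"
      unfolding q case_prod_beta' by (rule measurable_compose[OF measurable_switching_process \<Psi>m])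
    have Qm: "Q \<in> borel_measurable state_space"
      unfolding Q_def[abs_def] by (rule W.borel_measurable_lebesgue_integral[OF qm'])
    have QB: "\<bar>Q s\<bar> \<le> B" for s
    proof -
      have "\<bar>Q s\<bar> \<le> (\<integral>\<tau>. \<bar>q s \<tau>\<bar> \<partial>W)" unfolding Q_def by (rule integral_abs_bound)
      also have "\<dots> \<le> (\<integral>\<tau>. B \<partial>W)"
        using \<Psi>B less_imp_le[OF B(1)] measurable_compose[OF measurable_switching_process_path \<Psi>m]
        by (intro integral_mono W.integrable_const_bound[of _ B]) (auto simp: q)
      finally show ?thesis by (simp add: W.prob_space)
    qed
    have comp_split: "(\<integral>s. f s \<partial>\<mu>) = ?I i (\<lambda>x. f (x, i)) + ?I (1 - i) (\<lambda>x. f (x, 1 - i))"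
      if f: "f \<in> borel_measurable state_space" and b: "\<And>s. \<bar>f s\<bar> \<le> B" for f :: "torus \<times> bit \<Rightarrow> real"
    proof -
      have "f \<in> borel_measurable \<mu>" using f by (simp add: measurable_cong_sets[OF sets_\<mu> refl])
      then have fi: "integrable \<mu> f" using b by (intro \<mu>.integrable_const_bound[of _ B]) auto
      have "(\<integral>s. f s \<partial>\<mu>) = (\<Sum>j\<in>{0, 1}. \<integral>x. f (x, j) \<partial>component_measure \<mu> j)"
        by (rule integral_state_split[OF sets_\<mu> f fi])
      also have "\<dots> = (\<Sum>j\<in>{0, 1}. ?I j (\<lambda>x. f (x, j)))"
        by (simp add: comp[OF measurable_slice[OF f]])
      also have "\<dots> = ?I i (\<lambda>x. f (x, i)) + ?I (1 - i) (\<lambda>x. f (x, 1 - i))"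
        using bit_cases[of i] by auto
      finally show ?thesis .
    qed
    have "(\<integral>s. \<Psi> s \<partial>\<mu>) = (\<integral>s. \<Psi> s \<partial>distr (\<mu> \<Otimes>\<^sub>M W) state_space ?G)"
      by (simp add: invariant_measure_distr[OF dens t])
    also have "\<dots> = (\<integral>\<omega>. q (fst \<omega>) (snd \<omega>) \<partial>(\<mu> \<Otimes>\<^sub>M W))"
      unfolding q by (rule integral_distr[OF G\<mu> \<Psi>m])
    also have "\<dots> = (\<integral>s. Q s \<partial>\<mu>)"
    proof -
      have "integrable (\<mu> \<Otimes>\<^sub>M W) (\<lambda>\<omega>. q (fst \<omega>) (snd \<omega>))"
        using \<Psi>B qm by (intro P.integrable_const_bound[of _ B]) (auto simp: q)
      from P.integral_fst'[OF this] show ?thesis by (simp add: Q_def)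
    qed
    finally have "?I i (\<lambda>x. \<Psi> (x, i)) + ?I (1 - i) (\<lambda>x. \<Psi> (x, 1 - i)) = ?I i (\<lambda>x. Q (x, i)) + ?I (1 - i) (\<lambda>x. Q (x, 1 - i))"
      using comp_split[OF \<Psi>m \<Psi>B] comp_split[OF Qm QB] by simp
    then have bal: "?I i \<psi> = ?I i (\<lambda>x. Q (x, i)) + ?I (1 - i) (\<lambda>x. Q (x, 1 - i))"
      using other_neq[of i] by (simp add: \<Psi>_def)
    have K0': "0 \<le> K" using order_trans[OF abs_ge_zero K] .
    have C: "B * (r * t)\<^sup>2 \<le> C * t\<^sup>2" "2 * K * r * t\<^sup>2 + 2 * B * (r * t)\<^sup>2 \<le> C * t\<^sup>2"
      using B(1) r K0' by (auto simp: C_def power_mult_distrib algebra_simps)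
    have d1: "\<bar>Q (x, i) - exp (- r * t) * \<psi> (flow (u i) t x)\<bar> \<le> C * t\<^sup>2" for x
      using short_time_expectation(1)[OF \<psi> BB K t, where i = i and x = x] C(1) by (simp add: Q_def q_def)
    have d2: "\<bar>Q (x, 1 - i) - (1 - exp (- r * t)) * \<psi> x\<bar> \<le> C * t\<^sup>2" for x
      using short_time_expectation(2)[OF \<psi> BB K t, where i = i and x = x] C(2) by (simp add: Q_def q_def)
    have fm: "(\<lambda>x. \<psi> (flow (u i) t x)) \<in> borel_measurable borel" by measurable
    note [measurable] = measurable_slice[OF Qm] fm
    have est: "\<bar>?I j f - ?I j f'\<bar> \<le> C * t\<^sup>2"
      if f: "f \<in> borel_measurable borel" "\<And>x. \<bar>f x\<bar> \<le> B" "f' \<in> borel_measurable borel" "\<And>x. \<bar>f' x\<bar> \<le> B"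
        and d: "\<And>x. \<bar>f x - f' x\<bar> \<le> C * t\<^sup>2" for f f' j
    proof -
      note i1 = int_mult[OF f(1,2), of j] and i2 = int_mult[OF f(3,4), of j]
      have "\<bar>?I j f - ?I j f'\<bar> = \<bar>\<integral>x. \<rho> j x * f x - \<rho> j x * f' x \<partial>torus_lebesgue\<bar>"
        using i1 i2 by simp
      also have "\<dots> \<le> (\<integral>x. \<bar>\<rho> j x * f x - \<rho> j x * f' x\<bar> \<partial>torus_lebesgue)" by (rule integral_abs_bound)
      also have "\<dots> \<le> (\<integral>x. (C * t\<^sup>2) * \<rho> j x \<partial>torus_lebesgue)"
      proof (rule integral_mono)
        fix x
        have "\<bar>\<rho> j x * f x - \<rho> j x * f' x\<bar> = \<rho> j x * \<bar>f x - f' x\<bar>"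
          using \<rho>(2)[of j x] by (simp add: abs_mult flip: right_diff_distrib)
        also have "\<dots> \<le> \<rho> j x * (C * t\<^sup>2)" using d \<rho>(2) by (intro mult_left_mono)
        finally show "\<bar>\<rho> j x * f x - \<rho> j x * f' x\<bar> \<le> (C * t\<^sup>2) * \<rho> j x" by (simp only: mult.commute)
      qed (use i1 i2 int\<rho> in auto)
      also have "\<dots> = (C * t\<^sup>2) * (\<integral>x. \<rho> j x \<partial>torus_lebesgue)" by simp
      also have "\<dots> \<le> (C * t\<^sup>2) * 1"
        using mass order_trans[OF abs_ge_zero d] by (intro mult_left_mono) auto
      finally show ?thesis by simp
    qed
    have e1: "0 \<le> exp (- r * t)" "exp (- r * t) \<le> 1" using r t by auto
    have b1: "\<bar>exp (- r * t) * \<psi> (flow (u i) t x)\<bar> \<le> B" for x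
      unfolding abs_mult using e1 BB[of "flow (u i) t x"] B(1)
        mult_mono[of "\<bar>exp (- r * t)\<bar>" 1 "\<bar>\<psi> (flow (u i) t x)\<bar>" B] by simp
    have b2: "\<bar>(1 - exp (- r * t)) * \<psi> x\<bar> \<le> B" for x
      unfolding abs_mult using e1 BB[of x] B(1)
        mult_mono[of "\<bar>1 - exp (- r * t)\<bar>" 1 "\<bar>\<psi> x\<bar>" B] by simp
    have sc: "?I j (\<lambda>x. c * f x) = c * ?I j f" for c f j
      by (simp only: mult.left_commute[of "\<rho> j _" c] integral_mult_right_zero)
    have "\<bar>?I i (\<lambda>x. Q (x, i)) - ?I i (\<lambda>x. exp (- r * t) * \<psi> (flow (u i) t x))\<bar> \<le> C * t\<^sup>2"
      by (rule est[OF _ QB _ b1 d1]) measurable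
    moreover have "\<bar>?I (1 - i) (\<lambda>x. Q (x, 1 - i)) - ?I (1 - i) (\<lambda>x. (1 - exp (- r * t)) * \<psi> x)\<bar> \<le> C * t\<^sup>2"
      by (rule est[OF _ QB _ b2 d2]) measurable
    moreover have "?I i (\<lambda>x. exp (- r * t) * \<psi> (flow (u i) t x)) = exp (- r * t) * ?I i (\<lambda>x. \<psi> (flow (u i) t x))"
      by (rule sc)
    moreover have "?I (1 - i) (\<lambda>x. (1 - exp (- r * t)) * \<psi> x) = (1 - exp (- r * t)) * ?I (1 - i) \<psi>"
      by (rule sc)
    ultimately show ?thesis using bal by linarith
  qed
  define s where "s n = 1 / real (Suc n)" for n
  have s0: "s \<longlonglongrightarrow> 0" unfolding s_def using LIMSEQ_inverse_real_of_nat by (simp add: inverse_eq_divide)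
  have spos: "s n > 0" for n by (simp add: s_def)
  have sinv: "real (Suc n) * s n = 1" for n by (simp add: s_def)
  let ?c = "\<lambda>n. real (Suc n) * (1 - exp (- r * s n))"
  let ?d = "\<lambda>n. ?I i (\<lambda>x. real (Suc n) * (\<psi> (flow (u i) (s n) x) - \<psi> x))"
  have clim: "?c \<longlonglongrightarrow> r"
  proof -
    have "((\<lambda>h. (exp (- r * (0 + h)) - exp (- r * 0)) / h) \<longlongrightarrow> - r * exp (- r * 0)) (at 0)"
    proof -
      have "DERIV (\<lambda>t. exp (- r * t)) 0 :> - r * exp (- r * 0)"
        by (auto intro!: derivative_eq_intros)
      then show ?thesis by (simp only: DERIV_def)
    qed
    moreover have "filterlim s (at 0) sequentially"
      unfolding filterlim_at using s0 spos less_imp_neq[OF spos] by (auto intro!: always_eventually)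
    ultimately have "(\<lambda>n. (exp (- r * (0 + s n)) - exp (- r * 0)) / s n) \<longlonglongrightarrow> - r * exp (- r * 0)"
      by (rule filterlim_compose)
    from tendsto_minus[OF this] have "(\<lambda>n. - ((exp (- r * s n) - 1) / s n)) \<longlonglongrightarrow> r" by simp
    moreover have "- ((exp (- r * s n) - 1) / s n) = ?c n" for n
      by (simp add: s_def algebra_simps)
    ultimately show ?thesis by simp
  qed
  have dlim: "?d \<longlonglongrightarrow> ?I i (Lie (u i) \<psi>)"
    unfolding s_def by (rule i.difference_quotient_integral_limit[OF \<psi> int\<rho>])
  have elim: "(\<lambda>n. exp (- r * s n)) \<longlonglongrightarrow> 1"
  proof -
    have "(\<lambda>n. exp (- r * s n)) \<longlonglongrightarrow> exp (- r * 0)" by (intro tendsto_intros s0)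
    then show ?thesis by simp
  qed
  have rew: "real (Suc n) * (?I i \<psi> - exp (- r * s n) * ?I i (\<lambda>x. \<psi> (flow (u i) (s n) x)) - (1 - exp (- r * s n)) * ?I (1 - i) \<psi>)
      = ?c n * ?I i \<psi> - exp (- r * s n) * ?d n - ?c n * ?I (1 - i) \<psi>" for n
  proof -
    have m: "(\<lambda>x. \<psi> (flow (u i) (s n) x)) \<in> borel_measurable borel" by measurable
    have "?d n = (\<integral>x. real (Suc n) * (\<rho> i x * \<psi> (flow (u i) (s n) x) - \<rho> i x * \<psi> x) \<partial>torus_lebesgue)"
      by (intro Bochner_Integration.integral_cong refl) (simp add: algebra_simps)
    also have "\<dots> = real (Suc n) * (?I i (\<lambda>x. \<psi> (flow (u i) (s n) x)) - ?I i \<psi>)"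
      using int_mult[OF m BB, of i] int_mult[OF \<psi>m BB, of i] by simp
    finally have d: "?d n = real (Suc n) * (?I i (\<lambda>x. \<psi> (flow (u i) (s n) x)) - ?I i \<psi>)" .
    show ?thesis unfolding d by (simp only: algebra_simps)
  qed
  \<comment> \<open>Divide by \<open>t = s n\<close> and let it tend to 0.\<close>
  have lim0: "(\<lambda>n. ?c n * ?I i \<psi> - exp (- r * s n) * ?d n - ?c n * ?I (1 - i) \<psi>) \<longlonglongrightarrow> 0"
  proof (rule Lim_null_comparison)
    show "\<forall>\<^sub>F n in sequentially. norm (?c n * ?I i \<psi> - exp (- r * s n) * ?d n - ?c n * ?I (1 - i) \<psi>) \<le> 2 * C * s n"
    proof (intro always_eventually allI)
      fix n
      have "norm (?c n * ?I i \<psi> - exp (- r * s n) * ?d n - ?c n * ?I (1 - i) \<psi>) \<le> real (Suc n) * (2 * C * (s n)\<^sup>2)"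
        unfolding rew[symmetric] real_norm_def abs_mult abs_of_nat
        by (intro mult_left_mono small less_imp_le[OF spos]) simp
      also have "\<dots> = (real (Suc n) * s n) * (2 * C * s n)" by (simp add: power2_eq_square)
      finally show "norm (?c n * ?I i \<psi> - exp (- r * s n) * ?d n - ?c n * ?I (1 - i) \<psi>) \<le> 2 * C * s n"
        unfolding sinv by simp
    qed
    show "(\<lambda>n. 2 * C * s n) \<longlonglongrightarrow> 0" using tendsto_mult_right_zero[OF s0] by simp
  qed
  have "(\<lambda>n. ?c n * ?I i \<psi> - exp (- r * s n) * ?d n - ?c n * ?I (1 - i) \<psi>) \<longlonglongrightarrow>
      r * ?I i \<psi> - 1 * ?I i (Lie (u i) \<psi>) - r * ?I (1 - i) \<psi>"
    by (intro tendsto_intros clim dlim elim)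
  from LIMSEQ_unique[OF this lim0] show "?I i (Lie (u i) \<psi>) = r * ?I i \<psi> - r * ?I (1 - i) \<psi>" by simp
qed

end

section \<open>Smoothness of the invariant densities\<close>

theorem theorem1:
  fixes u :: "bit \<Rightarrow> vector_field" and r :: real and \<rho> :: "bit \<Rightarrow> torus \<Rightarrow> real"
  assumes "torus_smooth (u 0)" and "torus_smooth (u 1)"
    and "condition_A (u 0)" and "condition_A (u 1)"
    and "condition_B (u 0) (u 1)"
    and "r > 0"
    and "invariant_densities u r \<rho>"
  shows "\<forall>i. \<exists>g :: torus \<Rightarrow> real. torus_smooth g \<and> (AE x in torus_lebesgue. \<rho> i x = g x)"
proof -
  have u: "torus_smooth (u i)" for i using bit_cases[of i] assms(1,2) by auto
  have A: "condition_A (u i)" for i using bit_cases[of i] assms(3,4) by auto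
  have "span {u 0 x, u 1 x} = UNIV" for x using assms(5) by (simp add: condition_B_def)
  then have "span {u i x, u (1 - i) x} = UNIV" for i x
    using bit_cases[of i] by (auto simp: insert_commute)
  then have tr: "det2 (u i x) (u (1 - i) x) \<noteq> 0" for i x
    by (rule det2_nonzero_if_span)
  have "\<exists>h. torus_smooth h \<and> (\<forall>x. 0 < h x) \<and> flow_invariant (u i) (density torus_lebesgue (\<lambda>x. ennreal (h x)))" for i
    using A[of i] by (auto simp: condition_A_def)
  then obtain h where h: "\<And>i. torus_smooth (h i)" "\<And>i x. 0 < h i x"
    "\<And>i. flow_invariant (u i) (density torus_lebesgue (\<lambda>x. ennreal (h i x)))" by metis
  from assms(7) obtain \<mu> where \<mu>: "invariant_measure u r \<mu>" and \<rho>: "\<And>i. \<rho> i \<in> borel_measurable borel" "\<And>i x. 0 \<le> \<rho> i x"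
      "\<And>i. component_measure \<mu> i = density torus_lebesgue (\<lambda>x. ennreal (\<rho> i x))"
    unfolding invariant_densities_def by blast
  interpret switching_fields u r by unfold_locales (use u assms(6) in auto)
  note int = integrable_density[OF \<mu> \<rho>] and eq = stationary_equation(2)[OF \<mu> \<rho>]
  have cu: "continuous_on UNIV (u i)" for i by (rule torus_smooth_continuous[OF u])
  have step: "\<rho> i \<in> sobolev (u i) (u (1 - i)) (Suc k)"
    if IH: "\<And>i. \<rho> i \<in> sobolev (u i) (u (1 - i)) k" for i k
  proof -
    interpret p: switching_pair "u i" "u (1 - i)" "h i" r
      by unfold_locales (use u h tr assms(6) in auto)
    let ?S = "sobolev (u i) (u (1 - i))"
    note mult = sobolev_mult[OF u u]
    have sub: "\<rho> i \<in> ?S k" "\<rho> (1 - i) \<in> ?S k"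
    proof -
      show "\<rho> i \<in> ?S k" by (rule IH)
      have "\<rho> (1 - i) \<in> sobolev (u (1 - i)) (u i) k"
        using IH[of "1 - i"] by (simp only: other_other)
      then show "\<rho> (1 - i) \<in> ?S k" by (subst sobolev_swap)
    qed
    have ih: "torus_smooth (\<lambda>x. inverse (h i x))"
      using h(2)[of i] by (intro torus_smooth_inverse h) (metis less_irrefl)
    let ?p = "\<lambda>x. inverse (h i x) * \<rho> (1 - i) x"
    have p: "?p \<in> ?S k" by (rule mult[OF sub(2) ih])
    have hp: "h i x * ?p x = \<rho> (1 - i) x" for x
      using h(2)[of i x] by (simp flip: mult.assoc)
    \<comment> \<open>The stationary equation of the other component supplies the extra derivative along its own field.\<close>
    have flux: "weak_div (u (1 - i)) (\<rho> (1 - i)) (\<lambda>x. r * \<rho> i x - r * \<rho> (1 - i) x)"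
      unfolding weak_div_def
    proof (intro conjI allI impI)
      fix \<phi> :: "torus \<Rightarrow> real" assume \<phi>: "torus_C1 \<phi>"
      have "(\<integral>x. (r * \<rho> i x - r * \<rho> (1 - i) x) * \<phi> x \<partial>torus_lebesgue) =
          (\<integral>x. r * (\<rho> i x * \<phi> x) - r * (\<rho> (1 - i) x * \<phi> x) \<partial>torus_lebesgue)"
        by (simp add: left_diff_distrib mult.assoc)
      also have "\<dots> = r * (\<integral>x. \<rho> i x * \<phi> x \<partial>torus_lebesgue) - r * (\<integral>x. \<rho> (1 - i) x * \<phi> x \<partial>torus_lebesgue)"
        using integrable_mult_C1[OF int \<phi>] by simp
      finally show "(\<integral>x. \<rho> (1 - i) x * Lie (u (1 - i)) \<phi> x \<partial>torus_lebesgue) =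
          - (\<integral>x. (r * \<rho> i x - r * \<rho> (1 - i) x) * \<phi> x \<partial>torus_lebesgue)"
        using eq[OF \<phi>, of "1 - i"] by simp
    qed (use int in auto)
    have fluxS: "(\<lambda>x. r * \<rho> i x - r * \<rho> (1 - i) x) \<in> ?S k"
      by (intro sobolev_diff u mult sub torus_smooth_const)
    have dp: "weak_div (u (1 - i)) ?p (\<lambda>x. inverse (h i x) * (r * \<rho> i x - r * \<rho> (1 - i) x) +
        Lie (u (1 - i)) (\<lambda>x. inverse (h i x)) x * \<rho> (1 - i) x)"
      by (rule weak_div_mult[OF flux torus_C1_smooth[OF ih] cu])
    have dS: "(\<lambda>x. inverse (h i x) * (r * \<rho> i x - r * \<rho> (1 - i) x) +
        Lie (u (1 - i)) (\<lambda>x. inverse (h i x)) x * \<rho> (1 - i) x) \<in> ?S k"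
      by (intro sobolev_add cu mult fluxS sub ih torus_smooth_Lie u)
    have "p.push ?p \<in> ?S (Suc k)"
      by (rule p.push_gain[OF p.push_sobolev p dp dS])
    then have hpush: "(\<lambda>x. h i x * p.push ?p x) \<in> ?S (Suc k)" by (rule mult[OF _ h(1)])
    \<comment> \<open>The stationary equation of component \<open>i\<close>, tested with averages, identifies its density with the average.\<close>
    have "AE x in torus_lebesgue. h i x * p.push ?p x - \<rho> i x = 0"
    proof (rule zero_coefficients_AE)
      show "integrable torus_lebesgue (\<lambda>x. h i x * p.push ?p x - \<rho> i x)"
        using sobolev_integrable[OF hpush] int by simp
      fix a b \<theta>
      let ?\<phi> = "wave a b \<theta>"
      have C1: "torus_C1 ?\<phi>" by (rule torus_C1_smooth[OF wave_smooth])
      have av: "torus_C1 (p.average ?\<phi>)" by (rule p.torus_C1_average[OF C1])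
      have "(\<integral>x. h i x * p.push ?p x * ?\<phi> x \<partial>torus_lebesgue) = (\<integral>x. h i x * ?p x * p.average ?\<phi> x \<partial>torus_lebesgue)"
        by (rule p.push_average[OF sobolev_integrable[OF p] torus_C1_continuous[OF C1]])
      then have 1: "(\<integral>x. h i x * p.push ?p x * ?\<phi> x \<partial>torus_lebesgue) = (\<integral>x. \<rho> (1 - i) x * p.average ?\<phi> x \<partial>torus_lebesgue)"
        by (simp only: hp)
      have "(\<integral>x. \<rho> i x * Lie (u i) (p.average ?\<phi>) x \<partial>torus_lebesgue) =
          (\<integral>x. r * (\<rho> i x * p.average ?\<phi> x) - r * (\<rho> i x * ?\<phi> x) \<partial>torus_lebesgue)"
        by (simp add: p.Lie_u_average[OF C1] algebra_simps)
      also have "\<dots> = r * (\<integral>x. \<rho> i x * p.average ?\<phi> x \<partial>torus_lebesgue) - r * (\<integral>x. \<rho> i x * ?\<phi> x \<partial>torus_lebesgue)"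
        using integrable_mult_C1[OF int av] integrable_mult_C1[OF int C1] by simp
      finally have "r * (\<integral>x. \<rho> (1 - i) x * p.average ?\<phi> x \<partial>torus_lebesgue) = r * (\<integral>x. \<rho> i x * ?\<phi> x \<partial>torus_lebesgue)"
        using eq[OF av, of i] by simp
      then have 2: "(\<integral>x. \<rho> (1 - i) x * p.average ?\<phi> x \<partial>torus_lebesgue) = (\<integral>x. \<rho> i x * ?\<phi> x \<partial>torus_lebesgue)"
        using assms(6) by simp
      show "(\<integral>x. (h i x * p.push ?p x - \<rho> i x) * ?\<phi> x \<partial>torus_lebesgue) = 0"
        unfolding left_diff_distrib
        using integrable_mult_C1[OF sobolev_integrable[OF hpush] C1] integrable_mult_C1[OF int C1] 1 2
        by simp
    qed
    then have "AE x in torus_lebesgue. h i x * p.push ?p x = \<rho> i x" by eventually_elim simp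
    then show ?thesis by (rule sobolev_cong_AE[OF hpush _ \<rho>(1) cu cu])
  qed
  have "\<rho> i \<in> sobolev (u i) (u (1 - i)) k" for i k
  proof (induction k arbitrary: i)
    case 0
    show ?case using int by simp
  qed (rule step)
  then show ?thesis
    using smooth_if_all_sobolev[OF u u tr] by blast
qed

end
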